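(* Let $(J,\xi)$ be a Markov additive process on $E\times\mathbb{R}$ ($E$ finite, $J$ irreducible), $Y_t=\exp(\xi_t)$, let $A$ be the extended generator of the Markov process $(J,Y)$ with domain $\mathbb{D}(A)$, let $f:E\times(0,\infty)\to\mathbb{R}$, $f(\alpha,x)=x$, and let $(\mathcal{F}_t)_{t\ge0}$ be the natural filtration of $(J,\xi)$. Then $Y$ is a martingale with respect to $(\mathcal{F}_t)$ if and only if $f\in\mathbb{D}(A)$ and $(Af)(\alpha,1)=0$ for all $\alpha\in E$.
   Context: Let $E$ be a finite set. A càdlàg process $(J_t,\xi_t)_{t\ge0}$ in $E\times\mathbb{R}$ adapted to $(\mathcal{F}_t)$ is a Markov additive process (MAP) if for all bounded continuous $g:E\times\mathbb{R}\to\mathbb{R}^+$ and $s,t>0$, $\mathbb{E}[g(J_{t+s},\xi_{t+s}-\xi_t)\mid\mathcal{F}_t]=\mathbb{E}_{J_t,0}[g(J_s,\xi_s)]$, where $\mathbb{E}_{\alpha,x}$ is expectation given $(J_0,\xi_0)=(\alpha,x)$. The initial state has deterministic $\xi_0$ and arbitrary law of $J_0$. $J$ is an irreducible continuous-time Markov chain with rates $q_{\alpha,\beta}$ ($\alpha\neq\beta$); while $J$ is in state $\alpha$, $\xi$ evolves as an independent copy of a Lévy process $\xi^{(\alpha)}$; when $J$ jumps from $\alpha$ to $\beta$, $\xi$ makes an additional independent jump distributed as $U_{\alpha,\beta}$ ($U_{\alpha,\beta}=0$ if $q_{\alpha,\beta}=0$). Extended generator: $g\in\mathbb{D}(A)$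 if there is a measurable function $Ag$ such that, for every starting point, $g(J_t,Y_t)-g(J_0,Y_0)-\int_0^t(Ag)(J_s,Y_s)\,ds$ is a well-defined $(\mathcal{F}_t)$-martingale. The version of $A$ used is $$(Ag)(\alpha,x)=\big(\mathcal{L}^{(\alpha)}(g(\alpha,\exp(\cdot)))\big)(\log x)+\sum_{\beta\ne\alpha}q_{\alpha,\beta}\big(\mathbb{E}[g(\beta,xe^{U_{\alpha,\beta}})]-g(\alpha,x)\big),$$ where $\mathcal{L}^{(\alpha)}$ is the (extended) generator of $\xi^{(\alpha)}$. In particular, for $f(\alpha,x)=x$, $(Af)(\alpha,x)=x\big(\psi_\alpha(1)+\sum_{\beta\neq\alpha}q_{\alpha,\beta}(\mathbb{E}[e^{U_{\alpha,\beta}}]-1)\big)$, with $\psi_\alpha(1)=\log\mathbb{E}[e^{\xi^{(\alpha)}_1}]$, this expression being required to be finite when $f\in\mathbb{D}(A)$. *)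

theory Defs
  imports "HOL-Probability.Probability"
begin

subsection \<open>Processes indexed by \<open>t \<ge> 0\<close>\<close>

text \<open>Time is \<^typ>\<open>real\<close>; values of a process at negative times are never used.\<close>

definition cadlag :: "(real \<Rightarrow> 'b::topological_space) \<Rightarrow> bool" where
  "cadlag x \<longleftrightarrow>
     (\<forall>t\<ge>0. (x \<longlongrightarrow> x t) (at_right t)) \<and> (\<forall>t>0. \<exists>l. (x \<longlongrightarrow> l) (at_left t))"

definition natural_filtration ::
  "'w measure \<Rightarrow> 'b measure \<Rightarrow> (real \<Rightarrow> 'w \<Rightarrow> 'b) \<Rightarrow> real \<Rightarrow> 'w measure" where
  "natural_filtration M S X t =
     sigma (space M) (\<Union>s\<in>{0..t}. {X s -` B \<inter> space M | B. B \<in> sets S})"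

definition martingale :: "'w measure \<Rightarrow> (real \<Rightarrow> 'w measure) \<Rightarrow> (real \<Rightarrow> 'w \<Rightarrow> real) \<Rightarrow> bool" where
  "martingale M F X \<longleftrightarrow>
     (\<forall>t\<ge>0. subalgebra M (F t) \<and> X t \<in> borel_measurable (F t) \<and> integrable M (X t)) \<and>
     (\<forall>s\<ge>0. \<forall>t\<ge>s. AE w in M. real_cond_exp M (F s) (X t) w = X s w)"

text \<open>\<open>G t - G 0 - \<integral>\<^sub>0\<^sup>t K s ds\<close> is a martingale, the time integral being
  absolutely convergent almost surely.\<close>

definition compensated_martingale ::
  "'w measure \<Rightarrow> (real \<Rightarrow> 'w measure) \<Rightarrow> (real \<Rightarrow> 'w \<Rightarrow> real) \<Rightarrow> (real \<Rightarrow> 'w \<Rightarrow> real) \<Rightarrow> bool" where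
  "compensated_martingale M F G K \<longleftrightarrow>
     (\<forall>t\<ge>0. AE w in M. set_integrable lborel {0..t} (\<lambda>s. K s w)) \<and>
     martingale M F (\<lambda>t w. G t w - G 0 w - (LINT s:{0..t}|lborel. K s w))"


subsection \<open>L\'evy processes\<close>

locale levy_process = prob_space N for N :: "'l measure" +
  fixes X :: "real \<Rightarrow> 'l \<Rightarrow> real"
  assumes measurable_levy: "t \<ge> 0 \<Longrightarrow> X t \<in> borel_measurable N"
    and cadlag_levy: "w \<in> space N \<Longrightarrow> cadlag (\<lambda>t. X t w)"
    and levy_zero: "AE w in N. X 0 w = 0"
    and stationary_increments: "s \<ge> 0 \<Longrightarrow> t \<ge> 0 \<Longrightarrow>
      distr N borel (\<lambda>w. X (s + t) w - X s w) = distr N borel (X t)"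
    and independent_increments: "0 \<le> \<tau> 0 \<Longrightarrow> (\<And>i. i < n \<Longrightarrow> \<tau> i \<le> \<tau> (Suc i)) \<Longrightarrow>
      indep_vars (\<lambda>_. borel) (\<lambda>i w. X (\<tau> (Suc i)) w - X (\<tau> i) w) {..<n::nat}"

text \<open>\<open>k\<close> is the extended generator of the L\'evy process \<open>X\<close> applied to \<open>h\<close>.  The martingale
  property (from every starting point \<open>y\<close>) determines \<open>k\<close> only up to sets of potential zero;
  the last clause selects the version given pointwise by the transition semigroup.  For
  \<open>h = exp\<close> this is \<open>k y = exp y * \<psi>(1)\<close> with \<open>\<psi>(1) = ln (E (exp (X 1)))\<close>, and it exists iff
  \<open>exp (X 1)\<close> is integrable.\<close>

definition levy_generator ::
  "'l measure \<Rightarrow> (real \<Rightarrow> 'l \<Rightarrow> real) \<Rightarrow> (real \<Rightarrow> real) \<Rightarrow> (real \<Rightarrow> real) \<Rightarrow> bool" where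
  "levy_generator N X h k \<longleftrightarrow>
     k \<in> borel_measurable borel \<and>
     (\<forall>y. compensated_martingale N (natural_filtration N borel X)
            (\<lambda>t w. h (y + X t w)) (\<lambda>t w. k (y + X t w))) \<and>
     (\<forall>y. (\<forall>t\<ge>0. integrable N (\<lambda>w. h (y + X t w))) \<and>
          ((\<lambda>t. ((\<integral>w. h (y + X t w) \<partial>N) - h y) / t) \<longlongrightarrow> k y) (at_right 0))"


subsection \<open>Markov additive processes\<close>

text \<open>The finite set \<open>E\<close> is a finite type with the discrete topology.  \<open>P a x\<close> is the law under
  which the process starts from \<open>(a, x)\<close>; all these laws live on the measurable space \<open>M\<close>.\<close>

abbreviation state_space :: "('e \<times> real) measure" where
  "state_space \<equiv> count_space UNIV \<Otimes>\<^sub>M borel"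

locale markov_additive_process =
  fixes M :: "'w measure"
    and P :: "'e::{finite,discrete_topology} \<Rightarrow> real \<Rightarrow> 'w measure"
    and F :: "real \<Rightarrow> 'w measure"
    and J :: "real \<Rightarrow> 'w \<Rightarrow> 'e"
    and \<xi> :: "real \<Rightarrow> 'w \<Rightarrow> real"
  assumes prob_space_P: "prob_space (P a x)"
    and sets_P: "sets (P a x) = sets M"
    and filtration_F: "filtration (space M) F"
    and subalgebra_F: "subalgebra M (F t)"
    and adapted: "t \<ge> 0 \<Longrightarrow> (\<lambda>w. (J t w, \<xi> t w)) \<in> F t \<rightarrow>\<^sub>M state_space"
    and cadlag_paths: "w \<in> space M \<Longrightarrow> cadlag (\<lambda>t. (J t w, \<xi> t w))"
    and start: "AE w in P a x. J 0 w = a \<and> \<xi> 0 w = x"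
    and markov_additive:
      "\<And>(g :: 'e \<times> real \<Rightarrow> real) s t a x.
         continuous_on UNIV g \<Longrightarrow> bounded (range g) \<Longrightarrow> (\<And>z. g z \<ge> 0) \<Longrightarrow> s > 0 \<Longrightarrow> t > 0 \<Longrightarrow>
         AE w in P a x.
           real_cond_exp (P a x) (F t) (\<lambda>w. g (J (t + s) w, \<xi> (t + s) w - \<xi> t w)) w =
           (\<integral>w'. g (J s w', \<xi> s w') \<partial>P (J t w) 0)"

text \<open>The law with \<open>\<xi> 0 = x\<close> and \<open>J 0\<close> distributed according to \<open>\<mu>\<close>.\<close>

definition initial_law :: "('e \<Rightarrow> real \<Rightarrow> 'w measure) \<Rightarrow> 'e pmf \<Rightarrow> real \<Rightarrow> 'w measure" where
  "initial_law P \<mu> x = measure_pmf \<mu> \<bind> (\<lambda>a. P a x)"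


subsection \<open>Characteristics of a Markov additive process\<close>

text \<open>Jump times of a piecewise constant right-continuous path; they equal \<open>\<infinity>\<close> from the first
  jump that does not take place.\<close>

fun jump_time :: "(real \<Rightarrow> 'e) \<Rightarrow> nat \<Rightarrow> ereal" where
  "jump_time z 0 = 0"
| "jump_time z (Suc n) =
     Inf {ereal t | t. jump_time z n < ereal t \<and> z t \<noteq> z (real_of_ereal (jump_time z n))}"

definition jump_count :: "(real \<Rightarrow> 'e) \<Rightarrow> real \<Rightarrow> nat" where
  "jump_count z t = card {n. jump_time z (Suc n) \<le> ereal t}"

text \<open>Given the path \<open>z\<close> of the modulating chain, follow \<open>X \<alpha> n\<close> during the \<open>n\<close>-th sojourn if
  that sojourn is in state \<open>\<alpha>\<close>, and add \<open>V \<alpha> \<beta> n\<close> when it ends by a jump from \<open>\<alpha>\<close> to \<open>\<beta>\<close>.\<close>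

fun concat_at_jump ::
  "(real \<Rightarrow> 'e) \<Rightarrow> ('e \<Rightarrow> nat \<Rightarrow> real \<Rightarrow> real) \<Rightarrow> ('e \<Rightarrow> 'e \<Rightarrow> nat \<Rightarrow> real) \<Rightarrow> nat \<Rightarrow> real" where
  "concat_at_jump z X V 0 = 0"
| "concat_at_jump z X V (Suc n) =
     (let T = real_of_ereal (jump_time z n); T' = real_of_ereal (jump_time z (Suc n))
      in concat_at_jump z X V n + X (z T) n (T' - T) + V (z T) (z T') n)"

definition concat_path ::
  "(real \<Rightarrow> 'e) \<Rightarrow> ('e \<Rightarrow> nat \<Rightarrow> real \<Rightarrow> real) \<Rightarrow> ('e \<Rightarrow> 'e \<Rightarrow> nat \<Rightarrow> real) \<Rightarrow> real \<Rightarrow> real" where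
  "concat_path z X V t =
     (let n = jump_count z t; T = real_of_ereal (jump_time z n)
      in concat_at_jump z X V n + X (z T) n (t - T))"

text \<open>\<open>J\<close> has jump rates \<open>q\<close>; \<open>L \<alpha>\<close> is the L\'evy process \<open>\<xi>\<^sup>(\<^sup>\<alpha>\<^sup>)\<close> and \<open>U \<alpha> \<beta>\<close> the additional jump,
  both on a reference space \<open>N\<close> (of which only the individual laws matter).  The clause
  \<open>structure_law\<close> says that under \<open>P a x\<close> the process \<open>(J, \<xi>)\<close> has the law of the concatenation
  built from \<open>J\<close> and independent copies of the \<open>L \<alpha>\<close> and \<open>U \<alpha> \<beta>\<close>: the copies used in the \<open>n\<close>-th
  sojourn are read off the \<open>n\<close>-th coordinate of two infinite products of \<open>N\<close>, which are
  independent of each other and of \<open>J\<close>.  The diagonal values \<open>q a a\<close> and \<open>U a a\<close> are irrelevant.\<close>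

locale map_characteristics =
  fixes P :: "'e::finite \<Rightarrow> real \<Rightarrow> 'w measure"
    and J :: "real \<Rightarrow> 'w \<Rightarrow> 'e"
    and \<xi> :: "real \<Rightarrow> 'w \<Rightarrow> real"
    and q :: "'e \<Rightarrow> 'e \<Rightarrow> real"
    and N :: "'l measure"
    and L :: "'e \<Rightarrow> real \<Rightarrow> 'l \<Rightarrow> real"
    and U :: "'e \<Rightarrow> 'e \<Rightarrow> 'l \<Rightarrow> real"
  assumes rates: "a \<noteq> b \<Longrightarrow>
      ((\<lambda>t. measure (P a x) {w \<in> space (P a x). J t w = b} / t) \<longlongrightarrow> q a b) (at_right 0)"
    and levy_L: "levy_process N (L a)"
    and measurable_U: "a \<noteq> b \<Longrightarrow> U a b \<in> borel_measurable N"
    and U_zero: "a \<noteq> b \<Longrightarrow> q a b = 0 \<Longrightarrow> AE w in N. U a b w = 0"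
    and structure_law:
      "distr (P a x) (\<Pi>\<^sub>M t\<in>{0..}. state_space) (\<lambda>w. \<lambda>t\<in>{0..}. (J t w, \<xi> t w)) =
       distr (P a x \<Otimes>\<^sub>M ((\<Pi>\<^sub>M n\<in>(UNIV::nat set). N) \<Otimes>\<^sub>M (\<Pi>\<^sub>M n\<in>(UNIV::nat set). N)))
         (\<Pi>\<^sub>M t\<in>{0..}. state_space)
         (\<lambda>(w, l, u). \<lambda>t\<in>{0..}.
            (J t w, x + concat_path (\<lambda>s. J s w) (\<lambda>\<alpha> n s. L \<alpha> s (l n)) (\<lambda>\<alpha> \<beta> n. U \<alpha> \<beta> (u n)) t))"

definition irreducible_rates :: "('e \<Rightarrow> 'e \<Rightarrow> real) \<Rightarrow> bool" where
  "irreducible_rates q \<longleftrightarrow> (\<forall>a b. (a, b) \<in> {(c, d). c \<noteq> d \<and> q c d > 0}\<^sup>*)"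


subsection \<open>The extended generator of \<open>(J, Y)\<close>\<close>

text \<open>Functions on \<open>E \<times> (0,\<infinity>)\<close> are curried and total; only arguments \<open>x > 0\<close> matter, as \<open>Y\<close> is
  positive.\<close>

definition extended_generator ::
  "('e \<Rightarrow> real \<Rightarrow> 'w measure) \<Rightarrow> (real \<Rightarrow> 'w measure) \<Rightarrow> (real \<Rightarrow> 'w \<Rightarrow> 'e) \<Rightarrow> (real \<Rightarrow> 'w \<Rightarrow> real) \<Rightarrow>
   ('e \<Rightarrow> real \<Rightarrow> real) \<Rightarrow> ('e \<Rightarrow> real \<Rightarrow> real) \<Rightarrow> bool" where
  "extended_generator P F J Y g Ag \<longleftrightarrow>
     (\<forall>a. Ag a \<in> borel_measurable (restrict_space borel {0<..})) \<and>
     (\<forall>a x. compensated_martingale (P a x) F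
              (\<lambda>t w. g (J t w) (Y t w)) (\<lambda>t w. Ag (J t w) (Y t w)))"

definition extended_domain ::
  "('e \<Rightarrow> real \<Rightarrow> 'w measure) \<Rightarrow> (real \<Rightarrow> 'w measure) \<Rightarrow> (real \<Rightarrow> 'w \<Rightarrow> 'e) \<Rightarrow> (real \<Rightarrow> 'w \<Rightarrow> real) \<Rightarrow>
   ('e \<Rightarrow> real \<Rightarrow> real) set" where
  "extended_domain P F J Y = {g. \<exists>Ag. extended_generator P F J Y g Ag}"

text \<open>\<open>Ag\<close> is given by the explicit expression in terms of the characteristics, all the
  terms of which are well-defined and finite.  For \<open>g a x = x\<close> this reads
  \<open>Ag a x = x * (\<psi>\<^sub>a(1) + (\<Sum>b\<noteq>a. q a b * (E (exp (U a b)) - 1)))\<close>.\<close>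

definition generator_formula ::
  "('e::finite \<Rightarrow> 'e \<Rightarrow> real) \<Rightarrow> 'l measure \<Rightarrow> ('e \<Rightarrow> real \<Rightarrow> 'l \<Rightarrow> real) \<Rightarrow> ('e \<Rightarrow> 'e \<Rightarrow> 'l \<Rightarrow> real) \<Rightarrow>
   ('e \<Rightarrow> real \<Rightarrow> real) \<Rightarrow> ('e \<Rightarrow> real \<Rightarrow> real) \<Rightarrow> bool" where
  "generator_formula q N L U g Ag \<longleftrightarrow>
     (\<forall>a. \<exists>k. levy_generator N (L a) (\<lambda>y. g a (exp y)) k \<and>
        (\<forall>x>0. (\<forall>b. b \<noteq> a \<longrightarrow> integrable N (\<lambda>w. g b (x * exp (U a b w)))) \<and>
           Ag a x = k (ln x) +
             (\<Sum>b\<in>UNIV - {a}. q a b * ((\<integral>w. g b (x * exp (U a b w)) \<partial>N) - g a x))))"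

end

theory Submission
  imports Defs
begin

text \<open>
  \<open>Y = exp \<xi>\<close> is a martingale exactly when \<open>h\<^sub>s(b) = E\<^sub>b\<^sub>,\<^sub>0 Y\<^sub>s\<close> equals 1 for all states \<open>b\<close> and
  times \<open>s\<close>.  Indeed Markov additivity gives \<open>E[Y\<^sub>t\<^sub>+\<^sub>s; A] = E[Y\<^sub>t h\<^sub>s(J\<^sub>t); A]\<close> for \<open>A \<in> F\<^sub>t\<close>
  (\<open>tilted_markov_property_total\<close>).  If \<open>h = 1\<close>, this is the martingale property under every
  starting point.  If \<open>Y\<close> is a martingale under a single initial law, take \<open>A = {J\<^sub>t = b}\<close> for a
  time \<open>t\<close> at which this event has positive probability by irreducibility: a positive finite number is multiplied
  by \<open>h\<^sub>s(b)\<close> and does not change (\<open>martingale_unit_mean\<close>).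

  So for a martingale \<open>Y\<close> the function 0 is a version of \<open>A f\<close>, and the point is that the explicit
  formula is finite and vanishes too (\<open>unit_mean_balance\<close>).  This is read off from
  \<open>1 = E\<^sub>a\<^sub>,\<^sub>0 Y\<^sub>t\<close> for small \<open>t\<close>, split by the jumps of \<open>J\<close> up to \<open>t\<close>.  If \<open>J\<close> stays in \<open>a\<close>, then
  \<open>\<xi>\<close> is a Levy path independent of \<open>J\<close>, which contributes \<open>P(J stays in a) exp(c\<^sub>a t)\<close>, where
  \<open>exp(c\<^sub>a t) = E exp(L\<^sub>a(t))\<close>.  If \<open>J\<close> makes one jump, to \<open>b\<close>, then \<open>\<xi>\<close> is a sum of two Levy
  increments and \<open>U\<^sub>a\<^sub>b\<close>, and the contribution is \<open>P(one jump, to b) E exp(U\<^sub>a\<^sub>b)\<close> up to a factor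
  between \<open>exp(-C t)\<close> and \<open>exp(C t)\<close>.  Two or more jumps contribute \<open>O(t\<^sup>2)\<close>.  As the total is 1, all
  these expectations are finite; subtracting 1, dividing by \<open>t\<close> and letting \<open>t\<close> tend to 0 leaves
  \<open>c\<^sub>a + \<Sum>\<^sub>b q\<^sub>a\<^sub>b (E exp(U\<^sub>a\<^sub>b) - 1) = 0\<close>.

  The bound for two jumps is required under the given law and under the law tilted by the density
  \<open>Y\<^sub>t\<close>.  Both make \<open>J\<close> a Markov chain that leaves its state during a time step \<open>h\<close> with
  probability \<open>O(h)\<close>, so one argument serves both: a union bound over pairs of steps of a dyadic
  grid (\<open>emeasure_jumps_twice_le\<close>, \<open>tilted_jumps_twice_le\<close>).

  For the Levy processes, \<open>exp\<close> has to be shown to lie in the domain of the generator with image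
  \<open>c exp\<close>; this rests on the independence of an increment from the natural filtration
  (\<open>increment_independent_of_past\<close>, \<open>levy_generator_exp\<close>).

  Conversely the explicit formula is homogeneous of degree one in \<open>x\<close>, hence \<open>A f\<close> vanishes on
  \<open>E \<times> (0,\<infinity>)\<close> as soon as it vanishes at \<open>x = 1\<close>; the compensator of \<open>Y\<close> is then zero.
\<close>

section \<open>Laws, natural filtrations and martingales\<close>

text \<open>If \<open>Y\<close> were not measurable, some set and its complement would both have non-measurable preimages,
  hence both be null for \<open>distr B S Y\<close>; but the law of \<open>X\<close> has total mass one.  This is how the
  measurability of the concatenated path is obtained from the law it is assumed to have.\<close>

lemma measurable_of_distr_eq:
  assumes X: "X \<in> measurable A S" and A: "prob_space A"
    and Y: "Y \<in> space B \<rightarrow> space S"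
    and eq: "distr A S X = distr B S Y"
  shows "Y \<in> measurable B S"
proof (rule measurableI)
  show "Y w \<in> space S" if "w \<in> space B" for w using Y that by auto
next
  fix D assume D: "D \<in> sets S"
  interpret A: prob_space A by fact
  have null: "emeasure A (X -` C \<inter> space A) = 0" if C: "C \<in> sets S" and N: "Y -` C \<inter> space B \<notin> sets B" for C
  proof -
    have "emeasure A (X -` C \<inter> space A) = emeasure (distr B S Y) C"
      using emeasure_distr[OF X C] eq by simp
    also have "\<dots> = 0"
      using N by (auto simp: distr_def emeasure_measure_of_conv emeasure_notin_sets)
    finally show ?thesis .
  qed
  show "Y -` D \<inter> space B \<in> sets B"
  proof (rule ccontr)
    assume N: "Y -` D \<inter> space B \<notin> sets B"
    have eqB: "Y -` D \<inter> space B = space B - Y -` (space S - D) \<inter> space B"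
      using Y by auto
    have N': "Y -` (space S - D) \<inter> space B \<notin> sets B"
    proof
      assume "Y -` (space S - D) \<inter> space B \<in> sets B"
      then have "space B - Y -` (space S - D) \<inter> space B \<in> sets B" by blast
      with N eqB show False by simp
    qed
    have "space A = (X -` D \<inter> space A) \<union> (X -` (space S - D) \<inter> space A)"
      using measurable_space[OF X] by auto
    then have "emeasure A (space A) \<le> emeasure A (X -` D \<inter> space A) + emeasure A (X -` (space S - D) \<inter> space A)"
      using emeasure_subadditive[of "X -` D \<inter> space A" A "X -` (space S - D) \<inter> space A"]
        measurable_sets[OF X D] measurable_sets[OF X sets.compl_sets[OF D]] by simp
    then show False using null[OF D N] null[OF sets.compl_sets[OF D] N'] A.emeasure_space_1 by simp
  qed
qed

lemma space_natural_filtration [simp]: "space (natural_filtration M S X t) = space M"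
  unfolding natural_filtration_def by (rule space_measure_of) auto

lemma measurable_natural_filtration:
  assumes "0 \<le> s" "s \<le> t" "\<And>w. w \<in> space M \<Longrightarrow> X s w \<in> space S"
  shows "X s \<in> measurable (natural_filtration M S X t) S"
proof (rule measurableI)
  show "X s w \<in> space S" if "w \<in> space (natural_filtration M S X t)" for w
    using assms that by simp
  fix B assume "B \<in> sets S"
  then show "X s -` B \<inter> space (natural_filtration M S X t) \<in> sets (natural_filtration M S X t)"
    using assms(1,2) unfolding space_natural_filtration unfolding natural_filtration_def
    by (subst sets_measure_of) (auto intro!: sigma_sets.Basic bexI[of _ s] exI[of _ B])
qed

lemma subalgebra_natural_filtration:
  assumes "\<And>s. 0 \<le> s \<Longrightarrow> s \<le> t \<Longrightarrow> X s \<in> measurable M S"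
  shows "subalgebra M (natural_filtration M S X t)"
  unfolding subalgebra_def
proof
  show "sets (natural_filtration M S X t) \<subseteq> sets M"
    unfolding natural_filtration_def
    by (subst sets_measure_of) (auto intro!: sets.sigma_sets_subset measurable_sets[OF assms])
qed simp

text \<open>Reduces identities between measures on the natural filtration to finite-dimensional cylinders of
  the path space.\<close>

lemma natural_filtration_path_events:
  assumes A: "A \<in> sets (natural_filtration M S X t)"
    and X: "\<And>s. 0 \<le> s \<Longrightarrow> s \<le> t \<Longrightarrow> X s \<in> space M \<rightarrow> space S"
  obtains B where "B \<in> sets (PiM {0..t} (\<lambda>_. S))"
    "A = (\<lambda>w. \<lambda>s\<in>{0..t}. X s w) -` B \<inter> space M"
proof -
  let ?f = "\<lambda>w. \<lambda>s\<in>{0..t}. X s w"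
  let ?V = "vimage_algebra (space M) ?f (PiM {0..t} (\<lambda>_. S))"
  have f: "?f \<in> space M \<rightarrow> space (PiM {0..t} (\<lambda>_. S))"
    using X by (fastforce simp: space_PiM Pi_iff)
  have "X s -` B \<inter> space M \<in> sets ?V" if s: "s \<in> {0..t}" and B: "B \<in> sets S" for s B
  proof -
    have "(\<lambda>y. y s) -` B \<inter> space (PiM {0..t} (\<lambda>_. S)) \<in> sets (PiM {0..t} (\<lambda>_. S))"
      using s B by measurable
    moreover have "X s -` B \<inter> space M = ?f -` ((\<lambda>y. y s) -` B \<inter> space (PiM {0..t} (\<lambda>_. S))) \<inter> space M"
      using f s by auto
    ultimately show ?thesis
      unfolding sets_vimage_algebra2[OF f] by blast
  qed
  then have "sets (natural_filtration M S X t) \<subseteq> sets ?V"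
    unfolding natural_filtration_def
    by (subst sets_measure_of) (auto intro!: sets.sigma_sets_subset[where M="?V", simplified])
  with A show ?thesis unfolding sets_vimage_algebra2[OF f] using that by blast
qed

lemma (in prob_space) martingaleI:
  assumes sub: "\<And>t. 0 \<le> t \<Longrightarrow> subalgebra M (F t)"
    and meas: "\<And>t. 0 \<le> t \<Longrightarrow> X t \<in> borel_measurable (F t)"
    and int: "\<And>t. 0 \<le> t \<Longrightarrow> integrable M (X t)"
    and eq: "\<And>s t A. 0 \<le> s \<Longrightarrow> s \<le> t \<Longrightarrow> A \<in> sets (F s) \<Longrightarrow>
      (LINT w:A|M. X t w) = (LINT w:A|M. X s w)"
  shows "martingale M F X"
  unfolding martingale_def
proof (intro conjI allI impI)
  fix s t :: real assume s: "0 \<le> s" and t: "s \<le> t"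
  interpret finite_measure_subalgebra M "F s"
    by unfold_locales (rule sub[OF s])
  show "AE w in M. real_cond_exp M (F s) (X t) w = X s w"
    by (rule real_cond_exp_charact) (use eq[OF s t] s t int meas in auto)
qed (use assms in auto)

lemma (in prob_space) martingaleD:
  assumes m: "martingale M F X" and s: "0 \<le> s" "s \<le> t" and A: "A \<in> sets (F s)"
  shows "(LINT w:A|M. X t w) = (LINT w:A|M. X s w)"
proof -
  have sub: "subalgebra M (F s)" and int: "integrable M (X t)" 
    and [measurable]: "X s \<in> borel_measurable M"
    and ae: "AE w in M. real_cond_exp M (F s) (X t) w = X s w"
    using m s by (auto simp: martingale_def intro: measurable_from_subalg)
  interpret finite_measure_subalgebra M "F s"
    by unfold_locales (rule sub)
  have "A \<in> sets M" using A sub by (auto simp: subalgebra_def)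
  note [measurable] = this
  show ?thesis
    using real_cond_exp_intA[OF int A]
      set_lebesgue_integral_cong_AE[of A M "real_cond_exp M (F s) (X t)" "X s"] AE_mp[OF ae]
    by simp
qed

lemma (in prob_space) martingale_minus_initial:
  assumes m: "martingale M F X"
    and Z: "\<And>t. 0 \<le> t \<Longrightarrow> Z \<in> borel_measurable (F t)" "integrable M Z"
  shows "martingale M F (\<lambda>t w. X t w - Z w)"
proof (rule martingaleI)
  have int: "integrable M (X t)" if "0 \<le> t" for t using m that by (auto simp: martingale_def)
  show sub: "subalgebra M (F t)" if "0 \<le> t" for t using m that by (auto simp: martingale_def)
  show "(\<lambda>w. X t w - Z w) \<in> borel_measurable (F t)" if "0 \<le> t" for t
    using m Z(1)[OF that] that by (auto simp: martingale_def)
  show "integrable M (\<lambda>w. X t w - Z w)" if "0 \<le> t" for t using int[OF that] Z(2) by simp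
  fix s t A assume st: "0 \<le> s" "s \<le> t" and A: "A \<in> sets (F s)"
  have "A \<in> sets M" using A sub[OF st(1)] by (auto simp: subalgebra_def)
  then have "set_integrable M A f" if "integrable M f" for f :: "'a \<Rightarrow> real"
    unfolding set_integrable_def by (rule integrable_mult_indicator[OF _ that])
  then show "(LINT w:A|M. X t w - Z w) = (LINT w:A|M. X s w - Z w)"
    using martingaleD[OF m st A] int Z(2) st by simp
qed

text \<open>The difference \<open>r\<close> from the line is additive and vanishes at rational points, so its bound on
  \<open>[0,e]\<close> carries over to the half-line.  Then \<open>r (n t) = n r t\<close> forces \<open>r \<le> 0\<close>, and
  \<open>r t + r (n - t) = r n = 0\<close> forces equality.\<close>

lemma additive_bounded_above_linear:
  fixes g :: "real \<Rightarrow> real"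
  assumes add: "\<And>s t. 0 \<le> s \<Longrightarrow> 0 \<le> t \<Longrightarrow> g (s + t) = g s + g t"
    and e: "0 < e" and bdd: "\<And>t. 0 \<le> t \<Longrightarrow> t \<le> e \<Longrightarrow> g t \<le> K" and t: "0 \<le> t"
  shows "g t = g 1 * t"
proof -
  define r where "r t = g t - g 1 * t" for t
  have radd: "r (s + t) = r s + r t" if "0 \<le> s" "0 \<le> t" for s t
    using add[OF that] by (simp add: r_def algebra_simps)
  have rmul: "r (real n * t) = real n * r t" if "0 \<le> t" for n t
  proof (induction n)
    case 0 show ?case using radd[of 0 0] by simp
  next
    case (Suc n)
    have "r (real (Suc n) * t) = r (real n * t + t)" by (simp add: algebra_simps)
    also have "\<dots> = r (real n * t) + r t" using that by (intro radd) auto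
    finally show ?case using Suc by (simp add: algebra_simps)
  qed
  have r1: "r 1 = 0" by (simp add: r_def)
  have rrat: "r (real m / real n) = 0" if "n > 0" for m n
  proof -
    have "real n * r (real m / real n) = r (real m)"
      using rmul[of "real m / real n" n] that by simp
    also have "\<dots> = 0" using rmul[of 1 m] r1 by simp
    finally show ?thesis using that by simp
  qed
  define B where "B = K + \<bar>g 1\<bar> * e"
  have bdd1: "r s \<le> B" if s: "0 \<le> s" for s
  proof -
    obtain n where n: "n > 0" "1 / real n < e"
      using reals_Archimedean[OF e] by (metis inverse_eq_divide zero_less_Suc)
    define m where "m = nat \<lfloor>s * real n\<rfloor>"
    define d where "d = s - real m / real n"
    have "real m = of_int \<lfloor>s * real n\<rfloor>" using s by (simp add: m_def)
    then have m: "real m \<le> s * real n" "s * real n < real m + 1" by linarith+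
    have d: "0 \<le> d" "d < 1 / real n"
    proof -
      have "real m / real n \<le> s" using m n by (simp add: pos_divide_le_eq)
      then show "0 \<le> d" by (simp add: d_def)
      have "s < (real m + 1) / real n" using m n by (simp add: pos_less_divide_eq)
      then show "d < 1 / real n" by (simp add: d_def add_divide_distrib)
    qed
    have "r s = r (real m / real n + d)" by (simp add: d_def)
    also have "\<dots> = r d" using radd[of "real m / real n" d] rrat[OF n(1), of m] d by simp
    also have "\<dots> \<le> K + \<bar>g 1\<bar> * e"
    proof -
      have "g d \<le> K" using bdd d n by simp
      moreover have "- (g 1 * d) \<le> \<bar>g 1\<bar> * e"
      proof -
        have "- (g 1 * d) \<le> \<bar>g 1\<bar> * d"
          using d(1) by (metis abs_ge_minus_self minus_mult_left mult_right_mono)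
        also have "\<dots> \<le> \<bar>g 1\<bar> * e" using d n by (intro mult_left_mono) auto
        finally show ?thesis .
      qed
      ultimately show ?thesis by (simp add: r_def)
    qed
    finally show ?thesis by (simp add: B_def)
  qed
  have neg: "r s \<le> 0" if s: "0 \<le> s" for s
  proof (rule ccontr)
    assume "\<not> r s \<le> 0"
    then obtain n where "B < real n * r s" using reals_Archimedean3[of "r s"] by auto
    then show False using bdd1[of "real n * s"] rmul[OF s, of n] s by simp
  qed
  obtain n where n: "real n \<ge> t" using real_arch_simple by blast
  have "0 = r (t + (real n - t))" using rmul[of 1 n] r1 by simp
  also have "\<dots> = r t + r (real n - t)" using t n by (intro radd) auto
  finally have "r t = 0" using neg[of t] neg[of "real n - t"] t n by linarith
  then show ?thesis by (simp add: r_def)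
qed

text \<open>Close to 0 the limit bounds the quotient; farther away the bound by 1 is itself linear.\<close>

lemma linear_bound_at_zero:
  fixes F :: "real \<Rightarrow> real"
  assumes lim: "((\<lambda>h. F h / h) \<longlongrightarrow> l) (at_right 0)" and le: "\<And>h. 0 < h \<Longrightarrow> F h \<le> 1"
  obtains K where "K \<ge> 0" "\<And>h. 0 < h \<Longrightarrow> F h \<le> K * h"
proof -
  have "eventually (\<lambda>h. F h / h < l + 1) (at_right 0)"
    by (rule order_tendstoD(2)[OF lim]) simp
  then obtain d where d: "d > 0" "\<And>h. 0 < h \<Longrightarrow> h < d \<Longrightarrow> F h / h < l + 1"
    unfolding eventually_at_right_field by auto
  show ?thesis
  proof (rule that[of "max 0 (max (l + 1) (1 / d))"])
    fix h :: real assume h: "0 < h"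
    show "F h \<le> max 0 (max (l + 1) (1 / d)) * h"
    proof (cases "h < d")
      case True
      then have "F h \<le> (l + 1) * h" using d(2)[OF h] h by (simp add: field_simps)
      also have "\<dots> \<le> max 0 (max (l + 1) (1 / d)) * h" using h by (intro mult_right_mono) auto
      finally show ?thesis .
    next
      case False
      then have "1 \<le> (1 / d) * h" using d by (simp add: field_simps)
      then have "F h \<le> (1 / d) * h" using le[OF h] by linarith
      also have "\<dots> \<le> max 0 (max (l + 1) (1 / d)) * h" using h by (intro mult_right_mono) auto
      finally show ?thesis .
    qed
  qed auto
qed

text \<open>Evaluating the process at the next point of the grid of mesh \<open>1/(n+1)\<close>, cut off at \<open>t\<close>, gives
  jointly measurable approximations which converge by right-continuity.\<close>

lemma right_continuous_progressive:
  fixes K :: "real \<Rightarrow> 'w \<Rightarrow> real"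
  assumes meas: "\<And>s. 0 \<le> s \<Longrightarrow> s \<le> t \<Longrightarrow> K s \<in> borel_measurable G"
    and rc: "\<And>s w. 0 \<le> s \<Longrightarrow> w \<in> space G \<Longrightarrow> ((\<lambda>r. K r w) \<longlongrightarrow> K s w) (at_right s)"
    and t: "0 \<le> t"
  shows "(\<lambda>(s, w). indicator {0..t} s * K s w) \<in> borel_measurable (lborel \<Otimes>\<^sub>M G)"
proof -
  define \<phi> :: "nat \<Rightarrow> real \<Rightarrow> real" where
    "\<phi> n s = max 0 (min t (of_int (\<lfloor>s * real (Suc n)\<rfloor> + 1) / real (Suc n)))" for n s
  have \<phi>_lim: "(\<lambda>n. indicator {0..t} s * K (\<phi> n s) w) \<longlonglongrightarrow> indicator {0..t} s * K s w"
    if w: "w \<in> space G" for s w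
  proof (cases "s \<in> {0..t}")
    case True
    show ?thesis
    proof (cases "s = t")
      case True
      have "\<phi> n s = t" for n
      proof -
        have "t * real (Suc n) \<le> of_int (\<lfloor>t * real (Suc n)\<rfloor> + 1)" by linarith
        then have "t \<le> of_int (\<lfloor>t * real (Suc n)\<rfloor> + 1) / real (Suc n)"
          by (simp add: pos_le_divide_eq)
        \<comment> \<open>At the right end the cut-off returns \<open>t\<close> itself, so that times after \<open>t\<close> are never used.\<close>
        then show ?thesis using t True by (simp add: \<phi>_def)
      qed
      then show ?thesis using True by simp
    next
      case False
      then have st: "0 \<le> s" "s < t" using True by auto
      have up: "s < \<phi> n s" "\<phi> n s \<le> s + 1 / real (Suc n)" for n
      proof -
        have *: "s * real (Suc n) < of_int (\<lfloor>s * real (Suc n)\<rfloor> + 1)"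
          "of_int (\<lfloor>s * real (Suc n)\<rfloor> + 1) \<le> s * real (Suc n) + 1" by linarith+
        then have 1: "s < of_int (\<lfloor>s * real (Suc n)\<rfloor> + 1) / real (Suc n)"
          by (simp add: pos_less_divide_eq)
        from * have "of_int (\<lfloor>s * real (Suc n)\<rfloor> + 1) / real (Suc n) \<le> (s * real (Suc n) + 1) / real (Suc n)"
          by (intro divide_right_mono) auto
        also have "\<dots> = s + 1 / real (Suc n)" by (simp add: add_divide_distrib)
        finally have 2: "of_int (\<lfloor>s * real (Suc n)\<rfloor> + 1) / real (Suc n) \<le> s + 1 / real (Suc n)" .
        show "s < \<phi> n s" "\<phi> n s \<le> s + 1 / real (Suc n)" 
          using 1 2 st by (auto simp: \<phi>_def min_def max_def)
      qed
      have "(\<lambda>n. s + 1 / real (Suc n)) \<longlonglongrightarrow> s + 0"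
        by (intro tendsto_add tendsto_const) (rule LIMSEQ_Suc[OF lim_1_over_n])
      then have "(\<lambda>n. \<phi> n s) \<longlonglongrightarrow> s"
        using up by (intro tendsto_sandwich[of "\<lambda>_. s" "\<lambda>n. \<phi> n s" sequentially "\<lambda>n. s + 1 / real (Suc n)"])
          (auto intro!: always_eventually less_imp_le)
      then have "filterlim (\<lambda>n. \<phi> n s) (at_right s) sequentially"
        using up(1) less_imp_neq[THEN not_sym, OF up(1)] by (simp add: filterlim_at)
      from filterlim_compose[OF rc[OF st(1) w] this] show ?thesis
        by (intro tendsto_mult tendsto_const) (simp add: o_def)
    qed
  qed simp
  show ?thesis
  proof (rule borel_measurable_LIMSEQ_real)
    show "(\<lambda>n. (\<lambda>(s, w). indicator {0..t} s * K (\<phi> n s) w) z) \<longlonglongrightarrow> (\<lambda>(s, w). indicator {0..t} s * K s w) z"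
      if "z \<in> space (lborel \<Otimes>\<^sub>M G)" for z
      using that \<phi>_lim by (cases z) (auto simp: space_pair_measure)
  next
    fix n
    let ?\<psi> = "\<lambda>i::int. max 0 (min t (of_int (i + 1) / real (Suc n)))"
    have [measurable]: "(\<lambda>z. K (?\<psi> i) (snd z)) \<in> borel_measurable (lborel \<Otimes>\<^sub>M G)" for i
      using meas[of "?\<psi> i"] t by (intro measurable_compose[OF measurable_snd]) auto
    have "(\<lambda>z. K (?\<psi> \<lfloor>fst z * real (Suc n)\<rfloor>) (snd z)) \<in> borel_measurable (lborel \<Otimes>\<^sub>M G)"
      by (rule measurable_compose_countable[where f="\<lambda>i z. K (?\<psi> i) (snd z)" and g="\<lambda>z. \<lfloor>fst z * real (Suc n)\<rfloor>"])
         measurable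
    then have [measurable]: "(\<lambda>z. K (\<phi> n (fst z)) (snd z)) \<in> borel_measurable (lborel \<Otimes>\<^sub>M G)"
      by (simp add: \<phi>_def)
    show "(\<lambda>(s, w). indicator {0..t} s * K (\<phi> n s) w) \<in> borel_measurable (lborel \<Otimes>\<^sub>M G)"
      unfolding split_beta' by measurable
  qed
qed

section \<open>Paths with at most one jump\<close>

text \<open>Right-continuity of a path in a discrete space.\<close>

definition right_constant :: "(real \<Rightarrow> 'e) \<Rightarrow> bool" where
  "right_constant z \<longleftrightarrow> (\<forall>s\<ge>0. \<exists>e>0. \<forall>r. s \<le> r \<and> r < s + e \<longrightarrow> z r = z s)"

lemma right_constantD:
  assumes "right_constant z" "0 \<le> s"
  obtains e where "e > 0" "\<And>r. s \<le> r \<Longrightarrow> r < s + e \<Longrightarrow> z r = z s"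
  using assms unfolding right_constant_def by blast

lemma jump_time_le_Suc: "jump_time z n \<le> jump_time z (Suc n)"
  by (auto intro!: Inf_greatest)

lemma jump_time_mono: "m \<le> n \<Longrightarrow> jump_time z m \<le> jump_time z n"
  by (rule lift_Suc_mono_le) (rule jump_time_le_Suc)

text \<open>A right-constant path keeps its value for a little while after \<open>t\<close>, which makes the inequality
  strict.\<close>

lemma next_jump_time_gt:
  assumes z: "right_constant z" and T: "jump_time z n = ereal T" "0 \<le> T" "T \<le> t"
    and const: "\<And>s. T \<le> s \<Longrightarrow> s \<le> t \<Longrightarrow> z s = z T"
  shows "ereal t < jump_time z (Suc n)"
proof -
  obtain e where e: "e > 0" "\<And>r. t \<le> r \<Longrightarrow> r < t + e \<Longrightarrow> z r = z t"
    using right_constantD[OF z, of t] T by auto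
  have "ereal t < ereal (t + e)" using e by simp
  also have "\<dots> \<le> jump_time z (Suc n)"
    unfolding jump_time.simps(2) T
  proof (rule Inf_greatest)
    fix x assume "x \<in> {ereal r |r. ereal T < ereal r \<and> z r \<noteq> z (real_of_ereal (ereal T))}"
    then obtain r where r: "x = ereal r" "T < r" "z r \<noteq> z T" by auto
    have "t + e \<le> r"
    proof (rule ccontr)
      assume "\<not> t + e \<le> r"
      then show False using e(2)[of r] const[of r] const[of t] r T by (cases "r \<le> t") auto
    qed
    then show "ereal (t + e) \<le> x" using r by simp
  qed
  finally show ?thesis .
qed

lemma concat_path_no_jump:
  assumes z: "right_constant z" and t: "0 \<le> t"
    and const: "\<And>s. 0 \<le> s \<Longrightarrow> s \<le> t \<Longrightarrow> z s = a"
  shows "concat_path z X V t = X a 0 t"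
proof -
  have "ereal t < jump_time z (Suc 0)"
    by (rule next_jump_time_gt[OF z, where T=0]) (use t const const[of 0] in \<open>auto simp: zero_ereal_def\<close>)
  then have "ereal t < jump_time z (Suc n)" for n
    using jump_time_mono[of "Suc 0" "Suc n" z] by (auto intro: less_le_trans)
  then have "{n. jump_time z (Suc n) \<le> ereal t} = {}"
    by (auto simp: not_le simp del: jump_time.simps)
  then have "jump_count z t = 0" unfolding jump_count_def by (metis card.empty)
  then show ?thesis using const[of 0] t by (simp add: concat_path_def)
qed

lemma concat_path_one_jump:
  assumes z: "right_constant z" and T: "0 < T" "T \<le> t" and ab: "a \<noteq> b"
    and before: "\<And>s. 0 \<le> s \<Longrightarrow> s < T \<Longrightarrow> z s = a" and after: "\<And>s. T \<le> s \<Longrightarrow> s \<le> t \<Longrightarrow> z s = b"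
  shows "concat_path z X V t = X a 0 T + V a b 0 + X b 1 (t - T)"
proof -
  have z0: "z 0 = a" "z T = b" using before after T by auto
  have 1: "jump_time z (Suc 0) = ereal T"
    unfolding jump_time.simps
  proof (rule antisym)
    show "Inf {ereal t |t. 0 < ereal t \<and> z t \<noteq> z (real_of_ereal 0)} \<le> ereal T"
      by (rule Inf_lower) (use T z0 ab in auto)
    show "ereal T \<le> Inf {ereal t |t. 0 < ereal t \<and> z t \<noteq> z (real_of_ereal 0)}"
    proof (rule Inf_greatest)
      fix x assume "x \<in> {ereal t |t. 0 < ereal t \<and> z t \<noteq> z (real_of_ereal 0)}"
      then obtain r where "x = ereal r" "0 < r" "z r \<noteq> z 0" by auto
      then show "ereal T \<le> x" using before[of r] z0 by (cases "r < T") auto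
    qed
  qed
  have "ereal t < jump_time z (Suc (Suc 0))"
    by (rule next_jump_time_gt[OF z 1]) (use T after z0 in auto)
  then have "ereal t < jump_time z (Suc n)" if "n \<ge> 1" for n
    using jump_time_mono[of "Suc (Suc 0)" "Suc n" z] that by (auto intro: less_le_trans)
  then have "n = 0" if "jump_time z (Suc n) \<le> ereal t" for n
    using that by (metis One_nat_def leD less_one not_le)
  then have "{n. jump_time z (Suc n) \<le> ereal t} = {0}"
    using 1 T by (auto simp del: jump_time.simps)
  then have "jump_count z t = Suc 0" unfolding jump_count_def by (metis card.empty card_insert_disjoint empty_iff finite.emptyI)
  moreover have "jump_time z 0 = 0" by simp
  ultimately show ?thesis using 1 z0
    by (simp add: concat_path_def Let_def del: jump_time.simps)
qed

text \<open>A right-constant path satisfies this if and only if it has at least two jumps up to \<open>t\<close>.  The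
  formulation avoids jump times, so that it can be tested on a grid.\<close>

definition jumps_twice :: "real \<Rightarrow> (real \<Rightarrow> 'e) \<Rightarrow> bool" where
  "jumps_twice t z \<longleftrightarrow> (\<exists>s r. 0 \<le> s \<and> s < r \<and> r \<le> t \<and> z s \<noteq> z 0 \<and> z r \<noteq> z s)"

definition dyadic_jumps_twice :: "real \<Rightarrow> nat \<Rightarrow> (real \<Rightarrow> 'e) \<Rightarrow> bool" where
  "dyadic_jumps_twice t n z \<longleftrightarrow> (\<exists>j\<le>2^n. \<exists>i<j. z (t * real i / 2^n) \<noteq> z 0 \<and> z (t * real j / 2^n) \<noteq> z (t * real i / 2^n))"

text \<open>Every grid point is a point of the next grid, so the events increase with \<open>n\<close>.\<close>

lemma dyadic_jumps_twice_Suc: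
  assumes "dyadic_jumps_twice t n z" shows "dyadic_jumps_twice t (Suc n) z"
proof -
  obtain i j where "j \<le> 2^n" "i < j" "z (t * real i / 2^n) \<noteq> z 0" "z (t * real j / 2^n) \<noteq> z (t * real i / 2^n)"
    using assms by (auto simp: dyadic_jumps_twice_def)
  moreover have "t * real (2 * k) / 2 ^ Suc n = t * real k / 2^n" for k by simp
  ultimately show ?thesis
    unfolding dyadic_jumps_twice_def
    by (intro exI[of _ "2*j"] conjI exI[of _ "2*i"]) simp_all
qed

text \<open>Both times can be moved to the right onto a fine grid without changing the values of the path; a
  time equal to \<open>t\<close> already lies on every grid.\<close>

lemma jumps_twice_iff_dyadic:
  assumes z: "right_constant z" and t: "0 < t"
  shows "jumps_twice t z \<longleftrightarrow> (\<exists>n. dyadic_jumps_twice t n z)"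
proof
  assume "\<exists>n. dyadic_jumps_twice t n z"
  then obtain n and i j :: nat where *: "j \<le> 2^n" "i < j" "z (t * real i / 2^n) \<noteq> z 0" "z (t * real j / 2^n) \<noteq> z (t * real i / 2^n)"
    by (auto simp: dyadic_jumps_twice_def)
  have "real j \<le> 2^n" using *(1) by (metis of_nat_le_iff of_nat_numeral of_nat_power)
  then have "t * real j / 2^n \<le> t" using t by (simp add: field_simps)
  moreover have "t * real i / 2^n < t * real j / 2^n" using *(2) t by (simp add: field_simps)
  moreover have "0 \<le> t * real i / 2^n" using t by simp
  ultimately show "jumps_twice t z" using *(3,4) unfolding jumps_twice_def by blast
next
  assume "jumps_twice t z"
  then obtain s r where sr: "0 \<le> s" "s < r" "r \<le> t" "z s \<noteq> z 0" "z r \<noteq> z s"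
    by (auto simp: jumps_twice_def)
  obtain e1 where e1: "e1 > 0" "\<And>u. s \<le> u \<Longrightarrow> u < s + e1 \<Longrightarrow> z u = z s"
    using right_constantD[OF z, of s] sr by auto
  obtain e2 where e2: "e2 > 0" "\<And>u. r \<le> u \<Longrightarrow> u < r + e2 \<Longrightarrow> z u = z r"
    using right_constantD[OF z, of r] sr by auto
  define e where "e = min (min e1 e2) (r - s)"
  have e: "e > 0" using e1(1) e2(1) sr by (simp add: e_def)
  obtain n where n: "t / 2^n < e"
  proof -
    obtain n where "t / e < 2^n" using real_arch_pow[of 2 "t / e"] by auto
    then have "t < e * 2^n" using e by (simp add: pos_divide_less_eq mult.commute)
    then have "t / 2^n < e" by (simp add: pos_divide_less_eq)
    then show ?thesis by (rule that)
  qed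
  have up: "\<exists>i\<le>2^n. u \<le> t * real i / 2^n \<and> t * real i / 2^n < u + e" if u: "0 \<le> u" "u \<le> t" for u
  proof (intro exI conjI)
    define x where "x = u * 2^n / t"
    have x: "0 \<le> x" "x \<le> 2^n" using u t by (auto simp: x_def field_simps)
    have c: "x \<le> real (nat \<lceil>x\<rceil>)" "real (nat \<lceil>x\<rceil>) < x + 1" using x by linarith+
    show "nat \<lceil>x\<rceil> \<le> 2^n"
    proof -
      have "\<lceil>x\<rceil> \<le> 2^n" using x by (simp add: ceiling_le_iff)
      then show ?thesis using nat_le_iff by auto
    qed
    have eq: "u = t * x / 2^n" using t by (simp add: x_def)
    show "u \<le> t * real (nat \<lceil>x\<rceil>) / 2^n" unfolding eq using c t
      by (intro divide_right_mono mult_left_mono) auto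
    have "t * real (nat \<lceil>x\<rceil>) / 2^n < t * (x + 1) / 2^n"
      using c t by (intro divide_strict_right_mono mult_strict_left_mono) auto
    also have "\<dots> = u + t / 2^n" by (simp add: eq distrib_left add_divide_distrib)
    finally show "t * real (nat \<lceil>x\<rceil>) / 2^n < u + e" using n by linarith
  qed
  obtain i where i: "i \<le> 2^n" "s \<le> t * real i / 2^n" "t * real i / 2^n < s + e" using up[of s] sr by auto
  obtain j where j: "j \<le> 2^n" "r \<le> t * real j / 2^n" "t * real j / 2^n < r + e" using up[of r] sr by auto
  have "t * real i / 2^n < t * real j / 2^n" using i j by (simp add: e_def)
  then have "i < j" using t by (simp add: field_simps)
  moreover have "z (t * real i / 2^n) = z s" using i by (intro e1(2)) (simp_all add: e_def)
  moreover have "z (t * real j / 2^n) = z r" using j by (intro e2(2)) (simp_all add: e_def)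
  ultimately show "\<exists>n. dyadic_jumps_twice t n z"
    using sr(4,5) j(1) unfolding dyadic_jumps_twice_def
    by (intro exI[of _ n] exI[of _ j] conjI exI[of _ i]) simp_all
qed

text \<open>In this form the event is covered by pairs of distinct grid steps, as a union bound requires.\<close>

lemma dyadic_jumps_twice_changes:
  assumes "dyadic_jumps_twice t n z"
  shows "\<exists>l<2^n. \<exists>k<l. z (t * real k / 2^n) \<noteq> z (t * real (Suc k) / 2^n) \<and>
    z (t * real l / 2^n) \<noteq> z (t * real (Suc l) / 2^n)"
proof -
  define y where "y k = z (t * real k / 2^n)" for k
  have change: "\<exists>k. i \<le> k \<and> k < j \<and> y k \<noteq> y (Suc k)" if ij: "i \<le> j" "y i \<noteq> y j" for i j
  proof (rule ccontr)
    assume "\<not> ?thesis"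
    then have eq: "y k = y (Suc k)" if "i \<le> k" "k < j" for k using that by blast
    have "y j = y i" using ij(1)
    proof (induction rule: dec_induct)
      case (step m) then show ?case using eq[of m] by simp
    qed simp
    with ij show False by simp
  qed
  obtain i j where ij: "j \<le> 2^n" "i < j" "y i \<noteq> y 0" "y j \<noteq> y i"
    using assms by (auto simp: dyadic_jumps_twice_def y_def)
  obtain k where k: "k < i" "y k \<noteq> y (Suc k)" using change[of 0 i] ij by auto
  obtain l where l: "i \<le> l" "l < j" "y l \<noteq> y (Suc l)" using change[of i j] ij by auto
  have "l < 2^n" "k < l" using k l ij by auto
  then show ?thesis
    using k(2) l(3) unfolding y_def by blast
qed

lemma not_jumps_twice_constant:
  assumes "\<not> jumps_twice t z" "z 0 = z t" "0 \<le> s" "s \<le> t"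
  shows "z s = z t"
proof (rule ccontr)
  assume ne: "z s \<noteq> z t"
  then have "s < t" using assms(4) by (cases "s = t") auto
  then have "jumps_twice t z"
    using assms(2,3) ne unfolding jumps_twice_def by (intro exI[of _ s] exI[of _ t]) auto
  with assms(1) show False ..
qed

text \<open>The jump time is the infimum of the times at which the path is away from its starting point; by
  right-continuity it is attained, and a further change would be a second jump.\<close>

lemma not_jumps_twice_one_jump:
  assumes z: "right_constant z" and n: "\<not> jumps_twice t z" and t: "0 \<le> t" and ab: "z 0 \<noteq> z t"
  obtains T where "0 < T" "T \<le> t" "\<And>s. 0 \<le> s \<Longrightarrow> s < T \<Longrightarrow> z s = z 0" "\<And>s. T \<le> s \<Longrightarrow> s \<le> t \<Longrightarrow> z s = z t"
proof -
  have alt: "z r = z s" if "0 \<le> s" "s \<le> r" "r \<le> t" "z s \<noteq> z 0" for s r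
  proof (rule ccontr)
    assume ne: "z r \<noteq> z s"
    then have "s < r" using that(2) by (cases "s = r") auto
    then have "jumps_twice t z"
      using that ne unfolding jumps_twice_def by (intro exI[of _ s] exI[of _ r]) auto
    with n show False ..
  qed
  define S where "S = {s. 0 \<le> s \<and> s \<le> t \<and> z s \<noteq> z 0}"
  have tS: "t \<in> S" using ab t by (auto simp: S_def)
  have bdd: "bdd_below S" by (auto simp: S_def bdd_below_def)
  define T where "T = Inf S"
  have T0: "0 \<le> T" unfolding T_def using tS by (intro cInf_greatest) (auto simp: S_def)
  have Tt: "T \<le> t" unfolding T_def by (rule cInf_lower[OF tS bdd])
  have before: "z s = z 0" if "0 \<le> s" "s < T" for s
  proof (rule ccontr)
    assume "z s \<noteq> z 0"
    then have "s \<in> S" using that Tt by (auto simp: S_def)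
    then show False using cInf_lower[OF _ bdd, of s] that by (simp add: T_def)
  qed
  obtain e where e: "e > 0" "\<And>r. T \<le> r \<Longrightarrow> r < T + e \<Longrightarrow> z r = z T"
    using right_constantD[OF z T0] by auto
  obtain s where s: "s \<in> S" "s < T + e"
    using cInf_less_iff[of S "T + e"] tS bdd e by (auto simp: T_def)
  have "T \<le> s" using cInf_lower[OF s(1) bdd] by (simp add: T_def)
  then have "z T \<noteq> z 0" using e(2)[of s] s by (simp add: S_def)
  show ?thesis
  proof (rule that)
    show "0 < T" using \<open>z T \<noteq> z 0\<close> T0 by (cases "T = 0") auto
    show "z s = z t" if "T \<le> s" "s \<le> t" for s
      using alt[of T s] alt[of T t] \<open>z T \<noteq> z 0\<close> T0 Tt that by auto
  qed (fact Tt, fact before)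
qed

section \<open>Exponential moments of Levy processes\<close>

text \<open>Independence is expressed by a product law because \<open>X\<close> and \<open>Y\<close> may take values in different types:
  below, \<open>X\<close> is a path and \<open>Y\<close> a number.\<close>

lemma (in prob_space) product_law_nn_integral_times:
  fixes f :: "'b \<Rightarrow> ennreal" and g :: "'c \<Rightarrow> ennreal"
  assumes ind: "distr M S X \<Otimes>\<^sub>M distr M T Y = distr M (S \<Otimes>\<^sub>M T) (\<lambda>w. (X w, Y w))"
    and [measurable]: "X \<in> measurable M S" "Y \<in> measurable M T"
    and f[measurable]: "f \<in> borel_measurable S" and g[measurable]: "g \<in> borel_measurable T"
  shows "(\<integral>\<^sup>+w. f (X w) * g (Y w) \<partial>M) = (\<integral>\<^sup>+w. f (X w) \<partial>M) * (\<integral>\<^sup>+w. g (Y w) \<partial>M)"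
proof -
  interpret Y: prob_space "distr M T Y" by (rule prob_space_distr) simp
  have "(\<integral>\<^sup>+w. f (X w) * g (Y w) \<partial>M) = (\<integral>\<^sup>+z. f (fst z) * g (snd z) \<partial>distr M (S \<Otimes>\<^sub>M T) (\<lambda>x. (X x, Y x)))"
    by (subst nn_integral_distr) auto
  also have "\<dots> = (\<integral>\<^sup>+z. f (fst z) * g (snd z) \<partial>(distr M S X \<Otimes>\<^sub>M distr M T Y))"
    by (simp add: ind)
  also have "\<dots> = (\<integral>\<^sup>+x. \<integral>\<^sup>+y. f x * g y \<partial>distr M T Y \<partial>distr M S X)"
    by (subst Y.nn_integral_fst[symmetric]) auto
  also have "\<dots> = (\<integral>\<^sup>+x. f x * (\<integral>\<^sup>+y. g y \<partial>distr M T Y) \<partial>distr M S X)"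
    by (subst nn_integral_cmult) auto
  also have "\<dots> = (\<integral>\<^sup>+x. f x \<partial>distr M S X) * (\<integral>\<^sup>+y. g y \<partial>distr M T Y)"
    by (rule nn_integral_multc) simp
  finally show ?thesis by (simp add: nn_integral_distr)
qed

context levy_process
begin

lemma measurable_path: "(\<lambda>w. \<lambda>r\<in>{0..s}. X r w) \<in> measurable N (PiM {0..s} (\<lambda>_. borel))"
  by (intro measurable_restrict measurable_levy) auto

text \<open>Sort the times of the cylinder together with 0 and \<open>s\<close>.  As the process starts at 0, its value at
  each of them is almost surely a sum of increments before \<open>s\<close>, and these are independent of the
  increment after \<open>s\<close>.\<close>

lemma cylinder_independent_increment:
  assumes K: "finite K" "K \<subseteq> {0..s}" and s: "0 \<le> s" "s \<le> u"
    and A: "\<And>i. i \<in> K \<Longrightarrow> A i \<in> sets borel" and B: "B \<in> sets borel"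
  shows "emeasure N {w\<in>space N. (\<forall>i\<in>K. X i w \<in> A i) \<and> X u w - X s w \<in> B} =
    emeasure N {w\<in>space N. \<forall>i\<in>K. X i w \<in> A i} * emeasure N {w\<in>space N. X u w - X s w \<in> B}"
proof -
  define l where "l = sorted_list_of_set (insert 0 (insert s K))"
  define m where "m = length l - 1"
  have l: "sorted l" "set l = insert 0 (insert s K)" using K
    by (simp_all only: l_def sorted_sorted_list_of_set set_sorted_list_of_set finite_insert)
  have len: "length l = Suc m" using l(2) by (cases l) (auto simp: m_def)
  have l_range: "l ! i \<in> {0..s}" if "i \<le> m" for i
    using l(2) that len nth_mem[of i l] K s by auto
  have l0: "l ! 0 = 0"
  proof -
    obtain p where "p < length l" "l ! p = 0" using l(2) by (metis in_set_conv_nth insertI1)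
    then show ?thesis using l_range[of 0] sorted_nth_mono[OF l(1), of 0 p] by auto
  qed
  have lm: "l ! m = s"
  proof -
    obtain p where "p < length l" "l ! p = s" using l(2) by (metis in_set_conv_nth insertI1 insertI2)
    then show ?thesis using l_range[of m] sorted_nth_mono[OF l(1), of p m] len by auto
  qed
  define \<tau> where "\<tau> i = (if i \<le> m then l ! i else u)" for i
  define D where "D i w = X (\<tau> (Suc i)) w - X (\<tau> i) w" for i w
  have ind: "indep_vars (\<lambda>_. borel) D {..<Suc m}"
    unfolding D_def
  proof (rule independent_increments)
    show "0 \<le> \<tau> 0" by (simp add: \<tau>_def l0)
    show "\<tau> i \<le> \<tau> (Suc i)" if "i < Suc m" for i
      using that sorted_nth_mono[OF l(1), of i "Suc i"] len lm s by (auto simp: \<tau>_def not_less_eq_eq le_Suc_eq)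
  qed
  let ?past = "\<lambda>w. restrict (\<lambda>i. D i w) {..<m}" and ?next = "\<lambda>w. restrict (\<lambda>i. D i w) {m}"
  have Dm: "D m w = X u w - X s w" for w by (simp add: D_def \<tau>_def lm)
  have tele: "(\<Sum>k<p. D k w) = X (l ! p) w - X 0 w" if "p \<le> m" for p w
  proof -
    have "(\<Sum>k<p. D k w) = (\<Sum>k<p. X (\<tau> (Suc k)) w - X (\<tau> k) w)" by (simp add: D_def)
    also have "\<dots> = X (\<tau> p) w - X (\<tau> 0) w" by (rule sum_lessThan_telescope)
    finally show ?thesis using that by (simp add: \<tau>_def l0)
  qed
  define pos where "pos i = (SOME p. p \<le> m \<and> l ! p = i)" for i
  have pos: "pos i \<le> m" "l ! (pos i) = i" if "i \<in> K" for i
  proof -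
    have "i \<in> set l" using that l by auto
    then have "\<exists>p. p \<le> m \<and> l ! p = i" using len by (metis in_set_conv_nth less_Suc_eq_le)
    from someI_ex[OF this] show "pos i \<le> m" "l ! (pos i) = i" by (auto simp: pos_def)
  qed
  let ?S = "PiM {..<m} (\<lambda>_. borel :: real measure)" and ?T = "PiM {m} (\<lambda>_. borel :: real measure)"
  let ?f = "\<lambda>d :: nat \<Rightarrow> real. \<Prod>i\<in>K. indicator (A i) (\<Sum>k<pos i. d k) :: ennreal"
  let ?g = "\<lambda>d :: nat \<Rightarrow> real. indicator B (d m) :: ennreal"
  have "indep_var ?S ?past ?T ?next"
    by (rule indep_var_restrict[OF ind]) auto
  then have law: "distr N ?S ?past \<Otimes>\<^sub>M distr N ?T ?next =
      distr N (?S \<Otimes>\<^sub>M ?T) (\<lambda>w. (?past w, ?next w))"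
    and rv: "?past \<in> measurable N ?S" "?next \<in> measurable N ?T"
    by (auto simp: indep_var_distribution_eq)
  have f_meas: "?f \<in> borel_measurable ?S"
  proof (intro borel_measurable_prod_ennreal)
    fix i assume i: "i \<in> K"
    have [measurable]: "A i \<in> sets borel" by (rule A[OF i])
    have [measurable]: "(\<lambda>d. \<Sum>k<pos i. d k) \<in> borel_measurable ?S"
      using pos[OF i] by (intro borel_measurable_sum measurable_component_singleton) auto
    show "(\<lambda>d. indicator (A i) (\<Sum>k<pos i. d k) :: ennreal) \<in> borel_measurable ?S" by measurable
  qed
  have "?g \<in> borel_measurable ?T" using B by measurable
  with f_meas have eq: "(\<integral>\<^sup>+w. ?f (?past w) * ?g (?next w) \<partial>N) =
      (\<integral>\<^sup>+w. ?f (?past w) \<partial>N) * (\<integral>\<^sup>+w. ?g (?next w) \<partial>N)"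
    by (rule product_law_nn_integral_times[OF law rv])
  have [measurable]: "X i \<in> borel_measurable N" if "i \<in> K" for i using that K by (intro measurable_levy) auto
  have [measurable]: "X u \<in> borel_measurable N" "X s \<in> borel_measurable N" using s by (auto intro: measurable_levy)
  note [measurable] = A B
  have f_eq: "AE w in N. ?f (?past w) = indicator {w\<in>space N. \<forall>i\<in>K. X i w \<in> A i} w"
    using levy_zero AE_space
  proof eventually_elim
    case (elim w)
    have "(\<Sum>k<pos i. ?past w k) = X i w" if "i \<in> K" for i
    proof -
      have "(\<Sum>k<pos i. ?past w k) = (\<Sum>k<pos i. D k w)"
        using pos[OF that] by (intro sum.cong) auto
      then show ?thesis using tele[of "pos i" w] pos[OF that] elim by simp
    qed
    then have "?f (?past w) = (\<Prod>i\<in>K. indicator (A i) (X i w))" by simp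
    also have "\<dots> = indicator {w\<in>space N. \<forall>i\<in>K. X i w \<in> A i} w"
    proof (cases "\<forall>i\<in>K. X i w \<in> A i")
      case True
      then have "(\<Prod>i\<in>K. indicator (A i) (X i w) :: ennreal) = 1" by (intro prod.neutral) auto
      then show ?thesis using True elim by simp
    next
      case False
      then show ?thesis using K(1) by (auto simp: prod_zero_iff indicator_def)
    qed
    finally show ?case .
  qed
  have g_eq: "?g (?next w) = indicator {w\<in>space N. X u w - X s w \<in> B} w" if "w \<in> space N" for w
    using that by (auto simp: Dm indicator_def)
  let ?E1 = "{w\<in>space N. \<forall>i\<in>K. X i w \<in> A i}" and ?E2 = "{w\<in>space N. X u w - X s w \<in> B}"
  have [measurable]: "?E1 \<in> sets N" "?E2 \<in> sets N"
    using K(1) by measurable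
  have "{w\<in>space N. (\<forall>i\<in>K. X i w \<in> A i) \<and> X u w - X s w \<in> B} = ?E1 \<inter> ?E2" by auto
  then have "emeasure N {w\<in>space N. (\<forall>i\<in>K. X i w \<in> A i) \<and> X u w - X s w \<in> B} =
      (\<integral>\<^sup>+w. indicator ?E1 w * indicator ?E2 w \<partial>N)"
    by (simp add: nn_integral_indicator[symmetric] indicator_inter_arith del: nn_integral_indicator)
  also have "\<dots> = (\<integral>\<^sup>+w. ?f (?past w) * ?g (?next w) \<partial>N)"
  proof (rule nn_integral_cong_AE)
    show "AE w in N. indicator ?E1 w * indicator ?E2 w =
        ?f (?past w) * ?g (?next w)"
      using f_eq AE_space[of N]
    proof eventually_elim
      case (elim w)
      show ?case unfolding elim(1) g_eq[OF elim(2)] ..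
    qed
  qed
  also have "\<dots> = (\<integral>\<^sup>+w. ?f (?past w) \<partial>N) * (\<integral>\<^sup>+w. ?g (?next w) \<partial>N)"
    by (rule eq)
  also have "(\<integral>\<^sup>+w. ?f (?past w) \<partial>N) = (\<integral>\<^sup>+w. indicator ?E1 w \<partial>N)"
    using f_eq by (intro nn_integral_cong_AE)
  also have "(\<integral>\<^sup>+w. ?g (?next w) \<partial>N) = (\<integral>\<^sup>+w. indicator ?E2 w \<partial>N)"
    using g_eq by (intro nn_integral_cong)
  finally show ?thesis by simp
qed

lemma increment_independent_of_past:
  assumes s: "0 \<le> s" "s \<le> u"
  shows "distr N (PiM {0..s} (\<lambda>_. borel)) (\<lambda>w. \<lambda>r\<in>{0..s}. X r w) \<Otimes>\<^sub>M distr N borel (\<lambda>w. X u w - X s w) =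
    distr N (PiM {0..s} (\<lambda>_. borel) \<Otimes>\<^sub>M borel) (\<lambda>w. (\<lambda>r\<in>{0..s}. X r w, X u w - X s w))"
proof -
  let ?S = "PiM {0..s} (\<lambda>_. borel :: real measure)" and ?f = "\<lambda>w. \<lambda>r\<in>{0..s}. X r w"
  let ?D = "\<lambda>w. X u w - X s w"
  note [measurable] = measurable_path[of s]
  have [measurable]: "X u \<in> borel_measurable N" "X s \<in> borel_measurable N" using s by (auto intro: measurable_levy)
  interpret f: prob_space "distr N ?S ?f" by (rule prob_space_distr) simp
  interpret D: prob_space "distr N borel ?D" by (rule prob_space_distr) simp
  have main: "emeasure N (?f -` C \<inter> space N \<inter> (?D -` B \<inter> space N)) =
      emeasure N (?f -` C \<inter> space N) * emeasure N (?D -` B \<inter> space N)"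
    if C: "C \<in> sets ?S" and B[measurable]: "B \<in> sets borel" for B C
  proof -
    let ?b = "emeasure N (?D -` B \<inter> space N)"
    let ?P = "distr (density N (indicator (?D -` B \<inter> space N))) ?S ?f"
    let ?Q = "distr (density N (\<lambda>_. ?b)) ?S ?f"
    have [measurable]: "?D -` B \<inter> space N \<in> sets N" by measurable
    have eP: "emeasure ?P C' = emeasure N (?f -` C' \<inter> space N \<inter> (?D -` B \<inter> space N))" if [measurable]: "C' \<in> sets ?S" for C'
    proof -
      have "emeasure ?P C' = (\<integral>\<^sup>+w. indicator (?D -` B \<inter> space N) w * indicator (?f -` C' \<inter> space N) w \<partial>N)"
        by (simp add: emeasure_distr emeasure_density)
      also have "\<dots> = (\<integral>\<^sup>+w. indicator (?f -` C' \<inter> space N \<inter> (?D -` B \<inter> space N)) w \<partial>N)"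
        by (intro nn_integral_cong) (auto simp: indicator_def)
      also have "\<dots> = emeasure N (?f -` C' \<inter> space N \<inter> (?D -` B \<inter> space N))"
        by (rule nn_integral_indicator) measurable
      finally show ?thesis .
    qed
    have eQ: "emeasure ?Q C' = emeasure N (?f -` C' \<inter> space N) * ?b" if [measurable]: "C' \<in> sets ?S" for C'
      by (simp add: emeasure_distr emeasure_density nn_integral_cmult mult.commute)
    have "?P = ?Q"
    proof (rule measure_eqI_PiM_infinite)
      fix A K assume K: "finite K" "K \<subseteq> {0..s}" and A: "\<And>i. i \<in> K \<Longrightarrow> A i \<in> sets (borel :: real measure)"
      have [measurable]: "prod_emb {0..s} (\<lambda>_. borel) K (Pi\<^sub>E K A) \<in> sets ?S"
        using K A by (intro sets_PiM_I) auto
      have "?f -` prod_emb {0..s} (\<lambda>_. borel) K (Pi\<^sub>E K A) \<inter> space N = {w\<in>space N. \<forall>i\<in>K. X i w \<in> A i}"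
        using K(2) by (auto simp: prod_emb_def PiE_iff Pi_iff space_PiM subset_iff)
      then show "emeasure ?P (prod_emb {0..s} (\<lambda>_. borel) K (Pi\<^sub>E K A)) = emeasure ?Q (prod_emb {0..s} (\<lambda>_. borel) K (Pi\<^sub>E K A))"
        unfolding eP[OF \<open>prod_emb _ _ _ _ \<in> _\<close>] eQ[OF \<open>prod_emb _ _ _ _ \<in> _\<close>]
        using cylinder_independent_increment[OF K s, of A B] A B
        by (simp add: vimage_def Int_def conj_ac cong: conj_cong)
    next
      show "finite_measure ?P"
        by (rule finite_measureI) (simp add: eP)
    qed auto
    then show ?thesis using eP[OF C] eQ[OF C] by simp
  qed
  show ?thesis
  proof (rule pair_measure_eqI)
    fix C B assume C: "C \<in> sets (distr N ?S ?f)" and B: "B \<in> sets (distr N borel ?D)"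
    have "emeasure (distr N (?S \<Otimes>\<^sub>M borel) (\<lambda>w. (?f w, ?D w))) (C \<times> B) =
        emeasure N ((\<lambda>w. (?f w, ?D w)) -` (C \<times> B) \<inter> space N)"
      using B C by (intro emeasure_distr) auto
    also have "(\<lambda>w. (?f w, ?D w)) -` (C \<times> B) \<inter> space N = ?f -` C \<inter> space N \<inter> (?D -` B \<inter> space N)" by auto
    finally have "emeasure (distr N (?S \<Otimes>\<^sub>M borel) (\<lambda>w. (?f w, ?D w))) (C \<times> B) =
        emeasure N (?f -` C \<inter> space N \<inter> (?D -` B \<inter> space N))" .
    moreover have "emeasure (distr N ?S ?f) C = emeasure N (?f -` C \<inter> space N)"
      using C by (intro emeasure_distr) auto
    moreover have "emeasure (distr N borel ?D) B = emeasure N (?D -` B \<inter> space N)"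
      using B by (intro emeasure_distr) auto
    ultimately show "emeasure (distr N ?S ?f) C * emeasure (distr N borel ?D) B =
        emeasure (distr N (?S \<Otimes>\<^sub>M borel) (\<lambda>w. (?f w, ?D w))) (C \<times> B)"
      using main[of C B] B C by (simp only: sets_distr)
  qed (auto intro: f.sigma_finite_measure_axioms D.sigma_finite_measure_axioms)
qed

definition moment :: "real \<Rightarrow> ennreal" where
  "moment t = (\<integral>\<^sup>+w. ennreal (exp (X t w)) \<partial>N)"

lemma moment_increment:
  assumes s: "0 \<le> s" "s \<le> u"
  shows "(\<integral>\<^sup>+w. ennreal (exp (X u w - X s w)) \<partial>N) = moment (u - s)"
proof -
  have [measurable]: "X u \<in> borel_measurable N" "X s \<in> borel_measurable N" "X (u - s) \<in> borel_measurable N"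
    using s by (auto intro: measurable_levy)
  have "(\<integral>\<^sup>+w. ennreal (exp (X u w - X s w)) \<partial>N) = (\<integral>\<^sup>+x. ennreal (exp x) \<partial>distr N borel (\<lambda>w. X (s + (u - s)) w - X s w))"
    by (simp add: nn_integral_distr)
  also have "\<dots> = moment (u - s)"
    using s by (subst stationary_increments) (auto simp: nn_integral_distr moment_def)
  finally show ?thesis .
qed

text \<open>Write \<open>exp (X u)\<close> as \<open>exp (X s) * exp (X u - X s)\<close>; the first factor and \<open>A\<close> only depend on the
  path up to time \<open>s\<close>.\<close>

lemma exp_moment_past:
  assumes s: "0 \<le> s" "s \<le> u" and A: "A \<in> sets (natural_filtration N borel X s)"
  shows "(\<integral>\<^sup>+w\<in>A. ennreal (exp (X u w)) \<partial>N) = moment (u - s) * (\<integral>\<^sup>+w\<in>A. ennreal (exp (X s w)) \<partial>N)"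
proof -
  obtain B where B[measurable]: "B \<in> sets (PiM {0..s} (\<lambda>_. borel :: real measure))"
    and AB: "A = (\<lambda>w. \<lambda>r\<in>{0..s}. X r w) -` B \<inter> space N"
    using natural_filtration_path_events[OF A] by (auto simp: space_borel)
  have [measurable]: "(\<lambda>y. y s) \<in> borel_measurable (PiM {0..s} (\<lambda>_. borel :: real measure))"
    using s by (intro measurable_component_singleton) auto
  have [measurable]: "X u \<in> borel_measurable N" "X s \<in> borel_measurable N" using s by (auto intro: measurable_levy)
  let ?f = "\<lambda>y. ennreal (exp (y s)) * indicator B y"
  have ex: "exp (X u w) = exp (X s w) * exp (X u w - X s w)" for w by (simp flip: exp_add)
  have f: "ennreal (exp (X s w)) * indicator A w = ?f (\<lambda>r\<in>{0..s}. X r w)" if "w \<in> space N" for w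
    using that s by (auto simp: AB indicator_def)
  have "(\<integral>\<^sup>+w\<in>A. ennreal (exp (X u w)) \<partial>N) =
      (\<integral>\<^sup>+w. ?f (\<lambda>r\<in>{0..s}. X r w) * ennreal (exp (X u w - X s w)) \<partial>N)"
  proof (rule nn_integral_cong)
    fix w assume w: "w \<in> space N"
    have "ennreal (exp (X u w)) * indicator A w = (ennreal (exp (X s w)) * indicator A w) * ennreal (exp (X u w - X s w))"
      unfolding ex[of w] by (subst ennreal_mult) (auto simp: mult_ac)
    then show "ennreal (exp (X u w)) * indicator A w = ?f (\<lambda>r\<in>{0..s}. X r w) * ennreal (exp (X u w - X s w))"
      using f[OF w] by simp
  qed
  also have "\<dots> = (\<integral>\<^sup>+w. ?f (\<lambda>r\<in>{0..s}. X r w) \<partial>N) * (\<integral>\<^sup>+w. ennreal (exp (X u w - X s w)) \<partial>N)"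
    by (rule product_law_nn_integral_times[OF increment_independent_of_past[OF s] measurable_path])
       measurable
  also have "(\<integral>\<^sup>+w. ?f (\<lambda>r\<in>{0..s}. X r w) \<partial>N) = (\<integral>\<^sup>+w\<in>A. ennreal (exp (X s w)) \<partial>N)"
    using f by (intro nn_integral_cong) simp
  finally show ?thesis using moment_increment[OF s] by (simp add: mult.commute)
qed

lemma moment_add:
  assumes "0 \<le> s" "0 \<le> t"
  shows "moment (s + t) = moment s * moment t"
proof -
  have "(\<integral>\<^sup>+w\<in>space N. ennreal (exp (X u w)) \<partial>N) = moment u" for u
    unfolding moment_def by (intro nn_integral_cong) simp
  then show ?thesis
    using exp_moment_past[of s "s + t" "space N"] assms
      sets.top[of "natural_filtration N borel X s"] by (simp add: mult.commute)
qed

lemma moment_pos: "0 \<le> t \<Longrightarrow> moment t \<noteq> 0"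
proof
  assume t: "0 \<le> t" and "moment t = 0"
  have [measurable]: "X t \<in> borel_measurable N" using t by (rule measurable_levy)
  from \<open>moment t = 0\<close> have "AE w in N. ennreal (exp (X t w)) = 0"
    unfolding moment_def by (subst (asm) nn_integral_0_iff_AE) auto
  then have "AE w in N. False" by eventually_elim simp
  then show False by simp
qed

text \<open>The logarithm of the moment is additive and bounded above near 0, hence linear.  Finiteness spreads
  from \<open>[0,e]\<close> to all times by multiplicativity.\<close>

lemma moment_exponential:
  assumes e: "0 < e" and bdd: "\<And>t. 0 \<le> t \<Longrightarrow> t \<le> e \<Longrightarrow> moment t \<le> ennreal K"
  obtains c where "\<And>t. 0 \<le> t \<Longrightarrow> moment t = ennreal (exp (c * t))"
proof -
  have small: "moment t < \<infinity>" if "0 \<le> t" "t \<le> e" for t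
    using order_le_less_trans[OF bdd[OF that] ennreal_less_top] by simp
  have mult: "moment (real n * t) < \<infinity>" if "0 \<le> t" "t \<le> e" for n t
  proof (induction n)
    case 0 show ?case using small[of 0] e by simp
  next
    case (Suc n)
    have "moment (real (Suc n) * t) = moment (real n * t) * moment t"
      using moment_add[of "real n * t" t] that by (simp add: algebra_simps)
    then show ?case using Suc small[OF that] by (simp add: ennreal_mult_less_top)
  qed
  have fin: "moment t < \<infinity>" if t: "0 \<le> t" for t
  proof -
    obtain n where n: "real n > t / e" using reals_Archimedean2 by blast
    then have n0: "real n > 0" using t e by (meson divide_nonneg_pos order_le_less_trans)
    then have "t / real n \<le> e" using n e by (simp add: field_simps)
    then show ?thesis using mult[of "t / real n" n] t n0 by simp
  qed
  define g where "g t = ln (enn2real (moment t))" for t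
  have pos: "0 < enn2real (moment t)" if "0 \<le> t" for t
    using moment_pos[OF that] fin[OF that] by (simp add: enn2real_positive_iff zero_less_iff_neq_zero less_top)
  have lin: "g t = g 1 * t" if "0 \<le> t" for t
  proof (rule additive_bounded_above_linear[OF _ e _ that])
    show "g (s + t) = g s + g t" if "0 \<le> s" "0 \<le> t" for s t
      using pos[OF that(1)] pos[OF that(2)] by (simp add: g_def moment_add[OF that] enn2real_mult ln_mult)
    show "g t \<le> ln (max 1 K)" if "0 \<le> t" "t \<le> e" for t
    proof -
      have "moment t \<le> ennreal (max 1 K)" using bdd[OF that] by (rule order_trans) (simp add: ennreal_leI)
      then have "enn2real (moment t) \<le> max 1 K" by (simp add: enn2real_leI)
      then show ?thesis unfolding g_def using pos[OF that(1)] by (subst ln_le_cancel_iff) auto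
    qed
  qed
  show ?thesis
  proof (rule that)
    fix t :: real assume t: "0 \<le> t"
    have "exp (g 1 * t) = enn2real (moment t)"
      unfolding lin[OF t, symmetric] using pos[OF t] by (simp add: g_def)
    then show "moment t = ennreal (exp (g 1 * t))" using fin[OF t] by simp
  qed
qed

text \<open>For \<open>A\<close> in the natural filtration at time \<open>s\<close>, let \<open>m u = E[exp (y + X u); A]\<close>.  For \<open>u \<ge> s\<close> it equals
  \<open>m s * exp (c * (u - s))\<close>, so that \<open>m t - m s\<close> is the integral of \<open>c * m\<close> from \<open>s\<close> to \<open>t\<close>; by
  Fubini's theorem this is the martingale property of the compensated process.\<close>

lemma levy_generator_exp:
  assumes c: "\<And>t. 0 \<le> t \<Longrightarrow> moment t = ennreal (exp (c * t))"
  shows "levy_generator N X exp (\<lambda>y. c * exp y)"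
proof -
  let ?F = "natural_filtration N borel X"
  have meas: "X t \<in> borel_measurable N" if "0 \<le> t" for t using that by (rule measurable_levy)
  have sub: "subalgebra N (?F t)" for t by (intro subalgebra_natural_filtration measurable_levy)
  have adapted: "X s \<in> borel_measurable (?F t)" if "0 \<le> s" "s \<le> t" for s t
    using that by (intro measurable_natural_filtration) auto
  have nn_exp: "(\<integral>\<^sup>+w. ennreal (exp (y + X t w)) \<partial>N) = ennreal (exp (y + c * t))" if t: "0 \<le> t" for y t
  proof -
    have [measurable]: "X t \<in> borel_measurable N" using t by (rule meas)
    have "(\<integral>\<^sup>+w. ennreal (exp (y + X t w)) \<partial>N) = (\<integral>\<^sup>+w. ennreal (exp y) * ennreal (exp (X t w)) \<partial>N)"
      by (simp add: exp_add ennreal_mult)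
    also have "\<dots> = ennreal (exp y) * moment t" unfolding moment_def by (rule nn_integral_cmult) simp
    finally show ?thesis using c[OF t] by (simp add: exp_add ennreal_mult)
  qed
  have int: "integrable N (\<lambda>w. exp (y + X t w))" if t: "0 \<le> t" for y t
    using nn_exp[OF t, of y] meas[OF t] by (intro integrableI_nonneg) auto
  have expect: "(\<integral>w. exp (y + X t w) \<partial>N) = exp (y + c * t)" if t: "0 \<le> t" for y t
    using nn_exp[OF t, of y] meas[OF t] by (subst integral_eq_nn_integral) auto
  have lim: "((\<lambda>t. ((\<integral>w. exp (y + X t w) \<partial>N) - exp y) / t) \<longlongrightarrow> c * exp y) (at_right 0)" for y
  proof -
    have "((\<lambda>t. exp (y + c * t)) has_real_derivative c * exp y) (at 0 within {0<..})"
      by (auto intro!: derivative_eq_intros)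
    then have "((\<lambda>t. (exp (y + c * t) - exp y) / t) \<longlongrightarrow> c * exp y) (at_right 0)"
      by (simp add: has_field_derivative_iff)
    then show ?thesis
      by (rule Lim_transform_eventually) (auto simp: expect eventually_at_right_less intro!: eventually_at_rightI[of 0 1])
  qed
  have "compensated_martingale N ?F (\<lambda>t w. exp (y + X t w)) (\<lambda>t w. c * exp (y + X t w))" for y
  proof -
    let ?Y = "\<lambda>t w. exp (y + X t w)"
    have rc: "((\<lambda>r. c * ?Y r w) \<longlongrightarrow> c * ?Y s w) (at_right s)" if "0 \<le> s" "w \<in> space N" for s w
      using cadlag_levy[OF that(2)] that(1) unfolding cadlag_def by (intro tendsto_intros) auto
    have prog: "(\<lambda>(s, w). indicator {0..t} s * (c * ?Y s w)) \<in> borel_measurable (lborel \<Otimes>\<^sub>M G)"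
      if "subalgebra N G" "\<And>s. 0 \<le> s \<Longrightarrow> s \<le> t \<Longrightarrow> X s \<in> borel_measurable G" "0 \<le> t" for G t
    proof (rule right_continuous_progressive)
      show "(\<lambda>w. c * ?Y s w) \<in> borel_measurable G" if "0 \<le> s" "s \<le> t" for s
        using \<open>\<And>s. 0 \<le> s \<Longrightarrow> s \<le> t \<Longrightarrow> X s \<in> borel_measurable G\<close>[OF that] by measurable
      show "((\<lambda>r. c * ?Y r w) \<longlongrightarrow> c * ?Y s w) (at_right s)" if "0 \<le> s" "w \<in> space G" for s w
        using rc that \<open>subalgebra N G\<close> by (auto simp: subalgebra_def)
    qed fact
    interpret lb: pair_sigma_finite lborel N ..
    have int_pair: "integrable (lborel \<Otimes>\<^sub>M N) (\<lambda>(s, w). indicator {0..t} s * (c * ?Y s w))" if t: "0 \<le> t" for t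
    proof (rule lb.Fubini_integrable)
      show "(\<lambda>(s, w). indicator {0..t} s * (c * ?Y s w)) \<in> borel_measurable (lborel \<Otimes>\<^sub>M N)"
        by (rule prog) (use t meas in \<open>auto simp: subalgebra_def\<close>)
      have "integrable lborel (\<lambda>s. indicator {0..t} s *\<^sub>R (\<bar>c\<bar> * exp (y + c * s)))"
        by (rule borel_integrable_compact) (auto intro!: continuous_intros)
      moreover have "(\<lambda>s. indicator {0..t} s *\<^sub>R (\<bar>c\<bar> * exp (y + c * s))) =
          (\<lambda>s. \<integral>w. norm (indicator {0..t} s * (c * ?Y s w)) \<partial>N)"
        by (auto simp: fun_eq_iff indicator_def abs_mult expect)
      ultimately show "integrable lborel (\<lambda>s. \<integral>w. norm (case (s, w) of (s, w) \<Rightarrow> indicator {0..t} s * (c * ?Y s w)) \<partial>N)"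
        by simp
      show "AE s in lborel. integrable N (\<lambda>w. case (s, w) of (s, w) \<Rightarrow> indicator {0..t} s * (c * ?Y s w))"
        using int by (auto simp: indicator_def intro!: AE_I2)
    qed
    define I where "I t w = (LINT s:{0..t}|lborel. c * ?Y s w)" for t w
    have I_int: "integrable N (I t)" if t: "0 \<le> t" for t
      using lb.integrable_snd[OF int_pair[OF t]]
      unfolding I_def[abs_def] set_lebesgue_integral_def real_scaleR_def split .
    have I_meas: "I t \<in> borel_measurable (?F t)" if t: "0 \<le> t" for t
    proof -
      have "(\<lambda>(s, w). indicator {0..t} s * (c * ?Y s w)) \<in> borel_measurable (lborel \<Otimes>\<^sub>M ?F t)"
        by (rule prog) (use t sub adapted in auto)
      then have "(\<lambda>(w, s). indicator {0..t} s * (c * ?Y s w)) \<in> borel_measurable (?F t \<Otimes>\<^sub>M lborel)"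
        by (subst measurable_pair_swap_iff) (simp add: split_beta')
      then have "(\<lambda>w. \<integral>s. indicator {0..t} s * (c * ?Y s w) \<partial>lborel) \<in> borel_measurable (?F t)"
        by (rule lborel.borel_measurable_lebesgue_integral)
      then show ?thesis unfolding I_def[abs_def] set_lebesgue_integral_def real_scaleR_def .
    qed
    have "AE w in N. set_integrable lborel {0..t} (\<lambda>s. c * ?Y s w)" if t: "0 \<le> t" for t
      using lb.AE_integrable_snd[OF int_pair[OF t]] by (simp add: set_integrable_def)
    moreover have "martingale N ?F (\<lambda>t w. ?Y t w - ?Y 0 w - I t w)"
    proof (rule martingaleI)
      fix s t A assume s: "0 \<le> s" and st: "s \<le> t" and A: "A \<in> sets (?F s)"
      have t: "0 \<le> t" using s st by simp
      have A'[measurable]: "A \<in> sets N" using A sub[of s] by (auto simp: subalgebra_def)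
      define m where "m u = (LINT w:A|N. ?Y u w)" for u
      have set_int: "set_integrable N A (?Y u)" if "0 \<le> u" for u
        unfolding set_integrable_def using int[OF that] by (intro integrable_mult_indicator) auto
      have m: "m u = m s * exp (c * (u - s))" if u: "s \<le> u" for u
      proof -
        have u0: "0 \<le> u" using u s by simp
        have nn: "ennreal (m v) = ennreal (exp y) * (\<integral>\<^sup>+w\<in>A. ennreal (exp (X v w)) \<partial>N)" if v: "0 \<le> v" for v
        proof -
          have [measurable]: "X v \<in> borel_measurable N" using v by (rule meas)
          have "ennreal (m v) = (\<integral>\<^sup>+w. ennreal (indicator A w * ?Y v w) \<partial>N)"
            unfolding m_def set_lebesgue_integral_def using set_int[OF v]
            by (subst nn_integral_eq_integral) (auto simp: set_integrable_def)
          also have "\<dots> = (\<integral>\<^sup>+w. ennreal (exp y) * (ennreal (exp (X v w)) * indicator A w) \<partial>N)"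
            by (intro nn_integral_cong) (simp add: indicator_def exp_add ennreal_mult)
          also have "\<dots> = ennreal (exp y) * (\<integral>\<^sup>+w\<in>A. ennreal (exp (X v w)) \<partial>N)"
            by (rule nn_integral_cmult) measurable
          finally show ?thesis .
        qed
        have m_nonneg: "0 \<le> m v" for v
          unfolding m_def set_lebesgue_integral_def by (intro integral_nonneg_AE) auto
        have "ennreal (m u) = ennreal (exp (c * (u - s))) * ennreal (m s)"
          using exp_moment_past[OF s u A] c[of "u - s"] u by (simp add: nn[OF u0] nn[OF s] mult_ac)
        then have "ennreal (m u) = ennreal (m s * exp (c * (u - s)))"
          using m_nonneg by (simp add: ennreal_mult' mult.commute)
        then show ?thesis using m_nonneg by (subst (asm) ennreal_inj) auto
      qed
      have A_pair: "integrable (lborel \<Otimes>\<^sub>M N) (\<lambda>(r, w). indicator A w * (indicator {0..u} r * (c * ?Y r w)))"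
        if u: "0 \<le> u" for u
      proof -
        have "integrable (lborel \<Otimes>\<^sub>M N) (\<lambda>z. indicator (UNIV \<times> A) z *\<^sub>R (case z of (r, w) \<Rightarrow> indicator {0..u} r * (c * ?Y r w)))"
          by (intro integrable_mult_indicator int_pair u) auto
        then show ?thesis by (simp add: split_beta' indicator_times)
      qed
      have I_A: "(LINT w:A|N. I u w) = (LINT r:{0..u}|lborel. c * m r)" if u: "0 \<le> u" for u
      proof -
        have "(LINT w:A|N. I u w) = (\<integral>w. \<integral>r. indicator A w * (indicator {0..u} r * (c * ?Y r w)) \<partial>lborel \<partial>N)"
          by (simp only: set_lebesgue_integral_def I_def real_scaleR_def integral_mult_right_zero)
        also have "\<dots> = (\<integral>r. \<integral>w. indicator A w * (indicator {0..u} r * (c * ?Y r w)) \<partial>N \<partial>lborel)"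
          by (rule lb.Fubini_integral[OF A_pair[OF u]])
        also have "\<dots> = (\<integral>r. indicator {0..u} r * (c * m r) \<partial>lborel)"
          by (simp add: m_def set_lebesgue_integral_def mult.left_commute[of "indicator A _"])
        finally show ?thesis by (simp only: set_lebesgue_integral_def real_scaleR_def)
      qed
      have int_m: "set_integrable lborel {0..u} (\<lambda>r. c * m r)" if u: "0 \<le> u" for u
        using lb.integrable_fst[OF A_pair[OF u]]
        by (simp add: m_def set_lebesgue_integral_def set_integrable_def mult.left_commute[of "indicator A _"])
      have FTC: "(LINT r:{s..t}|lborel. c * m r) = m t - m s"
      proof -
        have "(LINT r:{s..t}|lborel. c * m r) = (\<integral>r. indicator {s..t} r *\<^sub>R (c * (m s * exp (c * (r - s)))) \<partial>lborel)"
          unfolding set_lebesgue_integral_def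
        proof (intro Bochner_Integration.integral_cong refl)
          fix r show "indicator {s..t} r *\<^sub>R (c * m r) = indicator {s..t} r *\<^sub>R (c * (m s * exp (c * (r - s))))"
            using m[of r] by (simp add: indicator_def)
        qed
        also have "\<dots> = m s * exp (c * (t - s)) - m s * exp (c * (s - s))"
          by (rule integral_FTC_atLeastAtMost[OF st])
             (auto intro!: derivative_eq_intros continuous_intros simp: has_real_derivative_iff_has_vector_derivative[symmetric])
        finally show ?thesis using m[OF st] by simp
      qed
      have "(LINT r:{0..t}|lborel. c * m r) = (LINT r:{0..s}|lborel. c * m r) + (LINT r:{s..t}|lborel. c * m r)"
      proof -
        have "AE r in lborel. r \<noteq> s" by (rule AE_lborel_singleton)
        then have "(LINT r:{0..t}|lborel. c * m r) =
            (\<integral>r. indicator {0..s} r *\<^sub>R (c * m r) + indicator {s..t} r *\<^sub>R (c * m r) \<partial>lborel)"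
          unfolding set_lebesgue_integral_def
        proof (intro integral_cong_AE)
          show "AE r in lborel. indicator {0..t} r *\<^sub>R (c * m r) = indicator {0..s} r *\<^sub>R (c * m r) + indicator {s..t} r *\<^sub>R (c * m r)"
            using AE_lborel_singleton[of s] by eventually_elim (use s st in \<open>auto simp: indicator_def\<close>)
        qed (use int_m[OF t] int_m[OF s] set_integrable_subset[OF int_m[OF t], of "{s..t}"] s in
              \<open>auto simp: set_integrable_def intro!: borel_measurable_add dest: borel_measurable_integrable\<close>)
        also have "\<dots> = (LINT r:{0..s}|lborel. c * m r) + (LINT r:{s..t}|lborel. c * m r)"
          unfolding set_lebesgue_integral_def using int_m[OF s] set_integrable_subset[OF int_m[OF t], of "{s..t}"] s
          by (intro Bochner_Integration.integral_add) (auto simp: set_integrable_def)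
        finally show ?thesis .
      qed
      moreover have "(LINT w:A|N. ?Y u w - ?Y 0 w - I u w) = m u - m 0 - (LINT r:{0..u}|lborel. c * m r)" if u: "0 \<le> u" for u
      proof -
        have "set_integrable N A (I u)"
          unfolding set_integrable_def using I_int[OF u] by (intro integrable_mult_indicator) auto
        then show ?thesis
          using set_int[OF u] set_int[of 0] I_A[OF u] by (simp add: m_def)
      qed
      ultimately show "(LINT w:A|N. ?Y t w - ?Y 0 w - I t w) = (LINT w:A|N. ?Y s w - ?Y 0 w - I s w)"
        using FTC s t by simp
    next
      fix t :: real assume t: "0 \<le> t"
      show "(\<lambda>w. ?Y t w - ?Y 0 w - I t w) \<in> borel_measurable (?F t)"
        using adapted[of t t] adapted[of 0 t] I_meas[OF t] t by measurable
      show "integrable N (\<lambda>w. ?Y t w - ?Y 0 w - I t w)"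
        using int[OF t] int[of 0] I_int[OF t] by simp
    qed (rule sub)
    ultimately show ?thesis unfolding compensated_martingale_def I_def by simp
  qed
  then show ?thesis
    unfolding levy_generator_def using int lim by auto
qed

end

section \<open>The tilted Markov property\<close>

lemma SUP_min_of_nat: "(SUP n. min (W::ennreal) (of_nat n)) = W"
proof -
  have "(SUP n. min W (of_nat n)) = inf W (SUP n. of_nat n)"
    by (subst inf_SUP) (simp add: inf_min)
  then show ?thesis by (simp add: ennreal_SUP_of_nat_eq_top)
qed

context markov_additive_process
begin

lemma space_P [simp]: "space (P a x) = space M"
  using sets_P by (rule sets_eq_imp_space_eq)

lemma emeasure_P_space [simp]: "emeasure (P a x) (space M) = 1"
  using prob_space.emeasure_space_1[OF prob_space_P[of a x]] by simp

lemma measure_P_space [simp]: "measure (P a x) (space M) = 1"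
  using prob_space.prob_space[OF prob_space_P[of a x]] by simp

lemma subalgebra_P: "subalgebra (P a x) (F t)"
  using subalgebra_F[of t] sets_P[of a x] by (simp add: subalgebra_def)

lemma space_F [simp]: "space (F t) = space M"
  using subalgebra_F[of t] by (simp add: subalgebra_def)

lemma sets_F_mono: "s \<le> t \<Longrightarrow> sets (F s) \<subseteq> sets (F t)"
  by (rule filtration.sets_F_mono[OF filtration_F])

lemma measurable_F_mono: "s \<le> t \<Longrightarrow> f \<in> measurable (F s) S \<Longrightarrow> f \<in> measurable (F t) S"
  by (rule measurable_from_subalg) (simp_all add: subalgebra_def sets_F_mono)

lemma measurable_F_P: "f \<in> measurable (F s) S \<Longrightarrow> f \<in> measurable (P a x) S"
  by (rule measurable_from_subalg[OF subalgebra_P])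

lemma J_adapted: "0 \<le> t \<Longrightarrow> J t \<in> measurable (F t) (count_space UNIV)"
  using measurable_compose[OF adapted measurable_fst] by simp

lemma xi_adapted: "0 \<le> t \<Longrightarrow> \<xi> t \<in> borel_measurable (F t)"
  using measurable_compose[OF adapted measurable_snd] by simp

lemma J_measurable: "0 \<le> t \<Longrightarrow> J t \<in> measurable (P a x) (count_space UNIV)"
  by (rule measurable_F_P[OF J_adapted])

lemma J_indicator_measurable: "0 \<le> t \<Longrightarrow> (\<lambda>w. indicator A (J t w)) \<in> borel_measurable (P a x)"
  by (rule measurable_compose[OF J_measurable]) auto

lemma xi_measurable: "0 \<le> t \<Longrightarrow> \<xi> t \<in> borel_measurable (P a x)"
  by (rule measurable_F_P[OF xi_adapted])

lemma J_right_constant: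
  assumes w: "w \<in> space M" shows "right_constant (\<lambda>t. J t w)"
  unfolding right_constant_def
proof (intro allI impI)
  fix s :: real assume s: "0 \<le> s"
  have "((\<lambda>t. (J t w, \<xi> t w)) \<longlongrightarrow> (J s w, \<xi> s w)) (at_right s)"
    using cadlag_paths[OF w] s by (simp add: cadlag_def)
  from tendsto_fst[OF this] have "eventually (\<lambda>t. J t w = J s w) (at_right s)"
    by (simp add: tendsto_discrete)
  then obtain b where "b > s" "\<And>y. s < y \<Longrightarrow> y < b \<Longrightarrow> J y w = J s w"
    by (auto simp: eventually_at_right_field)
  then show "\<exists>e>0. \<forall>r. s \<le> r \<and> r < s + e \<longrightarrow> J r w = J s w"
    by (intro exI[of _ "b - s"]) (auto simp: le_less)
qed

lemma paths_right_continuous: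
  assumes "w \<in> space M" "0 \<le> s"
  shows "(\<lambda>n. J (s + 1 / Suc n) w) \<longlonglongrightarrow> J s w" "(\<lambda>n. \<xi> (s + 1 / Suc n) w) \<longlonglongrightarrow> \<xi> s w"
proof -
  have lim: "((\<lambda>t. (J t w, \<xi> t w)) \<longlongrightarrow> (J s w, \<xi> s w)) (at_right s)"
    using cadlag_paths[OF assms(1)] assms(2) by (simp add: cadlag_def)
  have "(\<lambda>n. s + 1 / real (Suc n)) \<longlonglongrightarrow> s + 0"
    by (intro tendsto_add tendsto_const) (rule LIMSEQ_Suc[OF lim_1_over_n])
  then have "filterlim (\<lambda>n. s + 1 / real (Suc n)) (at_right s) sequentially"
    by (auto simp: filterlim_at)
  from filterlim_compose[OF lim this]
  have "(\<lambda>n. (J (s + 1 / Suc n) w, \<xi> (s + 1 / Suc n) w)) \<longlonglongrightarrow> (J s w, \<xi> s w)" .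
  from tendsto_fst[OF this] tendsto_snd[OF this]
  show "(\<lambda>n. J (s + 1 / Suc n) w) \<longlonglongrightarrow> J s w" "(\<lambda>n. \<xi> (s + 1 / Suc n) w) \<longlonglongrightarrow> \<xi> s w"
    by simp_all
qed

text \<open>Markov additivity is postulated for \<open>s > 0\<close> and \<open>t > 0\<close>.  The case \<open>t = 0\<close> is the limit of the
  identities at times \<open>\<tau> n\<close> decreasing to 0: a weight measurable at time 0 is measurable at all later
  times, paths are right-continuous and \<open>g\<close> is continuous.  It yields in particular the invariance of
  the laws under translations of \<open>\<xi>\<close>.\<close>

lemma bounded_markov_property:
  fixes g :: "'e \<times> real \<Rightarrow> real" and V :: "'w \<Rightarrow> real"
  assumes g: "continuous_on UNIV g" "\<And>z. 0 \<le> g z" "\<And>z. g z \<le> B"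
    and V: "V \<in> borel_measurable (F t)" "\<And>w. 0 \<le> V w" "\<And>w. V w \<le> C"
    and s: "0 \<le> s" and t: "0 \<le> t"
  shows "(\<integral>w. V w * g (J (t + s) w, \<xi> (t + s) w - \<xi> t w) \<partial>P a x) =
    (\<integral>w. V w * (\<integral>w'. g (J s w', \<xi> s w') \<partial>P (J t w) 0) \<partial>P a x)"
proof -
  let ?h = "\<lambda>r w. g (J (r + s) w, \<xi> (r + s) w - \<xi> r w)" and ?base = "\<lambda>w. g (J s w, \<xi> s w - \<xi> 0 w)"
  interpret prob_space "P a x" by (rule prob_space_P)
  have g_bdd: "bounded (range g)"
    by (rule boundedI[of _ B]) (use g in auto)
  have BC: "0 \<le> B" "0 \<le> C" using order_trans[OF g(2,3)] order_trans[OF V(2,3)] by auto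
  have g_meas: "(\<lambda>w. g (J u w, \<xi> u w - c w)) \<in> borel_measurable (P j y)"
    if u: "0 \<le> u" and [measurable]: "c \<in> borel_measurable (P j y)" for u c j y
  proof (rule measurable_compose_countable[where f="\<lambda>i w. g (i, \<xi> u w - c w)" and g="J u"])
    have [measurable]: "\<xi> u \<in> borel_measurable (P j y)" by (rule xi_measurable[OF u])
    have "continuous_on UNIV (\<lambda>v. g (i, v))" for i
      by (rule continuous_on_compose2[OF g(1)]) (auto intro!: continuous_intros)
    note [measurable] = borel_measurable_continuous_onI[OF this]
    show "(\<lambda>w. g (i, \<xi> u w - c w)) \<in> borel_measurable (P j y)" for i by measurable
  qed (rule J_measurable[OF u])
  define G where "G j = (\<integral>w'. g (J s w', \<xi> s w') \<partial>P j 0)" for j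
  have G: "0 \<le> G j" "G j \<le> B" for j
  proof -
    interpret j: prob_space "P j 0" by (rule prob_space_P)
    show "0 \<le> G j" unfolding G_def by (intro integral_nonneg_AE) (auto simp: g)
    have "(\<lambda>w'. g (J s w', \<xi> s w' - 0)) \<in> borel_measurable (P j 0)"
      by (rule g_meas[OF s]) simp
    then have "integrable (P j 0) (\<lambda>w'. g (J s w', \<xi> s w'))"
      by (intro j.integrable_const_bound[of _ B]) (auto simp: g)
    then show "G j \<le> B" unfolding G_def by (intro j.integral_le_const) (auto simp: g)
  qed
  have positive: "(\<integral>w. V w * ?h t w \<partial>P a x) = (\<integral>w. V w * G (J t w) \<partial>P a x)"
    if t: "0 < t" and V: "V \<in> borel_measurable (F t)" and s: "0 < s" for t
  proof -
    interpret fs: finite_measure_subalgebra "P a x" "F t" by unfold_locales (rule subalgebra_P)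
    have VP[measurable]: "V \<in> borel_measurable (P a x)" using V by (rule measurable_F_P)
    have gm[measurable]: "(\<lambda>w. ?h t w) \<in> borel_measurable (P a x)"
      by (rule g_meas) (use s t xi_measurable[of t] in auto)
    have "(\<integral>w. V w * ?h t w \<partial>P a x) =
        (\<integral>w. V w * real_cond_exp (P a x) (F t) (\<lambda>w. ?h t w) w \<partial>P a x)"
    proof (rule fs.real_cond_exp_intg(2)[symmetric])
      show "integrable (P a x) (\<lambda>w. V w * ?h t w)"
        by (rule integrable_const_bound[of _ "C * B"])
           (use assms BC in \<open>auto simp: abs_mult intro!: mult_mono\<close>)
    qed (use V gm in auto)
    also have "\<dots> = (\<integral>w. V w * G (J t w) \<partial>P a x)"
    proof (rule integral_cong_AE)
      have [measurable]: "J t \<in> measurable (P a x) (count_space UNIV)" using t by (intro J_measurable) auto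
      show "(\<lambda>w. V w * G (J t w)) \<in> borel_measurable (P a x)" by measurable
      show "AE w in P a x. V w * real_cond_exp (P a x) (F t) (\<lambda>w. ?h t w) w = V w * G (J t w)"
        using markov_additive[OF g(1) g_bdd g(2) s t, of a x] by eventually_elim (simp add: G_def)
    qed (auto intro: borel_measurable_times)
    finally show ?thesis .
  qed
  show ?thesis
    unfolding G_def[symmetric]
  proof (cases "s = 0")
    case True
    have "G j = g (j, 0)" for j
    proof -
      interpret j: prob_space "P j 0" by (rule prob_space_P)
      have "(\<lambda>w'. g (J s w', \<xi> s w' - 0)) \<in> borel_measurable (P j 0)"
        by (rule g_meas[OF s]) simp
      then have "G j = (\<integral>w'. g (j, 0) \<partial>P j 0)"
        unfolding G_def by (intro integral_cong_AE) (use start[of j 0] True in \<open>auto elim: eventually_mono\<close>)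
      then show ?thesis by simp
    qed
    then show "(\<integral>w. V w * ?h t w \<partial>P a x) = (\<integral>w. V w * G (J t w) \<partial>P a x)"
      using True by simp
  next
    case False
    then have s: "0 < s" using s by simp
    show "(\<integral>w. V w * ?h t w \<partial>P a x) = (\<integral>w. V w * G (J t w) \<partial>P a x)"
    proof (cases "t = 0")
      case False
      then show ?thesis using t by (intro positive V s) simp
    next
      case True
      define \<tau> :: "nat \<Rightarrow> real" where "\<tau> n = 1 / real (Suc n)" for n
      have \<tau>: "0 < \<tau> n" for n by (simp add: \<tau>_def)
      have VP[measurable]: "V \<in> borel_measurable (P a x)" using V(1) by (rule measurable_F_P)
      have "(\<integral>w. V w * ?h (\<tau> n) w \<partial>P a x) = (\<integral>w. V w * G (J (\<tau> n) w) \<partial>P a x)" for n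
        using V(1) True \<tau>[of n] by (intro positive s) (auto intro: measurable_F_mono[of 0 "\<tau> n"])
      moreover have lim: "(\<lambda>n. \<integral>w. V w * f n w \<partial>P a x) \<longlonglongrightarrow> (\<integral>w. V w * f0 w \<partial>P a x)"
        if [measurable]: "\<And>n. f n \<in> borel_measurable (P a x)" "f0 \<in> borel_measurable (P a x)"
          and f: "\<And>n w. 0 \<le> f n w \<and> f n w \<le> B" "\<And>w. w \<in> space M \<Longrightarrow> (\<lambda>n. f n w) \<longlonglongrightarrow> f0 w" for f f0
      proof (rule integral_dominated_convergence[of _ _ _ "\<lambda>_. C * B"])
        show "AE w in P a x. norm (V w * f n w) \<le> C * B" for n
          using V f(1) BC by (auto simp: abs_mult intro!: mult_mono)
      qed (use f(2) in \<open>auto intro!: AE_I2 tendsto_intros\<close>)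
      have "(\<lambda>n. \<integral>w. V w * ?h (\<tau> n) w \<partial>P a x) \<longlonglongrightarrow> (\<integral>w. V w * ?base w \<partial>P a x)"
      proof (rule lim)
        show "(\<lambda>w. ?base w) \<in> borel_measurable (P a x)"
          by (rule g_meas) (use s xi_measurable[of 0] in auto)
        show "(\<lambda>w. ?h (\<tau> n) w) \<in> borel_measurable (P a x)" for n
          by (rule g_meas) (use s \<tau>[of n] xi_measurable[of "\<tau> n"] in auto)
        fix w assume w: "w \<in> space M"
        have "(\<lambda>n. (J (\<tau> n + s) w, \<xi> (\<tau> n + s) w - \<xi> (\<tau> n) w)) \<longlonglongrightarrow> (J s w, \<xi> s w - \<xi> 0 w)"
          using paths_right_continuous[OF w, of s] paths_right_continuous[OF w, of 0] s
          by (intro tendsto_Pair tendsto_diff) (auto simp: \<tau>_def add.commute)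
        moreover have "isCont g (J s w, \<xi> s w - \<xi> 0 w)" using g(1) by (simp add: continuous_on_eq_continuous_at)
        ultimately show "(\<lambda>n. ?h (\<tau> n) w) \<longlonglongrightarrow> ?base w"
          by (rule isCont_tendsto_compose[rotated])
      qed (use g in auto)
      moreover have "(\<lambda>n. \<integral>w. V w * G (J (\<tau> n) w) \<partial>P a x) \<longlonglongrightarrow> (\<integral>w. V w * G (J 0 w) \<partial>P a x)"
      proof (rule lim)
        show "(\<lambda>w. G (J 0 w)) \<in> borel_measurable (P a x)"
          by (rule measurable_compose[OF J_measurable]) auto
        show "(\<lambda>w. G (J (\<tau> n) w)) \<in> borel_measurable (P a x)" for n
          using \<tau>[of n] by (intro measurable_compose[OF J_measurable]) auto
        fix w assume "w \<in> space M"
        then have "(\<lambda>n. J (\<tau> n) w) \<longlonglongrightarrow> J 0 w"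
          using paths_right_continuous(1)[of w 0] by (simp add: \<tau>_def)
        then have "eventually (\<lambda>n. J (\<tau> n) w = J 0 w) sequentially" by (simp add: tendsto_discrete)
        then have "eventually (\<lambda>n. G (J 0 w) = G (J (\<tau> n) w)) sequentially" by eventually_elim simp
        then show "(\<lambda>n. G (J (\<tau> n) w)) \<longlonglongrightarrow> G (J 0 w)"
          by (rule Lim_transform_eventually[OF tendsto_const])
      qed (use G in auto)
      ultimately show ?thesis using True LIMSEQ_unique by (metis (no_types, lifting) add_0 ext)
    qed
  qed
qed

text \<open>For \<open>\<theta> = 0\<close> this is the transition matrix of \<open>J\<close>, for \<open>\<theta> = 1\<close> its analogue under the measure tilted by
  \<open>Y\<close>.  Infinite values are possible a priori.\<close>

definition tilted_kernel :: "real \<Rightarrow> real \<Rightarrow> 'e \<Rightarrow> 'e \<Rightarrow> ennreal" where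
  "tilted_kernel \<theta> s a c = (\<integral>\<^sup>+w. ennreal (exp (\<theta> * \<xi> s w)) * indicator {c} (J s w) \<partial>P a 0)"

text \<open>The function \<open>(j, y) \<mapsto> indicator {c} j * exp (\<theta> * y)\<close> is the increasing limit of the bounded continuous
  functions \<open>g n\<close>; this gives the identity for events.  It extends to the weight \<open>V * exp (\<theta> * \<xi> t)\<close>
  because two densities with the same integrals over all events of \<open>F t\<close> integrate every function
  measurable at time \<open>t\<close> in the same way.\<close>

lemma tilted_markov_property:
  assumes V: "V \<in> borel_measurable (F t)" and s: "0 \<le> s" and t: "0 \<le> t"
  shows "(\<integral>\<^sup>+w. V w * (ennreal (exp (\<theta> * \<xi> (t + s) w)) * indicator {c} (J (t + s) w)) \<partial>P a x) =
    (\<integral>\<^sup>+w. V w * ennreal (exp (\<theta> * \<xi> t w)) * tilted_kernel \<theta> s (J t w) c \<partial>P a x)"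
proof -
  have ts: "0 \<le> t + s" using s t by simp
  define g :: "nat \<Rightarrow> 'e \<times> real \<Rightarrow> real" where
    "g n z = indicator {c} (fst z) * min (exp (\<theta> * snd z)) (real n)" for n z
  define e :: "'e \<times> real \<Rightarrow> ennreal" where
    "e z = ennreal (exp (\<theta> * snd z)) * indicator {c} (fst z)" for z
  have g_cont: "continuous_on UNIV (g n)" for n
  proof -
    have "continuous_on UNIV (\<lambda>z :: 'e \<times> real. indicator {c} (fst z) :: real)"
    proof (rule continuous_on_compose2[where g="indicator {c}" and f=fst])
      show "continuous_on UNIV (indicator {c} :: 'e \<Rightarrow> real)" by (simp add: continuous_on_open_vimage open_discrete)
    qed (auto intro!: continuous_intros)
    then show ?thesis unfolding g_def[abs_def] by (intro continuous_intros)
  qed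
  have g_nonneg: "0 \<le> g n z" for n z by (simp add: g_def)
  have g_le: "g n z \<le> real n" for n z by (auto simp: g_def indicator_def)
  have g_SUP: "(SUP n. ennreal (g n z)) = e z" for z
  proof -
    have "ennreal (g n z) = indicator {c} (fst z) * min (ennreal (exp (\<theta> * snd z))) (of_nat n)" for n
      by (auto simp: g_def indicator_def min_def ennreal_of_nat_eq_real_of_nat ennreal_le_iff ennreal_less_iff)
    then have "(SUP n. ennreal (g n z)) = indicator {c} (fst z) * (SUP n. min (ennreal (exp (\<theta> * snd z))) (of_nat n))"
      by (simp add: SUP_mult_left_ennreal)
    then show ?thesis by (simp add: SUP_min_of_nat e_def mult.commute)
  qed
  have g_inc: "incseq (\<lambda>n. ennreal (g n z))" for z
    by (auto simp: incseq_def g_def indicator_def intro!: ennreal_leI)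
  have g_meas: "(\<lambda>w. g n (J u w, \<xi> u w - b w)) \<in> borel_measurable (P j y)"
    if "0 \<le> u" "b \<in> borel_measurable (P j y)" for n u b j y
  proof -
    note [measurable] = that(2) xi_measurable[OF that(1), of j y]
    show ?thesis unfolding g_def fst_conv snd_conv
      by (intro borel_measurable_times J_indicator_measurable that(1)) measurable
  qed
  let ?Z = "\<lambda>w. (J (t + s) w, \<xi> (t + s) w - \<xi> t w)"
  let ?H = "\<lambda>n j. \<integral>\<^sup>+w'. ennreal (g n (J s w', \<xi> s w')) \<partial>P j 0"
  have Z_meas: "(\<lambda>w. g n (?Z w)) \<in> borel_measurable (P a x)" for n
    by (intro g_meas ts xi_measurable t)
  have s_meas: "(\<lambda>w. g n (J s w, \<xi> s w)) \<in> borel_measurable (P j 0)" for n j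
    using g_meas[OF s, of "\<lambda>_. 0" j 0 n] by simp
  have J_comp: "(\<lambda>w. h (J t w)) \<in> borel_measurable (P a x)" for h :: "'e \<Rightarrow> 'b::topological_space"
    by (rule measurable_compose[OF J_measurable[OF t]]) simp
  have mono: "(\<integral>\<^sup>+w. (SUP n. h n w) \<partial>Q) = (SUP n. \<integral>\<^sup>+w. h n w \<partial>Q)"
    if "\<And>w. incseq (\<lambda>n. h n w)" "\<And>n. h n \<in> borel_measurable Q" for h :: "nat \<Rightarrow> 'w \<Rightarrow> ennreal" and Q
    by (rule nn_integral_monotone_convergence_SUP) (use that in \<open>auto simp: incseq_def le_fun_def\<close>)
  have kern: "tilted_kernel \<theta> s j c = (SUP n. ?H n j)" for j
    using mono[of "\<lambda>n w'. ennreal (g n (J s w', \<xi> s w'))" "P j 0"] g_inc s_meas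
    by (simp add: tilted_kernel_def g_SUP e_def)
  have H_inc: "incseq (\<lambda>n. ?H n j)" for j
    using g_inc by (auto simp: incseq_def intro!: nn_integral_mono)
  have event: "(\<integral>\<^sup>+w. indicator A w * e (?Z w) \<partial>P a x) = (\<integral>\<^sup>+w. indicator A w * tilted_kernel \<theta> s (J t w) c \<partial>P a x)"
    if A: "A \<in> sets (F t)" for A
  proof -
    have [measurable]: "A \<in> sets (P a x)" using A subalgebra_P[of a x t] by (auto simp: subalgebra_def)
    have step: "(\<integral>\<^sup>+w. indicator A w * ennreal (g n (?Z w)) \<partial>P a x) = (\<integral>\<^sup>+w. indicator A w * ?H n (J t w) \<partial>P a x)" for n
    proof -
      interpret prob_space "P a x" by (rule prob_space_P)
      define G where "G j = (\<integral>w'. g n (J s w', \<xi> s w') \<partial>P j 0)" for j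
      have G: "?H n j = ennreal (G j) \<and> 0 \<le> G j \<and> G j \<le> real n" for j
      proof -
        interpret j: prob_space "P j 0" by (rule prob_space_P)
        have int: "integrable (P j 0) (\<lambda>w. g n (J s w, \<xi> s w))"
          using s_meas by (intro j.integrable_const_bound[of _ "real n"]) (auto simp: g_nonneg g_le)
        then have "?H n j = ennreal (G j)"
          unfolding G_def by (intro nn_integral_eq_integral) (auto simp: g_nonneg)
        moreover have "G j \<le> real n"
          unfolding G_def using int by (intro j.integral_le_const) (auto simp: g_le)
        ultimately show ?thesis unfolding G_def by (auto intro!: integral_nonneg_AE simp: g_nonneg)
      qed
      have real: "(\<integral>\<^sup>+w. indicator A w * ennreal (f w) \<partial>P a x) = ennreal (\<integral>w. indicator A w * f w \<partial>P a x)"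
        if [measurable]: "f \<in> borel_measurable (P a x)" and f: "\<And>w. 0 \<le> f w \<and> f w \<le> real n" for f
      proof -
        have "(\<integral>\<^sup>+w. indicator A w * ennreal (f w) \<partial>P a x) = (\<integral>\<^sup>+w. ennreal (indicator A w * f w) \<partial>P a x)"
          by (intro nn_integral_cong) (auto simp: indicator_def)
        also have "\<dots> = ennreal (\<integral>w. indicator A w * f w \<partial>P a x)"
          by (intro nn_integral_eq_integral integrable_const_bound[of _ "real n"]) (use f in \<open>auto simp: indicator_def\<close>)
        finally show ?thesis .
      qed
      have "(\<integral>w. indicator A w * g n (?Z w) \<partial>P a x) = (\<integral>w. indicator A w * G (J t w) \<partial>P a x)"
        unfolding G_def
        by (rule bounded_markov_property[OF g_cont g_nonneg g_le _ _ _ s t, where C=1]) (use A in auto)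
      then show ?thesis
        using real[OF Z_meas] real[OF J_comp[of G]] G by (simp add: g_nonneg g_le)
    qed
    have "(\<integral>\<^sup>+w. indicator A w * e (?Z w) \<partial>P a x) = (\<integral>\<^sup>+w. (SUP n. indicator A w * ennreal (g n (?Z w))) \<partial>P a x)"
      by (simp add: g_SUP[symmetric] SUP_mult_left_ennreal)
    also have "\<dots> = (SUP n. \<integral>\<^sup>+w. indicator A w * ennreal (g n (?Z w)) \<partial>P a x)"
      using g_inc Z_meas by (intro mono) (auto simp: incseq_def intro!: mult_left_mono)
    also have "\<dots> = (\<integral>\<^sup>+w. (SUP n. indicator A w * ?H n (J t w)) \<partial>P a x)"
      unfolding step using H_inc
      by (intro mono[symmetric] borel_measurable_times_ennreal J_comp) (auto simp: incseq_def intro!: mult_left_mono)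
    also have "\<dots> = (\<integral>\<^sup>+w. indicator A w * tilted_kernel \<theta> s (J t w) c \<partial>P a x)"
      by (simp add: kern SUP_mult_left_ennreal)
    finally show ?thesis .
  qed
  have e_meas: "(\<lambda>w. e (?Z w)) \<in> borel_measurable (P a x)"
    unfolding g_SUP[symmetric] using Z_meas by measurable
  let ?D = "\<lambda>h. density (P a x) h" and ?k = "\<lambda>w. tilted_kernel \<theta> s (J t w) c" and ?W = "\<lambda>w. V w * ennreal (exp (\<theta> * \<xi> t w))"
  have sub: "subalgebra (?D h) (F t)" for h using subalgebra_P[of a x t] by (simp add: subalgebra_def)
  have "restr_to_subalg (?D (\<lambda>w. e (?Z w))) (F t) = restr_to_subalg (?D ?k) (F t)"
  proof (rule measure_eqI)
    fix A assume "A \<in> sets (restr_to_subalg (?D (\<lambda>w. e (?Z w))) (F t))"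
    then have A: "A \<in> sets (F t)" by (simp add: sets_restr_to_subalg[OF sub])
    then have "A \<in> sets (P a x)" using subalgebra_P[of a x t] by (auto simp: subalgebra_def)
    then show "emeasure (restr_to_subalg (?D (\<lambda>w. e (?Z w))) (F t)) A = emeasure (restr_to_subalg (?D ?k) (F t)) A"
      using event[OF A] e_meas J_comp[of "\<lambda>j. tilted_kernel \<theta> s j c"]
      by (simp add: emeasure_restr_to_subalg[OF sub A] emeasure_density mult.commute)
  qed (simp add: sets_restr_to_subalg[OF sub])
  moreover have W: "?W \<in> borel_measurable (F t)"
    using V measurable_compose[OF xi_adapted[OF t], of "\<lambda>y. ennreal (exp (\<theta> * y))"] by measurable
  ultimately have "(\<integral>\<^sup>+w. ?W w \<partial>?D (\<lambda>w. e (?Z w))) = (\<integral>\<^sup>+w. ?W w \<partial>?D ?k)"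
    using nn_integral_subalgebra2[OF sub W] by metis
  then have "(\<integral>\<^sup>+w. e (?Z w) * ?W w \<partial>P a x) = (\<integral>\<^sup>+w. ?k w * ?W w \<partial>P a x)"
    by (simp only: nn_integral_density[OF e_meas measurable_F_P[OF W]]
        nn_integral_density[OF J_comp[of "\<lambda>j. tilted_kernel \<theta> s j c"] measurable_F_P[OF W]])
  moreover have "V w * (ennreal (exp (\<theta> * \<xi> (t + s) w)) * indicator {c} (J (t + s) w)) = e (?Z w) * ?W w" for w
  proof -
    have "exp (\<theta> * \<xi> (t + s) w) = exp (\<theta> * \<xi> t w) * exp (\<theta> * (\<xi> (t + s) w - \<xi> t w))"
      by (simp flip: exp_add add: algebra_simps)
    then show ?thesis by (simp add: e_def ennreal_mult mult_ac)
  qed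
  ultimately show ?thesis by (simp add: mult.commute)
qed

text \<open>The tilted Markov property at time 0.\<close>

lemma kernel_translation:
  assumes s: "0 \<le> s"
  shows "(\<integral>\<^sup>+w. ennreal (exp (\<theta> * \<xi> s w)) * indicator {c} (J s w) \<partial>P a x) = ennreal (exp (\<theta> * x)) * tilted_kernel \<theta> s a c"
proof -
  have "(\<integral>\<^sup>+w. ennreal (exp (\<theta> * \<xi> s w)) * indicator {c} (J s w) \<partial>P a x) =
      (\<integral>\<^sup>+w. ennreal (exp (\<theta> * \<xi> 0 w)) * tilted_kernel \<theta> s (J 0 w) c \<partial>P a x)"
    using tilted_markov_property[where V="\<lambda>_. 1" and t=0 and s=s and \<theta>=\<theta> and c=c and a=a and x=x] s by simp
  also have "\<dots> = (\<integral>\<^sup>+w. ennreal (exp (\<theta> * x)) * tilted_kernel \<theta> s a c \<partial>P a x)"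
    by (rule nn_integral_cong_AE) (use start[of a x] in \<open>auto elim: eventually_mono\<close>)
  finally show ?thesis by simp
qed

lemma total_kernel_translation:
  assumes s: "0 \<le> s"
  shows "(\<integral>\<^sup>+w. ennreal (exp (\<theta> * \<xi> s w)) \<partial>P a x) = ennreal (exp (\<theta> * x)) * (\<Sum>c\<in>UNIV. tilted_kernel \<theta> s a c)"
proof -
  have [measurable]: "J s \<in> measurable (P a x) (count_space UNIV)" "\<xi> s \<in> borel_measurable (P a x)"
    using s by (auto intro: J_measurable xi_measurable)
  have "(\<integral>\<^sup>+w. ennreal (exp (\<theta> * \<xi> s w)) \<partial>P a x) =
      (\<integral>\<^sup>+w. (\<Sum>c\<in>UNIV. ennreal (exp (\<theta> * \<xi> s w)) * indicator {c} (J s w)) \<partial>P a x)"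
    by (simp add: sum_distrib_left[symmetric] indicator_def)
  also have "\<dots> = (\<Sum>c\<in>UNIV. \<integral>\<^sup>+w. ennreal (exp (\<theta> * \<xi> s w)) * indicator {c} (J s w) \<partial>P a x)"
    by (intro nn_integral_sum borel_measurable_times_ennreal J_indicator_measurable s) measurable
  finally show ?thesis by (simp add: kernel_translation[OF s] sum_distrib_left)
qed

end

section \<open>Two jumps in a short time\<close>

lemma dyadic_jumps_twice_event:
  fixes Z :: "real \<Rightarrow> 'w \<Rightarrow> 'e :: finite"
  assumes "\<And>s. 0 \<le> s \<Longrightarrow> Z s \<in> measurable Q (count_space UNIV)" and t: "0 \<le> t"
  shows "{w\<in>space Q. dyadic_jumps_twice t n (\<lambda>s. Z s w)} \<in> sets Q"
proof -
  have ne: "{w\<in>space Q. Z s w \<noteq> Z r w} \<in> sets Q" if "0 \<le> s" "0 \<le> r" for s r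
  proof -
    have "Z s \<in> measurable Q (count_space UNIV)" "Z r \<in> measurable Q (count_space UNIV)"
      using that by (auto intro: assms(1))
    then show ?thesis by measurable
  qed
  have "{w\<in>space Q. dyadic_jumps_twice t n (\<lambda>s. Z s w)} =
      (\<Union>j\<in>{..2^n}. \<Union>i\<in>{..<j}. {w\<in>space Q. Z (t * real i / 2^n) w \<noteq> Z 0 w} \<inter>
        {w\<in>space Q. Z (t * real j / 2^n) w \<noteq> Z (t * real i / 2^n) w})"
    by (auto simp: dyadic_jumps_twice_def)
  also have "\<dots> \<in> sets Q"
    using t by (intro sets.finite_UN sets.Int ne) auto
  finally show ?thesis .
qed

lemma jumps_twice_event:
  fixes Z :: "real \<Rightarrow> 'w \<Rightarrow> 'e :: finite"
  assumes meas: "\<And>s. 0 \<le> s \<Longrightarrow> Z s \<in> measurable Q (count_space UNIV)" and t: "0 < t"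
    and rc: "\<And>w. w \<in> space Q \<Longrightarrow> right_constant (\<lambda>s. Z s w)"
  shows "{w\<in>space Q. jumps_twice t (\<lambda>s. Z s w)} \<in> sets Q"
proof -
  have "{w\<in>space Q. jumps_twice t (\<lambda>s. Z s w)} = (\<Union>n. {w\<in>space Q. dyadic_jumps_twice t n (\<lambda>s. Z s w)})"
    using jumps_twice_iff_dyadic[OF rc t] by auto
  also have "\<dots> \<in> sets Q" using dyadic_jumps_twice_event[OF meas] t by auto
  finally show ?thesis .
qed

text \<open>The grid with \<open>2^n\<close> steps of length \<open>t / 2^n\<close> has fewer than \<open>(2^n)\<^sup>2\<close> pairs of steps, each of which
  contributes at most \<open>C * (t / 2^n)\<^sup>2\<close>; the bound does not depend on \<open>n\<close>, and the grid events increase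
  to the event of two jumps.\<close>

lemma emeasure_jumps_twice_le:
  fixes Z :: "real \<Rightarrow> 'w \<Rightarrow> 'e :: finite"
  assumes meas: "\<And>s. 0 \<le> s \<Longrightarrow> Z s \<in> measurable Q (count_space UNIV)" and t: "0 < t"
    and rc: "\<And>w. w \<in> space Q \<Longrightarrow> right_constant (\<lambda>s. Z s w)"
    and C: "0 \<le> C"
    and bound: "\<And>s r s' r'. 0 \<le> s \<Longrightarrow> s < r \<Longrightarrow> r \<le> s' \<Longrightarrow> s' < r' \<Longrightarrow> r' \<le> t \<Longrightarrow>
      emeasure Q {w\<in>space Q. Z s w \<noteq> Z r w \<and> Z s' w \<noteq> Z r' w} \<le> ennreal (C * (r - s) * (r' - s'))"
  shows "emeasure Q {w\<in>space Q. jumps_twice t (\<lambda>s. Z s w)} \<le> ennreal (C * t\<^sup>2)"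
proof -
  let ?D = "\<lambda>n. {w\<in>space Q. dyadic_jumps_twice t n (\<lambda>s. Z s w)}"
  have D: "?D n \<in> sets Q" for n using dyadic_jumps_twice_event[OF meas] t by auto
  have "{w\<in>space Q. jumps_twice t (\<lambda>s. Z s w)} = (\<Union>n. ?D n)"
    using jumps_twice_iff_dyadic[OF rc t] by auto
  moreover have "emeasure Q (\<Union>n. ?D n) = (SUP n. emeasure Q (?D n))"
    by (rule SUP_emeasure_incseq[symmetric]) (use D in \<open>auto intro!: incseq_SucI dyadic_jumps_twice_Suc\<close>)
  moreover have "emeasure Q (?D n) \<le> ennreal (C * t\<^sup>2)" for n
  proof -
    define p where "p k = t * real k / 2^n" for k
    define B where "B k l = {w\<in>space Q. Z (p k) w \<noteq> Z (p (Suc k)) w \<and> Z (p l) w \<noteq> Z (p (Suc l)) w}" for k l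
    have p0: "0 \<le> p k" for k using t by (simp add: p_def)
    have p_mono: "p k \<le> p l" if "k \<le> l" for k l
      unfolding p_def using that t by (intro divide_right_mono mult_left_mono) auto
    have p_step: "p (Suc k) - p k = t / 2^n" for k by (simp add: p_def field_simps)
    have p_le: "p k \<le> t" if "k \<le> 2^n" for k
      using p_mono[OF that] by (simp add: p_def)
    have h: "0 < t / 2^n" using t by simp
    have B_meas: "B k l \<in> sets Q" for k l
    proof -
      have "Z (p i) \<in> measurable Q (count_space UNIV)" for i by (intro meas p0)
      note [measurable] = this[of k] this[of "Suc k"] this[of l] this[of "Suc l"]
      show ?thesis unfolding B_def by measurable
    qed
    have "?D n \<subseteq> (\<Union>l\<in>{..<2^n}. \<Union>k\<in>{..<l}. B k l)"
    proof
      fix w assume w: "w \<in> ?D n"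
      then obtain l k where "l < 2^n" "k < l"
        "Z (t * real k / 2^n) w \<noteq> Z (t * real (Suc k) / 2^n) w" "Z (t * real l / 2^n) w \<noteq> Z (t * real (Suc l) / 2^n) w"
        using dyadic_jumps_twice_changes[of t n "\<lambda>s. Z s w"] by auto
      then show "w \<in> (\<Union>l\<in>{..<2^n}. \<Union>k\<in>{..<l}. B k l)"
        using w unfolding B_def p_def by blast
    qed
    then have "emeasure Q (?D n) \<le> emeasure Q (\<Union>l\<in>{..<2^n}. \<Union>k\<in>{..<l}. B k l)"
      by (rule emeasure_mono) (use B_meas in auto)
    also have "\<dots> \<le> (\<Sum>l<2^n. emeasure Q (\<Union>k\<in>{..<l}. B k l))"
      by (rule emeasure_subadditive_finite) (use B_meas in auto)
    also have "\<dots> \<le> (\<Sum>l<2^n. \<Sum>k<l. emeasure Q (B k l))"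
      by (intro sum_mono emeasure_subadditive_finite) (use B_meas in auto)
    also have "\<dots> \<le> (\<Sum>l<(2::nat)^n. \<Sum>k<l. ennreal (C * (t / 2^n) * (t / 2^n)))"
    proof (intro sum_mono)
      fix l k :: nat assume l: "l \<in> {..<2^n}" and k: "k \<in> {..<l}"
      have "emeasure Q (B k l) \<le> ennreal (C * (p (Suc k) - p k) * (p (Suc l) - p l))"
        unfolding B_def
        using p_step[of k] p_step[of l] h l k by (intro bound p0 p_mono p_le) auto
      then show "emeasure Q (B k l) \<le> ennreal (C * (t / 2^n) * (t / 2^n))" by (simp only: p_step)
    qed
    also have "\<dots> \<le> (\<Sum>l<(2::nat)^n. \<Sum>k<(2::nat)^n. ennreal (C * (t / 2^n) * (t / 2^n)))"
      by (intro sum_mono sum_mono2) auto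
    also have "\<dots> = ennreal (\<Sum>l<(2::nat)^n. \<Sum>k<(2::nat)^n. C * (t / 2^n) * (t / 2^n))"
      using C t by (simp add: sum_nonneg del: sum_constant)
    also have "(\<Sum>l<(2::nat)^n. \<Sum>k<(2::nat)^n. C * (t / 2^n) * (t / 2^n)) = C * t\<^sup>2"
      by (simp add: power2_eq_square field_simps)
    finally show ?thesis .
  qed
  ultimately show ?thesis by (simp add: SUP_le_iff)
qed

context markov_additive_process
begin

lemma tilted_markov_property_total:
  assumes V: "V \<in> borel_measurable (F t)" and s: "0 \<le> s" and t: "0 \<le> t"
  shows "(\<integral>\<^sup>+w. V w * ennreal (exp (\<theta> * \<xi> (t + s) w)) \<partial>P a x) =
    (\<integral>\<^sup>+w. V w * ennreal (exp (\<theta> * \<xi> t w)) * (\<Sum>c\<in>UNIV. tilted_kernel \<theta> s (J t w) c) \<partial>P a x)"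
proof -
  let ?E = "\<lambda>u w. ennreal (exp (\<theta> * \<xi> u w))"
  have ts: "0 \<le> t + s" using s t by simp
  have V': "V \<in> borel_measurable (P a x)" using V by (rule measurable_F_P)
  note meas = borel_measurable_times_ennreal V' measurable_compose[OF _ measurable_ennreal] J_indicator_measurable
    measurable_compose[OF _ borel_measurable_exp] borel_measurable_times borel_measurable_const xi_measurable ts t
    measurable_compose[OF J_measurable[OF t]]
  have "(\<integral>\<^sup>+w. V w * ?E (t + s) w \<partial>P a x) =
      (\<integral>\<^sup>+w. (\<Sum>c\<in>UNIV. V w * (?E (t + s) w * indicator {c} (J (t + s) w))) \<partial>P a x)"
    by (simp add: sum_distrib_left[symmetric] indicator_def)
  also have "\<dots> = (\<Sum>c\<in>UNIV. \<integral>\<^sup>+w. V w * (?E (t + s) w * indicator {c} (J (t + s) w)) \<partial>P a x)"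
    by (intro nn_integral_sum meas)
  also have "\<dots> = (\<Sum>c\<in>UNIV. \<integral>\<^sup>+w. V w * ?E t w * tilted_kernel \<theta> s (J t w) c \<partial>P a x)"
    by (simp only: tilted_markov_property[OF V s t])
  also have "\<dots> = (\<integral>\<^sup>+w. (\<Sum>c\<in>UNIV. V w * ?E t w * tilted_kernel \<theta> s (J t w) c) \<partial>P a x)"
    by (intro nn_integral_sum[symmetric] meas) simp
  finally show ?thesis by (simp only: sum_distrib_left)
qed

text \<open>When the rows of the kernel sum to one, \<open>exp (\<theta> * \<xi>)\<close> is a martingale; for \<open>\<theta> = 1\<close> this process is
  \<open>Y\<close>.\<close>

lemma conservative_kernel_martingale:
  assumes cons: "\<And>b. (\<Sum>c\<in>UNIV. tilted_kernel \<theta> s b c) = 1"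
    and V: "V \<in> borel_measurable (F t)" and s: "0 \<le> s" and t: "0 \<le> t"
  shows "(\<integral>\<^sup>+w. V w * ennreal (exp (\<theta> * \<xi> (t + s) w)) \<partial>P a x) = (\<integral>\<^sup>+w. V w * ennreal (exp (\<theta> * \<xi> t w)) \<partial>P a x)"
  using tilted_markov_property_total[OF V s t, where \<theta>=\<theta> and a=a and x=x] by (simp add: cons)

text \<open>Split according to the state \<open>d\<close> at time \<open>t\<close> and the state \<open>c\<close> different from \<open>d\<close> at time \<open>t + s\<close>.\<close>

lemma change_of_state_le:
  assumes leave: "\<And>b. (\<Sum>c\<in>UNIV - {b}. tilted_kernel \<theta> s b c) \<le> \<kappa>"
    and V: "V \<in> borel_measurable (F t)" and s: "0 \<le> s" and t: "0 \<le> t"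
  shows "(\<integral>\<^sup>+w. V w * (ennreal (exp (\<theta> * \<xi> (t + s) w)) * indicator (- {J t w}) (J (t + s) w)) \<partial>P a x) \<le>
    \<kappa> * (\<integral>\<^sup>+w. V w * ennreal (exp (\<theta> * \<xi> t w)) \<partial>P a x)"
proof -
  let ?E = "\<lambda>u w. ennreal (exp (\<theta> * \<xi> u w))"
  have ts: "0 \<le> t + s" using s t by simp
  have V': "V \<in> borel_measurable (P a x)" using V by (rule measurable_F_P)
  note meas = borel_measurable_times_ennreal V' measurable_compose[OF _ measurable_ennreal] J_indicator_measurable
    measurable_compose[OF _ borel_measurable_exp] borel_measurable_times borel_measurable_const xi_measurable ts t
  have k_meas: "(\<lambda>w. tilted_kernel \<theta> s (J t w) c) \<in> borel_measurable (P a x)" for c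
    by (rule measurable_compose[OF J_measurable[OF t]]) simp
  have VF: "(\<lambda>w. V w * indicator {d} (J t w)) \<in> borel_measurable (F t)" for d
    by (intro borel_measurable_times_ennreal V measurable_compose[OF J_adapted[OF t]]) simp
  let ?I = "\<lambda>d c w. (V w * indicator {d} (J t w)) * (?E (t + s) w * indicator {c} (J (t + s) w))"
  let ?K = "\<lambda>d c w. (V w * indicator {d} (J t w)) * ?E t w * tilted_kernel \<theta> s (J t w) c"
  have split: "(\<Sum>d\<in>UNIV. \<Sum>c\<in>UNIV - {d}. f * indicator {d} j * (g c)) = f * (\<Sum>c\<in>UNIV - {j}. g c)"
    for f :: ennreal and g :: "'e \<Rightarrow> ennreal" and j
  proof -
    have "(\<Sum>d\<in>UNIV. \<Sum>c\<in>UNIV - {d}. f * indicator {d} j * (g c)) =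
        (\<Sum>d\<in>UNIV. if d = j then f * (\<Sum>c\<in>UNIV - {j}. g c) else 0)"
      by (intro sum.cong refl) (auto simp: sum_distrib_left)
    then show ?thesis by simp
  qed
  have hit: "(\<Sum>c\<in>UNIV - {j}. u * indicator {c} i) = u * indicator (- {j}) i" for u :: ennreal and i j :: 'e
    by (auto simp: sum_distrib_left[symmetric] indicator_def)
  have "(\<integral>\<^sup>+w. V w * (?E (t + s) w * indicator (- {J t w}) (J (t + s) w)) \<partial>P a x) =
      (\<integral>\<^sup>+w. (\<Sum>d\<in>UNIV. \<Sum>c\<in>UNIV - {d}. ?I d c w) \<partial>P a x)"
    by (simp only: split hit)
  also have "\<dots> = (\<Sum>d\<in>UNIV. \<Sum>c\<in>UNIV - {d}. \<integral>\<^sup>+w. ?I d c w \<partial>P a x)"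
    by (subst nn_integral_sum) (intro borel_measurable_sum meas, intro sum.cong refl nn_integral_sum meas)
  also have "\<dots> = (\<Sum>d\<in>UNIV. \<Sum>c\<in>UNIV - {d}. \<integral>\<^sup>+w. ?K d c w \<partial>P a x)"
    by (simp only: tilted_markov_property[OF VF s t])
  also have "\<dots> = (\<integral>\<^sup>+w. (\<Sum>d\<in>UNIV. \<Sum>c\<in>UNIV - {d}. ?K d c w) \<partial>P a x)"
    by (subst nn_integral_sum)
       (intro borel_measurable_sum meas k_meas, intro sum.cong refl nn_integral_sum[symmetric] meas k_meas)
  also have "\<dots> = (\<integral>\<^sup>+w. V w * (\<Sum>c\<in>UNIV - {J t w}. ?E t w * tilted_kernel \<theta> s (J t w) c) \<partial>P a x)"
    by (simp only: mult.assoc[of "_ * indicator _ _"] split)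
  also have "\<dots> \<le> (\<integral>\<^sup>+w. \<kappa> * (V w * ?E t w) \<partial>P a x)"
  proof (rule nn_integral_mono)
    fix w
    have "V w * (\<Sum>c\<in>UNIV - {J t w}. ?E t w * tilted_kernel \<theta> s (J t w) c) =
        (\<Sum>c\<in>UNIV - {J t w}. tilted_kernel \<theta> s (J t w) c) * (V w * ?E t w)"
      by (simp add: sum_distrib_left[symmetric] mult_ac)
    also have "\<dots> \<le> \<kappa> * (V w * ?E t w)"
      by (rule mult_right_mono[OF leave]) simp
    finally show "V w * (\<Sum>c\<in>UNIV - {J t w}. ?E t w * tilted_kernel \<theta> s (J t w) c)
        \<le> \<kappa> * (V w * ?E t w)" .
  qed
  also have "\<dots> = \<kappa> * (\<integral>\<^sup>+w. V w * ?E t w \<partial>P a x)"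
    by (rule nn_integral_cmult) (intro meas)
  finally show ?thesis .
qed

text \<open>Peel off the times from the last to the first: between changes the weight is a martingale, and each
  change costs a factor \<open>\<rho>\<close> times the length of the step.\<close>

lemma two_changes_of_state_le:
  assumes cons: "\<And>b s. 0 \<le> s \<Longrightarrow> (\<Sum>c\<in>UNIV. tilted_kernel \<theta> s b c) = 1"
    and leave: "\<And>b s. 0 < s \<Longrightarrow> (\<Sum>c\<in>UNIV - {b}. tilted_kernel \<theta> s b c) \<le> ennreal (\<rho> * s)"
    and l: "0 \<le> \<rho>" and ord: "0 \<le> s1" "s1 < r1" "r1 \<le> s2" "s2 < r2" "r2 \<le> t"
  shows "(\<integral>\<^sup>+w. ennreal (exp (\<theta> * \<xi> t w)) * indicator {w\<in>space M. J s1 w \<noteq> J r1 w \<and> J s2 w \<noteq> J r2 w} w \<partial>P a x) \<le>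
    ennreal (\<rho>\<^sup>2 * exp (\<theta> * x) * (r1 - s1) * (r2 - s2))"
proof -
  define V1 :: "'w \<Rightarrow> ennreal" where "V1 w = indicator (- {J s1 w}) (J r1 w)" for w
  define V2 :: "'w \<Rightarrow> ennreal" where "V2 w = indicator (- {J s2 w}) (J r2 w)" for w
  have ind: "(\<lambda>w. indicator (- {J s w}) (J r w)) \<in> borel_measurable (F u)" if "0 \<le> s" "s \<le> r" "r \<le> u" for s r u
  proof -
    have [measurable]: "J s \<in> measurable (F u) (count_space UNIV)" "J r \<in> measurable (F u) (count_space UNIV)"
      using that by (auto intro: measurable_F_mono[OF _ J_adapted])
    have "(\<lambda>w. indicator {w\<in>space (F u). J s w \<noteq> J r w} w :: 'b :: {topological_space, zero_neq_one}) \<in> borel_measurable (F u)"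
      by (intro borel_measurable_indicator) measurable
    then show ?thesis
      by (rule measurable_cong[THEN iffD1, rotated]) (auto simp: indicator_def)
  qed
  have V1: "V1 \<in> borel_measurable (F u)" if "r1 \<le> u" for u
    unfolding V1_def[abs_def] using ord that by (intro ind) auto
  have V12: "(\<lambda>w. V1 w * V2 w) \<in> borel_measurable (F r2)"
    unfolding V2_def using ord by (intro borel_measurable_times_ennreal V1 ind) auto
  let ?E = "\<lambda>u w. ennreal (exp (\<theta> * \<xi> u w))"
  have "(\<integral>\<^sup>+w. ?E t w * indicator {w\<in>space M. J s1 w \<noteq> J r1 w \<and> J s2 w \<noteq> J r2 w} w \<partial>P a x) =
      (\<integral>\<^sup>+w. V1 w * V2 w * ?E t w \<partial>P a x)"
    by (intro nn_integral_cong) (auto simp: V1_def V2_def indicator_def)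
  also have "\<dots> = (\<integral>\<^sup>+w. V1 w * V2 w * ?E r2 w \<partial>P a x)"
    using conservative_kernel_martingale[OF cons V12, of "t - r2" a x] ord by simp
  also have "\<dots> = (\<integral>\<^sup>+w. V1 w * (?E r2 w * indicator (- {J s2 w}) (J r2 w)) \<partial>P a x)"
    by (simp add: V2_def mult_ac)
  also have "\<dots> \<le> ennreal (\<rho> * (r2 - s2)) * (\<integral>\<^sup>+w. V1 w * ?E s2 w \<partial>P a x)"
    using change_of_state_le[OF leave V1, of "r2 - s2" s2 a x] ord by simp
  also have "(\<integral>\<^sup>+w. V1 w * ?E s2 w \<partial>P a x) = (\<integral>\<^sup>+w. V1 w * ?E r1 w \<partial>P a x)"
    using conservative_kernel_martingale[OF cons V1, of "s2 - r1" r1 a x] ord by simp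
  also have "\<dots> = (\<integral>\<^sup>+w. 1 * (?E r1 w * indicator (- {J s1 w}) (J r1 w)) \<partial>P a x)"
    by (simp add: V1_def mult_ac)
  also have "\<dots> \<le> ennreal (\<rho> * (r1 - s1)) * (\<integral>\<^sup>+w. 1 * ?E s1 w \<partial>P a x)"
    using change_of_state_le[OF leave, of "r1 - s1" "\<lambda>_. 1" s1 a x] ord by simp
  also have "(\<integral>\<^sup>+w. 1 * ?E s1 w \<partial>P a x) = ennreal (exp (\<theta> * x))"
    using total_kernel_translation[where s=s1 and \<theta>=\<theta> and a=a and x=x] cons[of s1 a] ord by simp
  also have "ennreal (\<rho> * (r2 - s2)) * (ennreal (\<rho> * (r1 - s1)) * ennreal (exp (\<theta> * x))) =
      ennreal (\<rho>\<^sup>2 * exp (\<theta> * x) * (r1 - s1) * (r2 - s2))"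
    using l ord by (simp add: ennreal_mult[symmetric] power2_eq_square mult_ac)
  finally show ?thesis by (simp add: mult_left_mono)
qed

lemma J_jumps_twice_event: "0 < t \<Longrightarrow> {w\<in>space M. jumps_twice t (\<lambda>s. J s w)} \<in> sets (P a x)"
  using jumps_twice_event[where Z=J and Q="P a x" and t=t] J_measurable J_right_constant by simp

text \<open>The bound on two jumps under the law with density \<open>exp (\<theta> * \<xi> t)\<close>.\<close>

lemma tilted_jumps_twice_le:
  assumes cons: "\<And>b s. 0 \<le> s \<Longrightarrow> (\<Sum>c\<in>UNIV. tilted_kernel \<theta> s b c) = 1"
    and leave: "\<And>b s. 0 < s \<Longrightarrow> (\<Sum>c\<in>UNIV - {b}. tilted_kernel \<theta> s b c) \<le> ennreal (\<rho> * s)"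
    and l: "0 \<le> \<rho>" and t: "0 < t"
  shows "(\<integral>\<^sup>+w. ennreal (exp (\<theta> * \<xi> t w)) * indicator {w\<in>space M. jumps_twice t (\<lambda>s. J s w)} w \<partial>P a x) \<le>
    ennreal (\<rho>\<^sup>2 * exp (\<theta> * x) * t\<^sup>2)"
proof -
  let ?f = "\<lambda>w. ennreal (exp (\<theta> * \<xi> t w))"
  let ?Q = "density (P a x) ?f"
  have [measurable]: "\<xi> t \<in> borel_measurable (P a x)" using t by (intro xi_measurable) auto
  have f: "?f \<in> borel_measurable (P a x)" by measurable
  have eQ: "emeasure ?Q A = (\<integral>\<^sup>+w. ?f w * indicator A w \<partial>P a x)" if "A \<in> sets (P a x)" for A
    by (rule emeasure_density[OF f that])
  have "emeasure ?Q {w\<in>space ?Q. jumps_twice t (\<lambda>s. J s w)} \<le> ennreal (\<rho>\<^sup>2 * exp (\<theta> * x) * t\<^sup>2)"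
  proof (rule emeasure_jumps_twice_le[OF _ t])
    show "J s \<in> measurable ?Q (count_space UNIV)" if "0 \<le> s" for s
      using J_measurable[OF that] by simp
    show "right_constant (\<lambda>s. J s w)" if "w \<in> space ?Q" for w
      using that by (intro J_right_constant) simp
    fix s r s' r' :: real
    assume ord: "0 \<le> s" "s < r" "r \<le> s'" "s' < r'" "r' \<le> t"
    have [measurable]: "J s \<in> measurable (P a x) (count_space UNIV)" "J r \<in> measurable (P a x) (count_space UNIV)"
      "J s' \<in> measurable (P a x) (count_space UNIV)" "J r' \<in> measurable (P a x) (count_space UNIV)"
      using ord by (auto intro: J_measurable)
    have "{w\<in>space (P a x). J s w \<noteq> J r w \<and> J s' w \<noteq> J r' w} \<in> sets (P a x)"
      by measurable
    then show "emeasure ?Q {w\<in>space ?Q. J s w \<noteq> J r w \<and> J s' w \<noteq> J r' w} \<le> ennreal (\<rho>\<^sup>2 * exp (\<theta> * x) * (r - s) * (r' - s'))"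
      using two_changes_of_state_le[OF cons leave l ord, of a x] by (simp add: eQ)
  qed simp
  then show ?thesis using J_jumps_twice_event[OF t, of a x] by (simp add: eQ)
qed

end

section \<open>The path up to the second jump\<close>

text \<open>The first sojourn uses coordinate 0 and the second one coordinate 1 of the first sequence, the jump
  between them coordinate 0 of the second sequence: three independent variables.\<close>

lemma nn_integral_noise_factors:
  fixes f1 f2 g :: "'l \<Rightarrow> ennreal"
  assumes N: "prob_space N"
    and [measurable]: "f1 \<in> borel_measurable N" "f2 \<in> borel_measurable N" "g \<in> borel_measurable N"
  shows "(\<integral>\<^sup>+z. f1 (fst z 0) * f2 (fst z 1) * g (snd z 0)
      \<partial>((\<Pi>\<^sub>M n\<in>(UNIV::nat set). N) \<Otimes>\<^sub>M (\<Pi>\<^sub>M n\<in>(UNIV::nat set). N))) =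
    (\<integral>\<^sup>+x. f1 x \<partial>N) * (\<integral>\<^sup>+x. f2 x \<partial>N) * (\<integral>\<^sup>+x. g x \<partial>N)"
proof -
  interpret N: prob_space N by fact
  interpret product_prob_space "\<lambda>_::nat. N" UNIV ..
  let ?S = "PiM (UNIV::nat set) (\<lambda>_. N)"
  have S: "sigma_finite_measure ?S"
    by (rule prob_space_imp_sigma_finite) (rule prob_space_PiM, rule N)
  have c[measurable]: "(\<lambda>l. l n) \<in> measurable ?S N" for n by (rule measurable_component_singleton) simp
  have single: "(\<integral>\<^sup>+u. g (u 0) \<partial>?S) = (\<integral>\<^sup>+x. g x \<partial>N)"
    using nn_integral_distr[OF c[of 0], of g] distr_PiM_component[of UNIV "\<lambda>_::nat. N" 0] N by simp
  have pair: "(\<integral>\<^sup>+l. f1 (l 0) * f2 (l 1) \<partial>?S) = (\<integral>\<^sup>+x. f1 x \<partial>N) * (\<integral>\<^sup>+x. f2 x \<partial>N)"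
  proof -
    let ?f = "\<lambda>i::nat. if i = 0 then f1 else f2"
    let ?T = "PiM {0, 1::nat} (\<lambda>_. N)"
    have [measurable]: "?f i \<in> borel_measurable N" for i by simp
    have m: "(\<lambda>l. \<Prod>i\<in>{0, 1::nat}. ?f i (l i)) \<in> borel_measurable ?T"
      by (intro borel_measurable_prod_ennreal measurable_compose[OF measurable_component_singleton]) auto
    have "(\<integral>\<^sup>+l. f1 (l 0) * f2 (l 1) \<partial>?S) = (\<integral>\<^sup>+l. (\<Prod>i\<in>{0, 1::nat}. ?f i (restrict l {0, 1} i)) \<partial>?S)"
      by simp
    also have "\<dots> = (\<integral>\<^sup>+l. (\<Prod>i\<in>{0, 1::nat}. ?f i (l i)) \<partial>distr ?S ?T (\<lambda>l. restrict l {0, 1}))"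
    proof (rule nn_integral_distr[symmetric])
      show "(\<lambda>l. restrict l {0, 1}) \<in> measurable ?S ?T" by (rule measurable_restrict_subset) simp
      show "(\<lambda>l. \<Prod>i\<in>{0, 1::nat}. ?f i (l i)) \<in> borel_measurable (distr ?S ?T (\<lambda>l. restrict l {0, 1}))"
        using m by (simp only: measurable_distr_eq1)
    qed
    also have "distr ?S ?T (\<lambda>l. restrict l {0, 1}) = ?T"
      by (rule distr_PiM_restrict_finite) auto
    also have "(\<integral>\<^sup>+l. (\<Prod>i\<in>{0, 1::nat}. ?f i (l i)) \<partial>?T) = (\<Prod>i\<in>{0, 1::nat}. \<integral>\<^sup>+x. ?f i x \<partial>N)"
      by (rule product_nn_integral_prod) auto
    finally show ?thesis by simp
  qed
  have "(\<integral>\<^sup>+z. f1 (fst z 0) * f2 (fst z 1) * g (snd z 0) \<partial>(?S \<Otimes>\<^sub>M ?S)) =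
      (\<integral>\<^sup>+l. \<integral>\<^sup>+u. f1 (l 0) * f2 (l 1) * g (u 0) \<partial>?S \<partial>?S)"
    by (subst sigma_finite_measure.nn_integral_fst[OF S, symmetric]) auto
  also have "\<dots> = (\<integral>\<^sup>+l. f1 (l 0) * f2 (l 1) * (\<integral>\<^sup>+u. g (u 0) \<partial>?S) \<partial>?S)"
    by (subst nn_integral_cmult) auto
  also have "\<dots> = (\<integral>\<^sup>+l. f1 (l 0) * f2 (l 1) \<partial>?S) * (\<integral>\<^sup>+u. g (u 0) \<partial>?S)"
    by (rule nn_integral_multc) measurable
  finally show ?thesis by (simp only: single pair)
qed

locale markov_additive_characteristics =
  markov_additive_process M P F J \<xi> + map_characteristics P J \<xi> q N L U
  for M :: "'w measure" and P :: "'e::{finite,discrete_topology} \<Rightarrow> real \<Rightarrow> 'w measure"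
    and F J \<xi> q and N :: "'l measure" and L U
begin

abbreviation noise :: "((nat \<Rightarrow> 'l) \<times> (nat \<Rightarrow> 'l)) measure" where
  "noise \<equiv> (\<Pi>\<^sub>M n\<in>(UNIV::nat set). N) \<Otimes>\<^sub>M (\<Pi>\<^sub>M n\<in>(UNIV::nat set). N)"

definition glued_path :: "'w \<Rightarrow> (nat \<Rightarrow> 'l) \<times> (nat \<Rightarrow> 'l) \<Rightarrow> real \<Rightarrow> real" where
  "glued_path w z = concat_path (\<lambda>s. J s w) (\<lambda>\<alpha> n s. L \<alpha> s (fst z n)) (\<lambda>\<alpha> \<beta> n. U \<alpha> \<beta> (snd z n))"

abbreviation noise_mean :: "'w \<Rightarrow> real \<Rightarrow> ennreal" where
  "noise_mean w t \<equiv> \<integral>\<^sup>+z. ennreal (exp (glued_path w z t)) \<partial>noise"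

definition moment :: "'e \<Rightarrow> real \<Rightarrow> ennreal" where
  "moment a = levy_process.moment N (L a)"

lemma moment_altdef: "moment a t = (\<integral>\<^sup>+w. ennreal (exp (L a t w)) \<partial>N)"
  unfolding moment_def by (rule levy_process.moment_def[OF levy_L])

lemma prob_space_N: "prob_space N"
  using levy_L by (rule levy_process.axioms(1))

lemma prob_space_noise: "prob_space noise"
  by (intro prob_space_pair prob_space_PiM prob_space_N)

abbreviation path_space :: "(real \<Rightarrow> 'e \<times> real) measure" where
  "path_space \<equiv> \<Pi>\<^sub>M t\<in>{0..}. state_space"

text \<open>The structure law as an iterated integral: given the path of \<open>J\<close>, integrate over the noise that
  drives \<open>\<xi>\<close>.\<close>

lemma structure_nn_integral:
  assumes \<phi>: "\<phi> \<in> borel_measurable path_space"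
  shows "(\<integral>\<^sup>+w. \<phi> (\<lambda>t\<in>{0..}. (J t w, \<xi> t w)) \<partial>P a x) =
    (\<integral>\<^sup>+w. \<integral>\<^sup>+z. \<phi> (\<lambda>t\<in>{0..}. (J t w, x + glued_path w z t)) \<partial>noise \<partial>P a x)"
proof -
  interpret noise: prob_space noise by (rule prob_space_noise)
  let ?X = "\<lambda>w. \<lambda>t\<in>{0..}. (J t w, \<xi> t w)"
  let ?Z = "\<lambda>(w, l, u). \<lambda>t\<in>{0..}. (J t w, x + glued_path w (l, u) t)"
  have law: "distr (P a x) path_space ?X = distr (P a x \<Otimes>\<^sub>M noise) path_space ?Z"
    using structure_law[of a x] by (simp add: glued_path_def)
  have X: "?X \<in> measurable (P a x) path_space"
    by (intro measurable_restrict measurable_F_P[OF adapted]) auto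
  have Z: "?Z \<in> measurable (P a x \<Otimes>\<^sub>M noise) path_space"
    by (rule measurable_of_distr_eq[OF X prob_space_P _ law]) (simp add: space_PiM split_beta' PiE_iff space_pair_measure)
  have "(\<integral>\<^sup>+w. \<phi> (?X w) \<partial>P a x) = (\<integral>\<^sup>+y. \<phi> y \<partial>distr (P a x) path_space ?X)"
    using \<phi> by (intro nn_integral_distr[symmetric, OF X]) (simp only: measurable_distr_eq1)
  also have "\<dots> = (\<integral>\<^sup>+v. \<phi> (?Z v) \<partial>(P a x \<Otimes>\<^sub>M noise))"
    unfolding law using \<phi> by (intro nn_integral_distr[OF Z]) (simp only: measurable_distr_eq1)
  also have "\<dots> = (\<integral>\<^sup>+w. \<integral>\<^sup>+z. \<phi> (?Z (w, z)) \<partial>noise \<partial>P a x)"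
    by (rule noise.nn_integral_fst[symmetric]) (rule measurable_compose[OF Z \<phi>])
  finally show ?thesis by (simp add: split_beta)
qed

text \<open>\<open>J\<close> is in \<open>b\<close> at time \<open>t\<close> after at most one jump: it has stayed in \<open>b\<close>, or has jumped there directly
  from its starting point.\<close>

definition direct_passage :: "real \<Rightarrow> 'e \<Rightarrow> 'w set" where
  "direct_passage t b = {w\<in>space M. J t w = b \<and> \<not> jumps_twice t (\<lambda>s. J s w)}"

abbreviation direct_mean :: "'e \<Rightarrow> 'e \<Rightarrow> real \<Rightarrow> ennreal" where
  "direct_mean a b t \<equiv> \<integral>\<^sup>+w. ennreal (exp (\<xi> t w)) * indicator (direct_passage t b) w \<partial>P a 0"

lemma direct_passage_sets: "0 < t \<Longrightarrow> direct_passage t b \<in> sets (P a x)"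
proof -
  assume t: "0 < t"
  have [measurable]: "J t \<in> measurable (P a x) (count_space UNIV)" using t by (intro J_measurable) auto
  have "direct_passage t b = {w\<in>space (P a x). J t w = b} - {w\<in>space M. jumps_twice t (\<lambda>s. J s w)}"
    by (auto simp: direct_passage_def)
  also have "\<dots> \<in> sets (P a x)"
  proof (rule sets.Diff[OF _ J_jumps_twice_event[OF t]])
    show "{w\<in>space (P a x). J t w = b} \<in> sets (P a x)" by measurable
  qed
  finally show ?thesis .
qed

text \<open>By its dyadic description the event of two jumps depends on countably many coordinates of \<open>J\<close>, so it
  is an event of the path space, on which the structure law can be used.\<close>

lemma expectation_direct_passage:
  assumes t: "0 < t"
  shows "direct_mean a b t =
    (\<integral>\<^sup>+w. indicator (direct_passage t b) w * noise_mean w t \<partial>P a 0)"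
proof -
  let ?C = "{y\<in>space path_space. fst (y t) = b} - (\<Union>n. {y\<in>space path_space. dyadic_jumps_twice t n (\<lambda>s. fst (y s))})"
  let ?\<phi> = "\<lambda>y. ennreal (exp (snd (y t))) * indicator ?C y"
  have comp: "(\<lambda>y. y s) \<in> measurable path_space state_space" if "0 \<le> s" for s
    using that by (intro measurable_component_singleton) auto
  have f: "(\<lambda>y. fst (y s)) \<in> measurable path_space (count_space UNIV)" if "0 \<le> s" for s
    by (rule measurable_compose[OF comp[OF that] measurable_fst])
  have s: "(\<lambda>y. snd (y t)) \<in> borel_measurable path_space"
    using t by (intro measurable_compose[OF comp measurable_snd]) auto
  have "{y\<in>space path_space. fst (y t) = b} \<in> sets path_space"
  proof -
    have "{y\<in>space path_space. fst (y t) = b} = (\<lambda>y. fst (y t)) -` {b} \<inter> space path_space" by auto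
    then show ?thesis using measurable_sets[OF f[of t], of "{b}"] t by simp
  qed
  then have "?C \<in> sets path_space"
    using dyadic_jumps_twice_event[where Z="\<lambda>s y. fst (y s)" and Q=path_space, OF f] t
    by (intro sets.Diff sets.countable_UN) auto
  then have \<phi>: "?\<phi> \<in> borel_measurable path_space"
    using s by measurable
  have C: "(\<lambda>r\<in>{0..}. (J r w, v r)) \<in> ?C \<longleftrightarrow> w \<in> direct_passage t b" if w: "w \<in> space M" for w v
  proof -
    have "dyadic_jumps_twice t n (\<lambda>s. fst ((\<lambda>r\<in>{0..}. (J r w, v r)) s)) = dyadic_jumps_twice t n (\<lambda>s. J s w)" for n
      using t by (simp add: dyadic_jumps_twice_def)
    then show ?thesis
      using w t jumps_twice_iff_dyadic[OF J_right_constant[OF w] t]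
      by (auto simp: direct_passage_def space_PiM space_pair_measure)
  qed
  have "direct_mean a b t =
      (\<integral>\<^sup>+w. ?\<phi> (\<lambda>r\<in>{0..}. (J r w, \<xi> r w)) \<partial>P a 0)"
  proof (rule nn_integral_cong)
    fix w assume "w \<in> space (P a 0)"
    then have "w \<in> space M" by simp
    from C[OF this, of "\<lambda>r. \<xi> r w"]
    show "ennreal (exp (\<xi> t w)) * indicator (direct_passage t b) w = ?\<phi> (\<lambda>r\<in>{0..}. (J r w, \<xi> r w))"
      using t unfolding indicator_def by simp
  qed
  also have "\<dots> = (\<integral>\<^sup>+w. \<integral>\<^sup>+z. ?\<phi> (\<lambda>r\<in>{0..}. (J r w, 0 + glued_path w z r)) \<partial>noise \<partial>P a 0)"
    by (rule structure_nn_integral[OF \<phi>])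
  also have "\<dots> = (\<integral>\<^sup>+w. indicator (direct_passage t b) w * noise_mean w t \<partial>P a 0)"
  proof (rule nn_integral_cong)
    fix w assume "w \<in> space (P a 0)"
    then have w: "w \<in> space M" by simp
    have "?\<phi> (\<lambda>r\<in>{0..}. (J r w, 0 + glued_path w z r)) =
        (if w \<in> direct_passage t b then ennreal (exp (glued_path w z t)) else 0)" for z
      using C[OF w, of "\<lambda>r. 0 + glued_path w z r"] t unfolding indicator_def by simp
    then have "(\<integral>\<^sup>+z. ?\<phi> (\<lambda>r\<in>{0..}. (J r w, 0 + glued_path w z r)) \<partial>noise) =
        (\<integral>\<^sup>+z. (if w \<in> direct_passage t b then ennreal (exp (glued_path w z t)) else 0) \<partial>noise)"
      by (rule nn_integral_cong)
    also have "\<dots> = indicator (direct_passage t b) w * noise_mean w t"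
      by (cases "w \<in> direct_passage t b") simp_all
    finally show "(\<integral>\<^sup>+z. ?\<phi> (\<lambda>r\<in>{0..}. (J r w, 0 + glued_path w z r)) \<partial>noise) =
        indicator (direct_passage t b) w * noise_mean w t" .
  qed
  finally show ?thesis .
qed

lemma L_measurable: "0 \<le> t \<Longrightarrow> L a t \<in> borel_measurable N"
  by (rule levy_process.measurable_levy[OF levy_L])

lemma expectation_no_jump:
  assumes t: "0 < t"
  shows "direct_mean a a t =
    moment a t * emeasure (P a 0) (direct_passage t a)"
proof -
  have [measurable]: "L a t \<in> borel_measurable N" using t by (intro L_measurable) auto
  have "direct_mean a a t =
    (\<integral>\<^sup>+w. indicator (direct_passage t a) w * noise_mean w t \<partial>P a 0)"
    by (rule expectation_direct_passage[OF t])
  also have "\<dots> = (\<integral>\<^sup>+w. moment a t * indicator (direct_passage t a) w \<partial>P a 0)"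
  proof (rule nn_integral_cong_AE)
    show "AE w in P a 0. indicator (direct_passage t a) w * noise_mean w t =
        moment a t * indicator (direct_passage t a) w"
      using start[of a 0]
    proof eventually_elim
      case (elim w)
      show ?case
      proof (cases "w \<in> direct_passage t a")
        case True
        then have w: "w \<in> space M" "J t w = a" "\<not> jumps_twice t (\<lambda>s. J s w)" by (auto simp: direct_passage_def)
        have "glued_path w z t = L a t (fst z 0)" for z
          unfolding glued_path_def
        proof (rule concat_path_no_jump[OF J_right_constant[OF w(1)]])
          show "0 \<le> t" using t by simp
          show "J s w = a" if "0 \<le> s" "s \<le> t" for s
            using not_jumps_twice_constant[OF w(3) _ that] elim w(2) by simp
        qed
        then have "noise_mean w t = (\<integral>\<^sup>+z. ennreal (exp (L a t (fst z 0))) * 1 * 1 \<partial>noise)"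
          by simp
        also have "\<dots> = (\<integral>\<^sup>+w. ennreal (exp (L a t w)) \<partial>N) * (\<integral>\<^sup>+w. 1 \<partial>N) * (\<integral>\<^sup>+w. 1 \<partial>N)"
          by (rule nn_integral_noise_factors[OF prob_space_N]) auto
        also have "\<dots> = moment a t"
          using prob_space.emeasure_space_1[OF prob_space_N] by (simp add: moment_altdef)
        finally show ?thesis using True by simp
      qed simp
    qed
  qed
  also have "\<dots> = moment a t * emeasure (P a 0) (direct_passage t a)"
    using direct_passage_sets[OF t] by (simp add: nn_integral_cmult)
  finally show ?thesis .
qed

text \<open>Given a jump from \<open>a\<close> to \<open>b\<close> at time \<open>T\<close>, the path is \<open>L a T + U a b + L b (t - T)\<close> with independent terms.
  The law of \<open>T\<close> is not known, so only bounds uniform in \<open>T\<close> are used.\<close>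

lemma expectation_one_jump_bounds:
  assumes t: "0 < t" and ab: "a \<noteq> b"
    and bounds: "\<And>s. 0 \<le> s \<Longrightarrow> s \<le> t \<Longrightarrow> lo \<le> moment a s * moment b (t - s) \<and> moment a s * moment b (t - s) \<le> hi"
  defines "u \<equiv> (\<integral>\<^sup>+w. ennreal (exp (U a b w)) \<partial>N)"
  shows "lo * u * emeasure (P a 0) (direct_passage t b) \<le>
      direct_mean a b t" (is ?lower)
    and "direct_mean a b t \<le>
      hi * u * emeasure (P a 0) (direct_passage t b)" (is ?upper)
proof -
  have inner: "lo * u \<le> noise_mean w t \<and> noise_mean w t \<le> hi * u" if w: "w \<in> direct_passage t b" and start: "J 0 w = a" for w
  proof -
    have w: "w \<in> space M" "J t w = b" "\<not> jumps_twice t (\<lambda>s. J s w)" using w by (auto simp: direct_passage_def)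
    obtain T where T: "0 < T" "T \<le> t" "\<And>s. 0 \<le> s \<Longrightarrow> s < T \<Longrightarrow> J s w = J 0 w" "\<And>s. T \<le> s \<Longrightarrow> s \<le> t \<Longrightarrow> J s w = J t w"
      using not_jumps_twice_one_jump[OF J_right_constant[OF w(1)] w(3)] t ab start w(2) by auto
    have [measurable]: "L a T \<in> borel_measurable N" "L b (t - T) \<in> borel_measurable N" "U a b \<in> borel_measurable N"
      using T ab by (auto intro: L_measurable measurable_U)
    have "glued_path w z t = L a T (fst z 0) + U a b (snd z 0) + L b (t - T) (fst z 1)" for z
      unfolding glued_path_def
      by (rule concat_path_one_jump[OF J_right_constant[OF w(1)] T(1,2) ab]) (use T start w(2) in auto)
    then have "noise_mean w t = (\<integral>\<^sup>+z. ennreal (exp (L a T (fst z 0))) * ennreal (exp (L b (t - T) (fst z 1))) * ennreal (exp (U a b (snd z 0))) \<partial>noise)"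
      by (simp add: exp_add ennreal_mult mult_ac)
    also have "\<dots> = moment a T * moment b (t - T) * u"
      unfolding moment_altdef u_def by (rule nn_integral_noise_factors[OF prob_space_N]) auto
    finally show ?thesis using bounds[of T] T by (auto intro: mult_right_mono)
  qed
  have ae: "AE w in P a 0. J 0 w = a" using start[of a 0] by eventually_elim simp
  note ev = direct_passage_sets[OF t, of b a 0]
  have "lo * u * emeasure (P a 0) (direct_passage t b) = (\<integral>\<^sup>+w. lo * u * indicator (direct_passage t b) w \<partial>P a 0)"
    using ev by (simp add: nn_integral_cmult)
  also have "\<dots> \<le> (\<integral>\<^sup>+w. indicator (direct_passage t b) w * noise_mean w t \<partial>P a 0)"
  proof (rule nn_integral_mono_AE)
    show "AE w in P a 0. lo * u * indicator (direct_passage t b) w \<le> indicator (direct_passage t b) w * noise_mean w t"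
      using ae by eventually_elim (auto simp: indicator_def inner)
  qed
  finally show ?lower by (simp only: expectation_direct_passage[OF t])
  have "(\<integral>\<^sup>+w. indicator (direct_passage t b) w * noise_mean w t \<partial>P a 0) \<le> (\<integral>\<^sup>+w. hi * u * indicator (direct_passage t b) w \<partial>P a 0)"
  proof (rule nn_integral_mono_AE)
    show "AE w in P a 0. indicator (direct_passage t b) w * noise_mean w t \<le> hi * u * indicator (direct_passage t b) w"
      using ae by eventually_elim (auto simp: indicator_def inner)
  qed
  also have "\<dots> = hi * u * emeasure (P a 0) (direct_passage t b)"
    using ev by (simp add: nn_integral_cmult)
  finally show ?upper by (simp only: expectation_direct_passage[OF t])
qed

end

section \<open>Short-time balance\<close>

context markov_additive_characteristics
begin

definition transition :: "'e \<Rightarrow> 'e \<Rightarrow> real \<Rightarrow> real" where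
  "transition a b t = measure (P a 0) {w\<in>space M. J t w = b}"

lemma state_event: "0 \<le> t \<Longrightarrow> {w\<in>space M. J t w = b} \<in> sets (P a x)"
proof -
  assume "0 \<le> t"
  then have [measurable]: "J t \<in> measurable (P a x) (count_space UNIV)" by (rule J_measurable)
  have "{w\<in>space (P a x). J t w = b} \<in> sets (P a x)" by measurable
  then show ?thesis by simp
qed

lemma kernel_zero: "0 \<le> t \<Longrightarrow> tilted_kernel 0 t a b = ennreal (transition a b t)"
proof -
  assume t: "0 \<le> t"
  interpret prob_space "P a 0" by (rule prob_space_P)
  have "tilted_kernel 0 t a b = (\<integral>\<^sup>+w. indicator {w\<in>space M. J t w = b} w \<partial>P a 0)"
    unfolding tilted_kernel_def by (intro nn_integral_cong) (auto simp: indicator_def)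
  also have "\<dots> = emeasure (P a 0) {w\<in>space M. J t w = b}"
    using state_event[OF t] by simp
  finally show ?thesis by (simp add: transition_def emeasure_eq_measure)
qed

lemma kernel_zero_conservative: "0 \<le> t \<Longrightarrow> (\<Sum>b\<in>UNIV. tilted_kernel 0 t a b) = 1"
  using total_kernel_translation[where s=t and \<theta>=0 and a=a and x=0] by simp

lemma sum_transition: "0 \<le> t \<Longrightarrow> (\<Sum>b\<in>UNIV. transition a b t) = 1"
  using kernel_zero_conservative[of t a]
  by (simp add: kernel_zero sum_ennreal transition_def sum_nonneg ennreal_eq_1)

lemma transition_rate: "a \<noteq> b \<Longrightarrow> ((\<lambda>t. transition a b t / t) \<longlongrightarrow> q a b) (at_right 0)"
  using rates[of a b 0] by (simp add: transition_def)

lemma rate_nonneg: "a \<noteq> b \<Longrightarrow> 0 \<le> q a b"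
  by (rule tendsto_lowerbound[OF transition_rate])
     (auto simp: transition_def eventually_at_right_field intro!: exI[of _ 1] divide_nonneg_pos)

abbreviation exit_rate :: "'e \<Rightarrow> real" where
  "exit_rate a \<equiv> \<Sum>b\<in>UNIV - {a}. q a b"

lemma transition_exit_rate:
  "((\<lambda>t. (1 - transition a a t) / t) \<longlongrightarrow> exit_rate a) (at_right 0)"
proof -
  have "((\<lambda>t. \<Sum>b\<in>UNIV - {a}. transition a b t / t) \<longlongrightarrow> exit_rate a) (at_right 0)"
    by (intro tendsto_sum transition_rate) auto
  then show ?thesis
  proof (rule Lim_transform_eventually)
    have "(\<Sum>b\<in>UNIV - {a}. transition a b t / t) = (1 - transition a a t) / t" if "0 < t" for t
    proof -
      have "(\<Sum>b\<in>UNIV - {a}. transition a b t) = 1 - transition a a t"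
        using sum_transition[of t a] that by (simp add: sum.remove[of UNIV a])
      then show ?thesis by (simp add: sum_divide_distrib[symmetric])
    qed
    then show "\<forall>\<^sub>F t in at_right 0. (\<Sum>b\<in>UNIV - {a}. transition a b t / t) = (1 - transition a a t) / t"
      by (auto simp: eventually_at_right_field intro!: exI[of _ 1])
  qed
qed

text \<open>The rates bound the quotients near 0, and the finitely many states have a common bound.\<close>

lemma exit_probability_linear:
  obtains \<rho> where "0 \<le> \<rho>" "\<And>a t. 0 < t \<Longrightarrow> (\<Sum>b\<in>UNIV - {a}. tilted_kernel 0 t a b) \<le> ennreal (\<rho> * t)"
proof -
  have "\<exists>K. 0 \<le> K \<and> (\<forall>t>0. 1 - transition a a t \<le> K * t)" for a
    by (rule linear_bound_at_zero[OF transition_exit_rate[of a]]) (auto simp: transition_def)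
  then obtain K where K: "\<And>a. 0 \<le> K a" "\<And>a t. 0 < t \<Longrightarrow> 1 - transition a a t \<le> K a * t" by metis
  show ?thesis
  proof (rule that)
    show "0 \<le> (\<Sum>a\<in>UNIV. K a)" using K by (intro sum_nonneg) auto
    fix a and t :: real assume t: "0 < t"
    have "(\<Sum>b\<in>UNIV - {a}. tilted_kernel 0 t a b) = ennreal (\<Sum>b\<in>UNIV - {a}. transition a b t)"
      using t by (simp add: kernel_zero sum_ennreal transition_def)
    also have "(\<Sum>b\<in>UNIV - {a}. transition a b t) = 1 - transition a a t"
      using sum_transition[of t a] t by (simp add: sum.remove[of UNIV a])
    also have "\<dots> \<le> K a * t" by (rule K(2)[OF t])
    also have "\<dots> \<le> (\<Sum>a\<in>UNIV. K a) * t"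
      using t K by (intro mult_right_mono member_le_sum) auto
    finally show "(\<Sum>b\<in>UNIV - {a}. tilted_kernel 0 t a b) \<le> ennreal ((\<Sum>a\<in>UNIV. K a) * t)"
      by (simp add: ennreal_leI)
  qed
qed

definition direct :: "'e \<Rightarrow> 'e \<Rightarrow> real \<Rightarrow> real" where
  "direct a b t = measure (P a 0) (direct_passage t b)"

lemma emeasure_direct: "emeasure (P a 0) (direct_passage t b) = ennreal (direct a b t)"
proof -
  interpret prob_space "P a 0" by (rule prob_space_P)
  show ?thesis by (simp add: direct_def emeasure_eq_measure)
qed

text \<open>Direct passage differs from mere presence by an event with two jumps, which has probability
  \<open>O(t\<^sup>2)\<close>; hence both have the same rate at 0.\<close>

lemma direct_bounds:
  obtains K where "0 \<le> K" "\<And>a b t. 0 < t \<Longrightarrow> transition a b t - K * t\<^sup>2 \<le> direct a b t"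
    "\<And>a b t. 0 < t \<Longrightarrow> direct a b t \<le> transition a b t"
proof -
  obtain \<rho> where \<rho>: "0 \<le> \<rho>" "\<And>a t. 0 < t \<Longrightarrow> (\<Sum>b\<in>UNIV - {a}. tilted_kernel 0 t a b) \<le> ennreal (\<rho> * t)"
    by (rule exit_probability_linear) blast
  show ?thesis
  proof (rule that[of "\<rho>\<^sup>2"])
    fix a b and t :: real assume t: "0 < t"
    interpret prob_space "P a 0" by (rule prob_space_P)
    let ?D = "{w\<in>space M. jumps_twice t (\<lambda>s. J s w)}" and ?S = "{w\<in>space M. J t w = b}"
    have D: "?D \<in> events" and S: "?S \<in> events" and O: "direct_passage t b \<in> events"
      using J_jumps_twice_event[OF t] state_event[of t] direct_passage_sets[OF t] t by auto
    have "emeasure (P a 0) ?D \<le> ennreal (\<rho>\<^sup>2 * t\<^sup>2)"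
      using tilted_jumps_twice_le[OF kernel_zero_conservative \<rho>(2,1) t, of a 0] D by simp
    then have "prob ?D \<le> \<rho>\<^sup>2 * t\<^sup>2" by (simp add: emeasure_eq_measure)
    moreover have "prob ?S \<le> prob (direct_passage t b \<union> ?D)"
      by (rule finite_measure_mono) (use D O in \<open>auto simp: direct_passage_def\<close>)
    moreover have "prob (direct_passage t b \<union> ?D) \<le> prob (direct_passage t b) + prob ?D"
      by (rule measure_Un_le[OF O D])
    ultimately show "transition a b t - \<rho>\<^sup>2 * t\<^sup>2 \<le> direct a b t"
      by (simp add: transition_def direct_def)
    show "direct a b t \<le> transition a b t"
      unfolding transition_def direct_def by (rule finite_measure_mono) (use S in \<open>auto simp: direct_passage_def\<close>)
  qed simp
qed

lemma direct_defect: "((\<lambda>t. (transition a b t - direct a b t) / t) \<longlongrightarrow> 0) (at_right 0)"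
proof -
  obtain K where K: "\<And>a b t. 0 < t \<Longrightarrow> transition a b t - K * t\<^sup>2 \<le> direct a b t"
    "\<And>a b t. 0 < t \<Longrightarrow> direct a b t \<le> transition a b t" by (rule direct_bounds) blast
  have pos: "eventually (\<lambda>t::real. 0 < t) (at_right 0)" by (simp add: eventually_at_right_less)
  have "((\<lambda>t. K * t) \<longlongrightarrow> K * 0) (at_right 0)" by (intro tendsto_intros)
  then have upper: "((\<lambda>t. K * t) \<longlongrightarrow> 0) (at_right 0)" by simp
  show ?thesis
  proof (rule tendsto_sandwich[OF _ _ tendsto_const upper])
    show "\<forall>\<^sub>F t in at_right 0. 0 \<le> (transition a b t - direct a b t) / t"
      using pos by eventually_elim (simp add: K(2))
    show "\<forall>\<^sub>F t in at_right 0. (transition a b t - direct a b t) / t \<le> K * t"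
      using pos
    proof eventually_elim
      case (elim t)
      have "(transition a b t - direct a b t) / t \<le> K * t\<^sup>2 / t"
        using K(1)[OF elim, of a b] elim by (intro divide_right_mono) auto
      then show ?case using elim by (simp add: power2_eq_square)
    qed
  qed
qed

lemma direct_rate:
  assumes "a \<noteq> b" shows "((\<lambda>t. direct a b t / t) \<longlongrightarrow> q a b) (at_right 0)"
  using tendsto_diff[OF transition_rate[OF assms] direct_defect[of a b]]
  by (simp add: diff_divide_distrib)

lemma direct_exit_rate: "((\<lambda>t. (1 - direct a a t) / t) \<longlongrightarrow> exit_rate a) (at_right 0)"
  using tendsto_add[OF transition_exit_rate[of a] direct_defect[of a a]]
  by (simp add: add_divide_distrib[symmetric])

lemma direct_self_tendsto: "((\<lambda>t. direct a a t) \<longlongrightarrow> 1) (at_right 0)"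
proof -
  have "((\<lambda>t. 1 - t * ((1 - direct a a t) / t)) \<longlongrightarrow> 1 - 0 * exit_rate a) (at_right 0)"
    by (intro tendsto_intros direct_exit_rate)
  then have "((\<lambda>t. 1 - t * ((1 - direct a a t) / t)) \<longlongrightarrow> 1) (at_right 0)" by simp
  then show ?thesis
    by (rule Lim_transform_eventually) (auto simp: eventually_at_right_field intro!: exI[of _ 1])
qed

text \<open>Uniform in the time \<open>s\<close> at which the first Levy process is replaced by the second one.\<close>

lemma moment_product_bounds:
  fixes a b :: 'e
  assumes c: "\<And>a t. 0 \<le> t \<Longrightarrow> moment a t = ennreal (exp (c a * t))" and s: "0 \<le> s" "s \<le> t"
  defines "C \<equiv> \<bar>c a\<bar> + \<bar>c b\<bar>"
  shows "ennreal (exp (- C * t)) \<le> moment a s * moment b (t - s) \<and> moment a s * moment b (t - s) \<le> ennreal (exp (C * t))"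
proof -
  have *: "\<bar>x * y\<bar> \<le> \<bar>x\<bar> * t" if "0 \<le> y" "y \<le> t" for x y :: real
    using that by (auto simp: abs_mult intro!: mult_left_mono)
  have "\<bar>c a * s\<bar> \<le> \<bar>c a\<bar> * t" "\<bar>c b * (t - s)\<bar> \<le> \<bar>c b\<bar> * t" using s by (auto intro!: *)
  moreover have "C * t = \<bar>c a\<bar> * t + \<bar>c b\<bar> * t" "- C * t = - (\<bar>c a\<bar> * t) - \<bar>c b\<bar> * t"
    by (simp_all add: C_def algebra_simps)
  ultimately have "- C * t \<le> c a * s + c b * (t - s)" "c a * s + c b * (t - s) \<le> C * t"
    by linarith+
  then show ?thesis
    using s by (simp add: c ennreal_mult[symmetric] ennreal_leI exp_add[symmetric])
qed

text \<open>A positive rate makes the direct passage from \<open>a\<close> to \<open>b\<close> possible in a short time \<open>t\<close>, and its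
  contribution to the expectation of \<open>Y\<close> contains the factor \<open>E exp(U\<^sub>a\<^sub>b)\<close>.  When the rate is zero,
  \<open>U a b\<close> is zero by convention.\<close>

lemma jump_moment_finite:
  assumes bound: "\<And>a b t. 0 < t \<Longrightarrow> direct_mean a b t \<le> 1"
    and c: "\<And>a t. 0 \<le> t \<Longrightarrow> moment a t = ennreal (exp (c a * t))"
    and ab: "a \<noteq> b"
  shows "integrable N (\<lambda>w. exp (U a b w))"
proof (cases "q a b = 0")
  case True
  interpret N: prob_space N by (rule prob_space_N)
  have "integrable N (\<lambda>w. exp 0 :: real)" by simp
  then show ?thesis
    by (rule integrable_cong_AE_imp) (use measurable_U[OF ab] U_zero[OF ab True] in \<open>auto elim: eventually_mono\<close>)
next
  case False
  then have q: "0 < q a b" using rate_nonneg[OF ab] by simp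
  have "eventually (\<lambda>t. 0 < direct a b t / t) (at_right 0)"
    by (rule order_tendstoD(1)[OF direct_rate[OF ab] q])
  moreover have "eventually (\<lambda>t::real. 0 < t) (at_right 0)" by (simp add: eventually_at_right_less)
  ultimately have "eventually (\<lambda>t. 0 < direct a b t \<and> 0 < t) (at_right 0)"
    by eventually_elim (simp add: zero_less_divide_iff)
  then obtain t where t: "0 < direct a b t" "0 < t"
    using eventually_happens'[of "at_right (0::real)"] by auto
  define lo where "lo = exp (- (\<bar>c a\<bar> + \<bar>c b\<bar>) * t)"
  define u where "u = (\<integral>\<^sup>+w. ennreal (exp (U a b w)) \<partial>N)"
  have "ennreal lo * u * emeasure (P a 0) (direct_passage t b) \<le>
      direct_mean a b t"
    unfolding u_def
    by (rule expectation_one_jump_bounds(1)[OF t(2) ab]) (unfold lo_def, rule moment_product_bounds[OF c])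
  also have "\<dots> \<le> 1" by (rule bound[OF t(2)])
  finally have le: "ennreal lo * u * ennreal (direct a b t) \<le> 1" by (simp add: emeasure_direct)
  have "u \<noteq> top"
  proof
    assume "u = top"
    then have "ennreal lo * u * ennreal (direct a b t) = top"
      using t by (simp add: lo_def ennreal_mult_top ennreal_top_mult)
    with le show False by (simp add: top_unique)
  qed
  then show ?thesis
    using measurable_U[OF ab] unfolding u_def by (intro integrableI_nonneg) (auto simp: less_top)
qed

text \<open>The short-time expansion of \<open>1 = E\<^sub>a\<^sub>,\<^sub>0 Y\<^sub>t\<close>.  Staying in \<open>a\<close> already contributes a positive multiple of
  \<open>E exp(L\<^sub>a(t))\<close>, which makes the exponential moments finite and hence exponential in \<open>t\<close>.  So staying in \<open>a\<close> has
  probability \<open>1 - O(t)\<close> under the tilted law, too, and two jumps contribute \<open>O(t\<^sup>2)\<close>.\<close>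

theorem unit_mean_balance:
  assumes unit: "\<And>a t. 0 \<le> t \<Longrightarrow> (\<Sum>b\<in>UNIV. tilted_kernel 1 t a b) = 1"
  obtains c where "\<And>a t. 0 \<le> t \<Longrightarrow> moment a t = ennreal (exp (c a * t))"
    "\<And>a b. a \<noteq> b \<Longrightarrow> integrable N (\<lambda>w. exp (U a b w))"
    "\<And>a. c a + (\<Sum>b\<in>UNIV - {a}. q a b * ((\<integral>w. exp (U a b w) \<partial>N) - 1)) = 0"
proof -
  have total: "(\<integral>\<^sup>+w. ennreal (exp (\<xi> t w)) \<partial>P a 0) = 1" if "0 \<le> t" for a t
    using total_kernel_translation[where s=t and \<theta>=1 and a=a and x=0] unit[OF that, of a] that by simp
  have A_le: "direct_mean a b t \<le> 1" if t: "0 < t" for a b t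
  proof -
    have "direct_mean a b t \<le> (\<integral>\<^sup>+w. ennreal (exp (\<xi> t w)) \<partial>P a 0)"
      by (intro nn_integral_mono) (auto simp: indicator_def)
    then show ?thesis using total[of t a] t by simp
  qed
  have A_self: "direct_mean a a t = moment a t * ennreal (direct a a t)" if t: "0 < t" for a t
    by (simp add: expectation_no_jump[OF t] emeasure_direct)
  have "\<exists>c. \<forall>t\<ge>0. moment a t = ennreal (exp (c * t))" for a
  proof -
    interpret levy: levy_process N "L a" by (rule levy_L)
    have "eventually (\<lambda>t. 1/2 < direct a a t) (at_right 0)"
      by (rule order_tendstoD(1)[OF direct_self_tendsto]) simp
    then obtain d where d: "0 < d" "\<And>t. 0 < t \<Longrightarrow> t < d \<Longrightarrow> 1/2 < direct a a t"
      by (auto simp: eventually_at_right_field)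
    have "moment a t \<le> ennreal 2" if t: "0 \<le> t" "t \<le> d / 2" for t
    proof (cases "t = 0")
      case True
      have "moment a 0 = (\<integral>\<^sup>+w. 1 \<partial>N)"
        unfolding moment_altdef
        by (rule nn_integral_cong_AE) (use levy.levy_zero in \<open>auto elim: eventually_mono\<close>)
      then show ?thesis using True levy.emeasure_space_1 by simp
    next
      case False
      then have t: "0 < t" "t < d" using t d by auto
      have "moment a t * ennreal (1/2) \<le> moment a t * ennreal (direct a a t)"
        using d(2)[OF t] by (intro mult_left_mono ennreal_leI) auto
      also have "\<dots> \<le> 1" using A_le[OF t(1), of a a] A_self[OF t(1), of a] by simp
      finally have "moment a t * ennreal (1/2) * ennreal 2 \<le> 1 * ennreal 2" by (intro mult_right_mono) auto
      moreover have "ennreal (1/2) * ennreal 2 = 1" by (subst ennreal_mult[symmetric]) auto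
      ultimately show ?thesis by (simp only: mult.assoc mult_1 mult_1_right)
    qed
    then show ?thesis
      using levy.moment_exponential[of "d / 2" 2] d(1) unfolding moment_def by (metis half_gt_zero)
  qed
  then obtain c where c: "\<And>a t. 0 \<le> t \<Longrightarrow> moment a t = ennreal (exp (c a * t))" by metis
  have int: "integrable N (\<lambda>w. exp (U a b w))" if "a \<noteq> b" for a b
    by (rule jump_moment_finite[OF A_le c that])
  define u where "u a b = (\<integral>w. exp (U a b w) \<partial>N)" for a b
  have u: "(\<integral>\<^sup>+w. ennreal (exp (U a b w)) \<partial>N) = ennreal (u a b)" if "a \<noteq> b" for a b
    unfolding u_def by (rule nn_integral_eq_integral[OF int[OF that]]) simp
  have u0: "0 \<le> u a b" for a b unfolding u_def by (intro integral_nonneg_AE) auto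
  define r where "r a b t = enn2real (direct_mean a b t)" for a b t
  have r: "direct_mean a b t = ennreal (r a b t)" if "0 < t" for a b t
    unfolding r_def using A_le[OF that, of a b] by (metis ennreal_enn2real ennreal_one_less_top order_le_less_trans)
  have r_self: "r a a t = exp (c a * t) * direct a a t" if "0 < t" for a t
    using that by (simp add: r_def A_self c enn2real_mult direct_def)
  \<comment> \<open>One jump: the Levy factors lie between \<open>exp (- C * t)\<close> and \<open>exp (C * t)\<close>, so they disappear in the limit.\<close>
  have r_rate: "((\<lambda>t. r a b t / t) \<longlongrightarrow> q a b * u a b) (at_right 0)" if ab: "a \<noteq> b" for a b
  proof -
    define C where "C = \<bar>c a\<bar> + \<bar>c b\<bar>"
    have bounds: "exp (- C * t) * u a b * direct a b t \<le> r a b t \<and> r a b t \<le> exp (C * t) * u a b * direct a b t" if t: "0 < t" for t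
    proof -
      have m: "ennreal (exp (- C * t)) \<le> moment a s * moment b (t - s) \<and> moment a s * moment b (t - s) \<le> ennreal (exp (C * t))"
        if "0 \<le> s" "s \<le> t" for s
        unfolding C_def by (rule moment_product_bounds[OF c that])
      note e = expectation_one_jump_bounds[OF t ab m, unfolded r[OF t] u[OF ab] emeasure_direct]
      have nn: "0 \<le> exp (C * t) * u a b * direct a b t" "0 \<le> r a b t"
        using u0 by (auto simp: direct_def r_def)
      show ?thesis
        using e nn u0[of a b] by (simp add: ennreal_mult[symmetric] direct_def)
    qed
    have lim: "((\<lambda>t. exp (k * t) * u a b * (direct a b t / t)) \<longlongrightarrow> exp (k * 0) * u a b * q a b) (at_right 0)" for k
      by (intro tendsto_intros direct_rate[OF ab])
    have pos: "eventually (\<lambda>t::real. 0 < t) (at_right 0)" by (simp add: eventually_at_right_less)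
    show ?thesis
    proof (rule tendsto_sandwich)
      show "\<forall>\<^sub>F t in at_right 0. exp (- C * t) * u a b * (direct a b t / t) \<le> r a b t / t"
        using pos by eventually_elim (use bounds in \<open>auto simp: divide_right_mono\<close>)
      show "\<forall>\<^sub>F t in at_right 0. r a b t / t \<le> exp (C * t) * u a b * (direct a b t / t)"
        using pos by eventually_elim (use bounds in \<open>auto simp: divide_right_mono\<close>)
    qed (use lim[of "- C"] lim[of C] in \<open>simp_all add: mult.commute\<close>)
  qed
  have self_rate: "((\<lambda>t. (1 - r a a t) / t) \<longlongrightarrow> exit_rate a - c a) (at_right 0)" for a
  proof -
    have "((\<lambda>t. exp (c a * t)) has_real_derivative c a) (at 0 within {0<..})"
      by (auto intro!: derivative_eq_intros)
    then have ex: "((\<lambda>t. (exp (c a * t) - 1) / t) \<longlongrightarrow> c a) (at_right 0)"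
      by (simp add: has_field_derivative_iff)
    have "((\<lambda>t. (1 - direct a a t) / t - direct a a t * ((exp (c a * t) - 1) / t)) \<longlongrightarrow>
        exit_rate a - 1 * c a) (at_right 0)"
      by (intro tendsto_intros direct_exit_rate direct_self_tendsto ex)
    then have "((\<lambda>t. (1 - direct a a t) / t - direct a a t * ((exp (c a * t) - 1) / t)) \<longlongrightarrow>
        exit_rate a - c a) (at_right 0)" by simp
    then show ?thesis
      by (rule Lim_transform_eventually)
         (auto simp: eventually_at_right_field r_self field_simps intro!: exI[of _ 1])
  qed
  have leave: "\<exists>K. 0 \<le> K \<and> (\<forall>t>0. 1 - r a a t \<le> K * t)" for a
    by (rule linear_bound_at_zero[OF self_rate[of a]]) (auto simp: r_def)
  then obtain K where K: "\<And>a. 0 \<le> K a" "\<And>a t. 0 < t \<Longrightarrow> 1 - r a a t \<le> K a * t" by metis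
  define \<rho> where "\<rho> = (\<Sum>a\<in>UNIV. K a)"
  have \<rho>: "0 \<le> \<rho>" unfolding \<rho>_def using K by (intro sum_nonneg) auto
  \<comment> \<open>Under the tilted law, leaving \<open>a\<close> is at most as likely as not staying there all the time.\<close>
  have leave1: "(\<Sum>b\<in>UNIV - {a}. tilted_kernel 1 t a b) \<le> ennreal (\<rho> * t)" if t: "0 < t" for a t
  proof -
    have "direct_mean a a t \<le> tilted_kernel 1 t a a"
      unfolding tilted_kernel_def by (intro nn_integral_mono) (auto simp: indicator_def direct_passage_def)
    moreover have k1: "tilted_kernel 1 t a a + (\<Sum>b\<in>UNIV - {a}. tilted_kernel 1 t a b) = 1"
      using unit[of t a] t by (simp add: sum.remove[of UNIV a])
    ultimately have "ennreal (r a a t) + (\<Sum>b\<in>UNIV - {a}. tilted_kernel 1 t a b) \<le> 1"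
      by (metis add_right_mono r[OF t])
    moreover have "(\<Sum>b\<in>UNIV - {a}. tilted_kernel 1 t a b) \<noteq> top"
      using k1 by (metis ennreal_add_eq_top ennreal_one_neq_top)
    then obtain y where y: "(\<Sum>b\<in>UNIV - {a}. tilted_kernel 1 t a b) = ennreal y" "0 \<le> y"
      by (cases "\<Sum>b\<in>UNIV - {a}. tilted_kernel 1 t a b") auto
    ultimately have "r a a t + y \<le> 1"
      by (simp add: r_def ennreal_plus[symmetric] del: ennreal_plus)
    then have "y \<le> K a * t" using K(2)[OF t, of a] by simp
    also have "\<dots> \<le> \<rho> * t"
      unfolding \<rho>_def using t K by (intro mult_right_mono member_le_sum) auto
    finally show ?thesis using y by (simp add: ennreal_leI)
  qed
  have balance: "c a + (\<Sum>b\<in>UNIV - {a}. q a b * (u a b - 1)) = 0" for a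
  proof -
    \<comment> \<open>\<open>R t\<close> is the contribution of two or more jumps, divided by \<open>t\<close>.\<close>
    define R where "R t = (1 - r a a t) / t - (\<Sum>b\<in>UNIV - {a}. r a b t / t)" for t
    have R: "0 \<le> R t \<and> R t \<le> \<rho>\<^sup>2 * t" if t: "0 < t" for t
    proof -
      let ?D = "{w\<in>space M. jumps_twice t (\<lambda>s. J s w)}"
      define D where "D = (\<integral>\<^sup>+w. ennreal (exp (\<xi> t w)) * indicator ?D w \<partial>P a 0)"
      have [measurable]: "\<xi> t \<in> borel_measurable (P a 0)" using t by (intro xi_measurable) auto
      have [measurable]: "?D \<in> sets (P a 0)" "direct_passage t b \<in> sets (P a 0)" for b
        using J_jumps_twice_event[OF t] direct_passage_sets[OF t] by auto
      have "1 = (\<integral>\<^sup>+w. (\<Sum>b\<in>UNIV. ennreal (exp (\<xi> t w)) * indicator (direct_passage t b) w)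
          + ennreal (exp (\<xi> t w)) * indicator ?D w \<partial>P a 0)"
      proof -
        have pointwise: "ennreal (exp (\<xi> t w)) = (\<Sum>b\<in>UNIV. ennreal (exp (\<xi> t w)) * indicator (direct_passage t b) w)
          + ennreal (exp (\<xi> t w)) * indicator ?D w" if "w \<in> space M" for w
        proof -
          have "(\<Sum>b\<in>UNIV. indicator (direct_passage t b) w) =
              (\<Sum>b\<in>UNIV. if b = J t w then indicator (- ?D) w else 0 :: ennreal)"
            using that by (intro sum.cong) (auto simp: direct_passage_def indicator_def)
          then show ?thesis
            by (simp add: sum_distrib_left[symmetric] distrib_left[symmetric] indicator_def)
        qed
        have "(\<integral>\<^sup>+w. ennreal (exp (\<xi> t w)) \<partial>P a 0) =
            (\<integral>\<^sup>+w. (\<Sum>b\<in>UNIV. ennreal (exp (\<xi> t w)) * indicator (direct_passage t b) w)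
              + ennreal (exp (\<xi> t w)) * indicator ?D w \<partial>P a 0)"
          by (rule nn_integral_cong) (rule pointwise, simp)
        then show ?thesis using total[of t a] t by simp
      qed
      also have "\<dots> = (\<Sum>b\<in>UNIV. direct_mean a b t) + D"
      proof -
        have "(\<integral>\<^sup>+w. (\<Sum>b\<in>UNIV. ennreal (exp (\<xi> t w)) * indicator (direct_passage t b) w) \<partial>P a 0) = (\<Sum>b\<in>UNIV. direct_mean a b t)"
          by (rule nn_integral_sum) measurable
        moreover have "(\<integral>\<^sup>+w. (\<Sum>b\<in>UNIV. ennreal (exp (\<xi> t w)) * indicator (direct_passage t b) w)
            + ennreal (exp (\<xi> t w)) * indicator ?D w \<partial>P a 0) =
            (\<integral>\<^sup>+w. (\<Sum>b\<in>UNIV. ennreal (exp (\<xi> t w)) * indicator (direct_passage t b) w) \<partial>P a 0) + D"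
          unfolding D_def by (rule nn_integral_add) measurable
        ultimately show ?thesis by (simp only:)
      qed
      finally have one: "(\<Sum>b\<in>UNIV. direct_mean a b t) + D = 1" by simp
      have "D \<le> ennreal (\<rho>\<^sup>2 * exp (1 * 0) * t\<^sup>2)"
        using tilted_jumps_twice_le[OF unit leave1 \<rho> t, of a 0] by (simp add: D_def)
      then have Dle: "D \<le> ennreal (\<rho>\<^sup>2 * t\<^sup>2)" by simp
      then obtain d where d: "D = ennreal d" "0 \<le> d"
        by (cases D) (auto simp: top_unique)
      have "d \<le> \<rho>\<^sup>2 * t\<^sup>2" using Dle d by (simp add: ennreal_le_iff)
      have r0: "0 \<le> r a b t" for b by (simp add: r_def)
      have "ennreal ((\<Sum>b\<in>UNIV. r a b t) + d) = 1"
        using one d r0 by (simp add: r[OF t] sum_ennreal sum_nonneg)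
      then have "(\<Sum>b\<in>UNIV. r a b t) + d = 1" by (simp add: ennreal_eq_1)
      then have "1 - r a a t - (\<Sum>b\<in>UNIV - {a}. r a b t) = d" by (simp add: sum.remove[of UNIV a])
      then have "R t = d / t"
        by (simp add: R_def sum_divide_distrib[symmetric] diff_divide_distrib[symmetric])
      moreover have "d / t \<le> \<rho>\<^sup>2 * t\<^sup>2 / t"
        using \<open>d \<le> \<rho>\<^sup>2 * t\<^sup>2\<close> t by (intro divide_right_mono) auto
      moreover have "\<rho>\<^sup>2 * t\<^sup>2 / t = \<rho>\<^sup>2 * t" using t by (simp add: power2_eq_square)
      ultimately show ?thesis using d t by simp
    qed
    have "(R \<longlongrightarrow> (exit_rate a - c a) - (\<Sum>b\<in>UNIV - {a}. q a b * u a b)) (at_right 0)"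
      unfolding R_def[abs_def] by (intro tendsto_diff self_rate tendsto_sum r_rate) auto
    moreover have "(R \<longlongrightarrow> 0) (at_right 0)"
    proof (rule tendsto_sandwich[OF _ _ tendsto_const])
      have "((\<lambda>t. \<rho>\<^sup>2 * t) \<longlongrightarrow> \<rho>\<^sup>2 * 0) (at_right 0)" by (intro tendsto_intros)
      then show "((\<lambda>t. \<rho>\<^sup>2 * t) \<longlongrightarrow> 0) (at_right 0)" by simp
    qed (use R in \<open>auto simp: eventually_at_right_field intro!: exI[of _ 1]\<close>)
    ultimately have "(exit_rate a - c a) - (\<Sum>b\<in>UNIV - {a}. q a b * u a b) = 0"
      by (intro tendsto_unique[OF trivial_limit_at_right_real])
    then show ?thesis by (simp add: right_diff_distrib sum_subtractf)
  qed
  show ?thesis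
    by (rule that[OF c int]) (use balance in \<open>auto simp: u_def\<close>)
qed

end

section \<open>Unit mean and the extended generator\<close>

lemma nonneg_set_nn_integral:
  assumes X: "integrable M X" "\<And>w. 0 \<le> X w" and A: "A \<in> sets M"
  shows "(\<integral>\<^sup>+w. indicator A w * ennreal (X w) \<partial>M) = ennreal (LINT w:A|M. X w)"
proof -
  have "(\<integral>\<^sup>+w. ennreal (indicator A w *\<^sub>R X w) \<partial>M) = ennreal (LINT w:A|M. X w)"
    unfolding set_lebesgue_integral_def
    by (rule nn_integral_eq_integral[OF integrable_mult_indicator[OF A X(1)]]) (simp add: X)
  moreover have "(\<integral>\<^sup>+w. ennreal (indicator A w *\<^sub>R X w) \<partial>M) = (\<integral>\<^sup>+w. indicator A w * ennreal (X w) \<partial>M)"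
    by (intro nn_integral_cong) (auto simp: indicator_def)
  ultimately show ?thesis by simp
qed

lemma (in prob_space) nonneg_martingaleI:
  assumes sub: "\<And>t. 0 \<le> t \<Longrightarrow> subalgebra M (F t)"
    and meas: "\<And>t. 0 \<le> t \<Longrightarrow> X t \<in> borel_measurable (F t)"
    and nonneg: "\<And>t w. 0 \<le> X t w"
    and fin: "\<And>t. 0 \<le> t \<Longrightarrow> (\<integral>\<^sup>+w. ennreal (X t w) \<partial>M) < top"
    and eq: "\<And>s t A. 0 \<le> s \<Longrightarrow> s \<le> t \<Longrightarrow> A \<in> sets (F s) \<Longrightarrow>
      (\<integral>\<^sup>+w. indicator A w * ennreal (X t w) \<partial>M) = (\<integral>\<^sup>+w. indicator A w * ennreal (X s w) \<partial>M)"
  shows "martingale M F X"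
proof (rule martingaleI[OF sub meas])
  show int: "integrable M (X t)" if "0 \<le> t" for t
    using measurable_from_subalg[OF sub meas, OF that that] fin[OF that] nonneg by (intro integrableI_nonneg) auto
  fix s t A assume st: "0 \<le> s" "s \<le> t" and A: "A \<in> sets (F s)"
  have AM: "A \<in> sets M" using A sub[OF st(1)] by (auto simp: subalgebra_def)
  have "0 \<le> (LINT w:A|M. X u w)" for u
    unfolding set_lebesgue_integral_def by (intro integral_nonneg_AE) (simp add: nonneg)
  then show "(LINT w:A|M. X t w) = (LINT w:A|M. X s w)"
    using eq[OF st A] nonneg_set_nn_integral[OF int nonneg AM] st by simp
qed auto

lemma (in prob_space) nonneg_martingaleD:
  assumes m: "martingale M F X" and nonneg: "\<And>t w. 0 \<le> X t w"
    and st: "0 \<le> s" "s \<le> t" and A: "A \<in> sets (F s)"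
  shows "(\<integral>\<^sup>+w. indicator A w * ennreal (X t w) \<partial>M) = (\<integral>\<^sup>+w. indicator A w * ennreal (X s w) \<partial>M)"
    and "(\<integral>\<^sup>+w. indicator A w * ennreal (X s w) \<partial>M) < top"
proof -
  have int: "integrable M (X u)" if "0 \<le> u" for u using m that by (auto simp: martingale_def)
  have "subalgebra M (F s)" using m st by (auto simp: martingale_def)
  then have AM: "A \<in> sets M" using A by (auto simp: subalgebra_def)
  note L = nonneg_set_nn_integral[OF int nonneg AM]
  show "(\<integral>\<^sup>+w. indicator A w * ennreal (X t w) \<partial>M) = (\<integral>\<^sup>+w. indicator A w * ennreal (X s w) \<partial>M)"
    using martingaleD[OF m st A] L[of s] L[of t] st by simp
  show "(\<integral>\<^sup>+w. indicator A w * ennreal (X s w) \<partial>M) < top"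
    using L[OF st(1)] by simp
qed

context markov_additive_process
begin

lemma sets_initial_law [simp]: "sets (initial_law P \<mu> x) = sets M"
  unfolding initial_law_def by (rule sets_bind) (auto simp: sets_P)

lemma space_initial_law [simp]: "space (initial_law P \<mu> x) = space M"
  by (rule sets_eq_imp_space_eq) simp

lemma measurable_M_P: "f \<in> borel_measurable M \<Longrightarrow> f \<in> borel_measurable (P a x)"
  using measurable_cong_sets[OF sets_P refl] by blast

lemma nn_integral_initial_law:
  assumes f: "f \<in> borel_measurable M"
  shows "(\<integral>\<^sup>+w. f w \<partial>initial_law P \<mu> x) = (\<Sum>a\<in>UNIV. ennreal (pmf \<mu> a) * (\<integral>\<^sup>+w. f w \<partial>P a x))"
proof -
  have "(\<lambda>a. P a x) \<in> measurable (measure_pmf \<mu>) (subprob_algebra M)"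
    by (auto simp: space_subprob_algebra sets_P intro: prob_space_imp_subprob_space prob_space_P)
  then have "(\<integral>\<^sup>+w. f w \<partial>initial_law P \<mu> x) = (\<integral>\<^sup>+a. \<integral>\<^sup>+w. f w \<partial>P a x \<partial>measure_pmf \<mu>)"
    unfolding initial_law_def by (rule nn_integral_bind[OF f])
  also have "\<dots> = (\<Sum>a\<in>UNIV. ennreal (pmf \<mu> a) * (\<integral>\<^sup>+w. f w \<partial>P a x))"
    by (simp add: nn_integral_measure_pmf nn_integral_count_space_finite)
  finally show ?thesis .
qed

lemma prob_space_initial_law: "prob_space (initial_law P \<mu> x)"
proof
  have "emeasure (initial_law P \<mu> x) (space M) = (\<integral>\<^sup>+w. indicator (space M) w \<partial>initial_law P \<mu> x)"
    by simp
  also have "\<dots> = (\<Sum>a\<in>UNIV. ennreal (pmf \<mu> a) * (\<integral>\<^sup>+w. indicator (space M) w \<partial>P a x))"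
    by (rule nn_integral_initial_law) simp
  also have "\<dots> = (\<Sum>a\<in>UNIV. ennreal (pmf \<mu> a))"
    by (intro sum.cong refl) (simp add: sets_P)
  also have "\<dots> = 1"
    using sum_pmf_eq_1[of UNIV \<mu>] by (simp add: sum_ennreal)
  finally show "emeasure (initial_law P \<mu> x) (space (initial_law P \<mu> x)) = 1" by simp
qed

lemma subalgebra_initial_law: "subalgebra (initial_law P \<mu> x) (F t)"
  using subalgebra_F[of t] by (simp add: subalgebra_def)

lemma exp_xi_adapted: "0 \<le> t \<Longrightarrow> (\<lambda>w. exp (\<xi> t w)) \<in> borel_measurable (F t)"
  by (intro measurable_compose[OF xi_adapted borel_measurable_exp])

lemma exp_xi_0_adapted: "0 \<le> t \<Longrightarrow> (\<lambda>w. exp (\<xi> 0 w)) \<in> borel_measurable (F t)"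
  by (rule measurable_F_mono[OF _ exp_xi_adapted]) simp_all

lemma exp_xi_0_integrable: "integrable (P a x) (\<lambda>w. exp (\<xi> 0 w))"
proof -
  interpret prob_space "P a x" by (rule prob_space_P)
  have "(\<lambda>w. exp (\<xi> 0 w)) \<in> borel_measurable (P a x)"
    by (rule measurable_F_P[OF exp_xi_adapted]) simp
  then show ?thesis
    by (rule integrable_cong_AE_imp[of _ "\<lambda>_. exp x", rotated]) (use start[of a x] in \<open>auto elim: eventually_mono\<close>)
qed

lemma weighted_exp_measurable:
  assumes "0 \<le> t" "A \<in> sets (F s)"
  shows "(\<lambda>w. indicator A w * ennreal (exp (\<xi> t w))) \<in> borel_measurable M"
proof -
  have "A \<in> sets M" using assms(2) subalgebra_F[of s] by (auto simp: subalgebra_def)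
  moreover have "(\<lambda>w. exp (\<xi> t w)) \<in> borel_measurable M"
    by (rule measurable_from_subalg[OF subalgebra_F exp_xi_adapted[OF assms(1)]])
  ultimately show ?thesis by measurable
qed

lemma unit_mean_martingale:
  assumes unit: "\<And>a t. 0 \<le> t \<Longrightarrow> (\<Sum>b\<in>UNIV. tilted_kernel 1 t a b) = 1"
  shows "martingale (P a x) F (\<lambda>t w. exp (\<xi> t w))"
proof -
  interpret prob_space "P a x" by (rule prob_space_P)
  show ?thesis
  proof (rule nonneg_martingaleI[OF subalgebra_P exp_xi_adapted])
    show "(\<integral>\<^sup>+w. ennreal (exp (\<xi> t w)) \<partial>P a x) < top" if "0 \<le> t" for t
      using total_kernel_translation[where s=t and \<theta>=1 and a=a and x=x] unit[OF that, of a] that by simp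
    fix s t A assume st: "0 \<le> s" "s \<le> t" and A: "A \<in> sets (F s)"
    have V: "(\<lambda>w. indicator A w :: ennreal) \<in> borel_measurable (F s)" using A by simp
    have "(\<Sum>c\<in>UNIV. tilted_kernel 1 (t - s) b c) = 1" for b using st by (intro unit) simp
    from conservative_kernel_martingale[OF this V, where a=a and x=x] st
    show "(\<integral>\<^sup>+w. indicator A w * ennreal (exp (\<xi> t w)) \<partial>P a x) = (\<integral>\<^sup>+w. indicator A w * ennreal (exp (\<xi> s w)) \<partial>P a x)"
      by simp
  qed auto
qed

text \<open>Both sides of the martingale identity are affine in the initial law.\<close>

lemma mixture_martingale:
  assumes m: "\<And>a. martingale (P a x) F (\<lambda>t w. exp (\<xi> t w))"
  shows "martingale (initial_law P \<mu> x) F (\<lambda>t w. exp (\<xi> t w))"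
proof -
  let ?I = "\<lambda>A u Q. \<integral>\<^sup>+w. indicator A w * ennreal (exp (\<xi> u w)) \<partial>Q"
  interpret prob_space "initial_law P \<mu> x" by (rule prob_space_initial_law)
  have law: "?I A u (initial_law P \<mu> x) =
      (\<Sum>a\<in>UNIV. ennreal (pmf \<mu> a) * ?I A u (P a x))"
    if "A \<in> sets (F s)" "0 \<le> u" for A s u
    by (rule nn_integral_initial_law[OF weighted_exp_measurable[OF that(2,1)]])
  show ?thesis
  proof (rule nonneg_martingaleI[OF subalgebra_initial_law exp_xi_adapted])
    show "(\<integral>\<^sup>+w. ennreal (exp (\<xi> t w)) \<partial>initial_law P \<mu> x) < top" if t: "0 \<le> t" for t
    proof -
      have one: "(\<integral>\<^sup>+w. indicator (space M) w * ennreal (exp (\<xi> t w)) \<partial>Q) = (\<integral>\<^sup>+w. ennreal (exp (\<xi> t w)) \<partial>Q)"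
        if "space Q = space M" for Q :: "'w measure"
        using that by (intro nn_integral_cong) auto
      have "space M \<in> sets (F t)" using sets.top[of "F t"] by simp
      then have "(\<integral>\<^sup>+w. indicator (space M) w * ennreal (exp (\<xi> t w)) \<partial>P a x) < top" for a
        using prob_space.nonneg_martingaleD(2)[OF prob_space_P m, of t t] t by simp
      then show ?thesis
        using law[OF \<open>space M \<in> sets (F t)\<close> t] by (simp add: one ennreal_mult_less_top)
    qed
    fix s t A assume st: "0 \<le> s" "s \<le> t" and A: "A \<in> sets (F s)"
    have "?I A t (P a x) = ?I A s (P a x)" for a
      by (rule prob_space.nonneg_martingaleD(1)[OF prob_space_P m _ st A]) simp
    then show "?I A t (initial_law P \<mu> x) =
        ?I A s (initial_law P \<mu> x)"
      using law[OF A, of t] law[OF A, of s] st by simp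
  qed auto
qed

end

context markov_additive_characteristics
begin

lemma transition_any_level: "0 \<le> t \<Longrightarrow> emeasure (P a x) {w\<in>space M. J t w = b} = ennreal (transition a b t)"
proof -
  assume t: "0 \<le> t"
  have "emeasure (P a x) {w\<in>space M. J t w = b} = (\<integral>\<^sup>+w. indicator {w\<in>space M. J t w = b} w \<partial>P a x)"
    using state_event[OF t] by simp
  also have "\<dots> = (\<integral>\<^sup>+w. ennreal (exp (0 * \<xi> t w)) * indicator {b} (J t w) \<partial>P a x)"
    by (intro nn_integral_cong) (auto simp: indicator_def)
  also have "\<dots> = tilted_kernel 0 t a b"
    using kernel_translation[OF t, where \<theta>=0 and c=b and a=a and x=x] by simp
  finally show ?thesis using kernel_zero[OF t] by simp
qed

text \<open>A lower bound from the Chapman-Kolmogorov equations: pass through \<open>b\<close> at time \<open>t\<close>.\<close>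

lemma transition_chain:
  assumes s: "0 \<le> s" and t: "0 \<le> t"
  shows "transition a b t * transition b c s \<le> transition a c (t + s)"
proof -
  let ?S = "{w\<in>space M. J t w = b}"
  have V: "(\<lambda>w. indicator {b} (J t w) :: ennreal) \<in> borel_measurable (F t)"
    by (rule measurable_compose[OF J_adapted[OF t]]) simp
  have "ennreal (transition a b t) * tilted_kernel 0 s b c = (\<integral>\<^sup>+w. indicator ?S w * tilted_kernel 0 s b c \<partial>P a 0)"
    using state_event[OF t] transition_any_level[OF t, of a 0 b] by (simp add: nn_integral_multc)
  also have "\<dots> = (\<integral>\<^sup>+w. indicator {b} (J t w) * ennreal (exp (0 * \<xi> t w)) * tilted_kernel 0 s (J t w) c \<partial>P a 0)"
    by (intro nn_integral_cong) (auto simp: indicator_def)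
  also have "\<dots> = (\<integral>\<^sup>+w. indicator {b} (J t w) * (ennreal (exp (0 * \<xi> (t + s) w)) * indicator {c} (J (t + s) w)) \<partial>P a 0)"
    by (rule tilted_markov_property[OF V s t, symmetric])
  also have "\<dots> \<le> tilted_kernel 0 (t + s) a c"
    unfolding tilted_kernel_def by (intro nn_integral_mono) (auto simp: indicator_def)
  finally show ?thesis
    using s t by (simp add: kernel_zero ennreal_mult[symmetric] transition_def)
qed

text \<open>Every single step of a path with positive rates has positive probability in a short time; chain
  these steps.\<close>

lemma irreducible_reaches:
  assumes "irreducible_rates q"
  obtains t where "0 < t" "0 < transition a b t"
proof -
  have "(a, b) \<in> {(c, d). c \<noteq> d \<and> q c d > 0}\<^sup>*" using assms by (simp add: irreducible_rates_def)
  then have "\<exists>t>0. 0 < transition a b t"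
  proof (induction rule: rtrancl_induct)
    case base
    obtain K where K: "\<And>a b t. 0 < t \<Longrightarrow> direct a b t \<le> transition a b t" by (rule direct_bounds) blast
    have "eventually (\<lambda>t. 0 < direct a a t) (at_right 0)"
      by (rule order_tendstoD(1)[OF direct_self_tendsto]) simp
    moreover have "eventually (\<lambda>t::real. 0 < t) (at_right 0)" by (simp add: eventually_at_right_less)
    ultimately have "eventually (\<lambda>t. 0 < t \<and> 0 < transition a a t) (at_right 0)"
      by eventually_elim (use K in \<open>auto intro: less_le_trans\<close>)
    then show ?case using eventually_happens'[of "at_right (0::real)"] by auto
  next
    case (step c d)
    then obtain t where t: "0 < t" "0 < transition a c t" by auto
    have cd: "c \<noteq> d" "0 < q c d" using step by auto
    have "eventually (\<lambda>s. 0 < transition c d s / s) (at_right 0)"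
      by (rule order_tendstoD(1)[OF transition_rate[OF cd(1)] cd(2)])
    moreover have "eventually (\<lambda>t::real. 0 < t) (at_right 0)" by (simp add: eventually_at_right_less)
    ultimately have "eventually (\<lambda>s. 0 < s \<and> 0 < transition c d s) (at_right 0)"
      by eventually_elim (simp add: zero_less_divide_iff)
    then obtain s where s: "0 < s" "0 < transition c d s"
      using eventually_happens'[of "at_right (0::real)"] by auto
    have "0 < transition a c t * transition c d s" using t s by simp
    also have "\<dots> \<le> transition a d (t + s)" using t s by (intro transition_chain) auto
    finally show ?case using t s by (intro exI[of _ "t + s"]) auto
  qed
  then show ?thesis using that by auto
qed

text \<open>Test the martingale property between \<open>t\<close> and \<open>t + s\<close> on the event that \<open>J\<close> is in \<open>b\<close> at time \<open>t\<close>.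
  By the Markov property the later expectation is the earlier one multiplied by the mean
  \<open>?H\<close> of \<open>Y\<close> at time \<open>s\<close> when started in \<open>b\<close>, and the earlier one is positive and finite.\<close>

lemma martingale_unit_mean:
  assumes m: "martingale (initial_law P \<mu> x) F (\<lambda>t w. exp (\<xi> t w))"
    and irr: "irreducible_rates q" and s: "0 \<le> s"
  shows "(\<Sum>c\<in>UNIV. tilted_kernel 1 s b c) = 1"
proof -
  obtain a where a: "a \<in> set_pmf \<mu>" using set_pmf_not_empty[of \<mu>] by auto
  obtain t where t: "0 < t" "0 < transition a b t" using irreducible_reaches[OF irr] by blast
  have t0: "0 \<le> t" using t by simp
  let ?A = "{w\<in>space M. J t w = b}"
  let ?I = "\<lambda>u Q. \<integral>\<^sup>+w. indicator ?A w * ennreal (exp (\<xi> u w)) \<partial>Q" and ?H = "\<Sum>c\<in>UNIV. tilted_kernel 1 s b c"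
  have A: "?A \<in> sets (F t)"
  proof -
    have "?A = J t -` {b} \<inter> space (F t)" by auto
    then show ?thesis using measurable_sets[OF J_adapted[OF t0], of "{b}"] by simp
  qed
  define m where "m = ?I t (initial_law P \<mu> x)"
  have law: "?I u (initial_law P \<mu> x) =
      (\<Sum>a\<in>UNIV. ennreal (pmf \<mu> a) * ?I u (P a x))" if "0 \<le> u" for u
    by (rule nn_integral_initial_law[OF weighted_exp_measurable[OF that A]])
  have mart: "?I (t + s) (initial_law P \<mu> x) = m" and m_fin: "m < top"
    unfolding m_def
    using prob_space.nonneg_martingaleD[OF prob_space_initial_law assms(1) _ t0 _ A, of "t + s"] s by auto
  have V: "(\<lambda>w. indicator ?A w :: ennreal) \<in> borel_measurable (F t)" using A by simp
  have "?I (t + s) (P a x) =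
      ?I t (P a x) * ?H" for a
  proof -
    have [measurable]: "(\<lambda>w. indicator ?A w * ennreal (exp (\<xi> t w))) \<in> borel_measurable (P a x)"
      by (rule measurable_M_P[OF weighted_exp_measurable[OF t0 A]])
    have "?I (t + s) (P a x) =
        (\<integral>\<^sup>+w. indicator ?A w * ennreal (exp (\<xi> t w)) * (\<Sum>c\<in>UNIV. tilted_kernel 1 s (J t w) c) \<partial>P a x)"
      using tilted_markov_property_total[OF V s t0, where \<theta>=1 and a=a and x=x] by simp
    also have "\<dots> = (\<integral>\<^sup>+w. indicator ?A w * ennreal (exp (\<xi> t w)) * ?H \<partial>P a x)"
      by (intro nn_integral_cong) (auto simp: indicator_def)
    also have "\<dots> = ?I t (P a x) * ?H"
      by (rule nn_integral_multc) measurable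
    finally show ?thesis .
  qed
  then have "m = m * ?H"
    using mart law[of "t + s"] law[OF t0] s t0 by (simp add: m_def sum_distrib_right mult.assoc)
  moreover have "m \<noteq> 0"
  proof
    assume "m = 0"
    then have "(\<Sum>a\<in>UNIV. ennreal (pmf \<mu> a) * ?I t (P a x)) = 0"
      using law[OF t0] by (simp only: m_def)
    then have "ennreal (pmf \<mu> a) * ?I t (P a x) = 0"
      by (subst (asm) sum_eq_0_iff) auto
    moreover have "ennreal (pmf \<mu> a) \<noteq> 0" using a by (simp add: set_pmf_iff)
    ultimately have "?I t (P a x) = 0"
      using mult_eq_0_iff by blast
    then have "AE w in P a x. indicator ?A w * ennreal (exp (\<xi> t w)) = 0"
      using nn_integral_0_iff_AE[OF measurable_M_P[OF weighted_exp_measurable[OF t0 A]], of a x] by simp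
    then have "AE w in P a x. w \<notin> ?A" by eventually_elim (auto simp: indicator_def)
    then have "emeasure (P a x) ?A = 0"
      using AE_iff_measurable[OF state_event[OF t0, of b a x], of "\<lambda>w. w \<notin> ?A"] by auto
    then show False using transition_any_level[OF t0, of a x b] t by simp
  qed
  ultimately have "1 = ?H"
    using m_fin by (metis ennreal_mult_cancel_left infinity_ennreal_def less_irrefl mult.right_neutral)
  then show ?thesis by simp
qed

text \<open>With \<open>Y\<close> a martingale under every starting point, \<open>f\<close> has the zero function as its image under the extended
  generator; the balance identity says that the explicit formula gives the same function.\<close>

lemma unit_mean_generator:
  assumes unit: "\<And>a t. 0 \<le> t \<Longrightarrow> (\<Sum>b\<in>UNIV. tilted_kernel 1 t a b) = 1"
  shows "extended_generator P F J (\<lambda>t w. exp (\<xi> t w)) (\<lambda>\<alpha> x. x) (\<lambda>\<alpha> x. 0)"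
    and "generator_formula q N L U (\<lambda>\<alpha> x. x) (\<lambda>\<alpha> x. 0)"
proof -
  have "martingale (P a x) F (\<lambda>t w. exp (\<xi> t w) - exp (\<xi> 0 w))" for a x
    by (rule prob_space.martingale_minus_initial[OF prob_space_P unit_mean_martingale[OF unit] exp_xi_0_adapted exp_xi_0_integrable])
  then show "extended_generator P F J (\<lambda>t w. exp (\<xi> t w)) (\<lambda>\<alpha> x. x) (\<lambda>\<alpha> x. 0)"
    unfolding extended_generator_def compensated_martingale_def
    by (simp add: set_integrable_def set_lebesgue_integral_def)
  obtain c where c: "\<And>a t. 0 \<le> t \<Longrightarrow> moment a t = ennreal (exp (c a * t))"
    and int: "\<And>a b. a \<noteq> b \<Longrightarrow> integrable N (\<lambda>w. exp (U a b w))"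
    and balance: "\<And>a. c a + (\<Sum>b\<in>UNIV - {a}. q a b * ((\<integral>w. exp (U a b w) \<partial>N) - 1)) = 0"
    by (rule unit_mean_balance[OF unit]) blast+
  show "generator_formula q N L U (\<lambda>\<alpha> x. x) (\<lambda>\<alpha> x. 0)"
    unfolding generator_formula_def
  proof (intro allI exI conjI impI)
    fix a
    show "levy_generator N (L a) exp (\<lambda>y. c a * exp y)"
      by (rule levy_process.levy_generator_exp[OF levy_L]) (use c in \<open>simp add: moment_def\<close>)
    fix x :: real assume x: "0 < x"
    show "integrable N (\<lambda>w. x * exp (U a b w))" if "b \<noteq> a" for b
      using int[of a b] that by simp
    have "c a * exp (ln x) + (\<Sum>b\<in>UNIV - {a}. q a b * ((\<integral>w. x * exp (U a b w) \<partial>N) - x)) =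
        x * (c a + (\<Sum>b\<in>UNIV - {a}. q a b * ((\<integral>w. exp (U a b w) \<partial>N) - 1)))"
      using x by (simp add: sum_distrib_left algebra_simps)
    then show "0 = c a * exp (ln x) + (\<Sum>b\<in>UNIV - {a}. q a b * ((\<integral>w. x * exp (U a b w) \<partial>N) - x))"
      by (simp add: balance)
  qed
qed

end

text \<open>The pointwise limit that selects the version of the generator determines \<open>k\<close>, and translating the
  starting point by \<open>y\<close> multiplies the difference quotient by \<open>exp y\<close>.\<close>

lemma levy_generator_exp_scales:
  assumes "levy_generator N X exp k"
  shows "k y = exp y * k 0"
proof -
  have k: "((\<lambda>t. ((\<integral>w. exp (y + X t w) \<partial>N) - exp y) / t) \<longlongrightarrow> k y) (at_right 0)" for y
    using assms by (auto simp: levy_generator_def)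
  have lim: "((\<lambda>t. exp y * (((\<integral>w. exp (0 + X t w) \<partial>N) - exp 0) / t)) \<longlongrightarrow> exp y * k 0) (at_right 0)"
    by (intro tendsto_intros k)
  have eq: "exp y * (((\<integral>w. exp (0 + X t w) \<partial>N) - exp 0) / t) = ((\<integral>w. exp (y + X t w) \<partial>N) - exp y) / t" for t
    by (simp add: exp_add algebra_simps)
  have "((\<lambda>t. ((\<integral>w. exp (y + X t w) \<partial>N) - exp y) / t) \<longlongrightarrow> exp y * k 0) (at_right 0)"
    using lim by (simp only: eq)
  then show ?thesis using k by (intro tendsto_unique[OF trivial_limit_at_right_real])
qed

lemma generator_formula_identity_scales:
  assumes g: "generator_formula q N L U (\<lambda>\<alpha> x. x) Af" and x: "0 < x"
  shows "Af a x = x * Af a 1"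
proof -
  have "\<exists>k. levy_generator N (L a) exp k \<and> (\<forall>x>0. (\<forall>b. b \<noteq> a \<longrightarrow> integrable N (\<lambda>w. x * exp (U a b w))) \<and>
      Af a x = k (ln x) + (\<Sum>b\<in>UNIV - {a}. q a b * ((\<integral>w. x * exp (U a b w) \<partial>N) - x)))"
    using g unfolding generator_formula_def by (rule spec)
  then obtain k where k: "levy_generator N (L a) exp k"
    and "\<forall>x>0. (\<forall>b. b \<noteq> a \<longrightarrow> integrable N (\<lambda>w. x * exp (U a b w))) \<and>
      Af a x = k (ln x) + (\<Sum>b\<in>UNIV - {a}. q a b * ((\<integral>w. x * exp (U a b w) \<partial>N) - x))"
    by (elim exE conjE)
  then have Af: "Af a x = k (ln x) + (\<Sum>b\<in>UNIV - {a}. q a b * ((\<integral>w. x * exp (U a b w) \<partial>N) - x))" if "0 < x" for x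
    using that by simp
  have "k (ln x) = x * k 0" using levy_generator_exp_scales[OF k, of "ln x"] x by simp
  then show ?thesis using Af[OF x] Af[of 1] by (simp add: sum_distrib_left algebra_simps)
qed

lemma (in markov_additive_process) vanishing_generator_martingale:
  assumes A: "extended_generator P F J (\<lambda>t w. exp (\<xi> t w)) (\<lambda>\<alpha> x. x) Af"
    and zero: "\<And>a x. 0 < x \<Longrightarrow> Af a x = 0"
  shows "martingale (P a x) F (\<lambda>t w. exp (\<xi> t w))"
proof -
  interpret prob_space "P a x" by (rule prob_space_P)
  have m: "martingale (P a x) F (\<lambda>t w. exp (\<xi> t w) - exp (\<xi> 0 w))"
    using A by (simp add: extended_generator_def compensated_martingale_def zero set_lebesgue_integral_def)
  have "martingale (P a x) F (\<lambda>t w. exp (\<xi> t w) - exp (\<xi> 0 w) - - exp (\<xi> 0 w))"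
    by (rule martingale_minus_initial[OF m]) (use exp_xi_0_adapted exp_xi_0_integrable in auto)
  then show ?thesis by simp
qed

theorem theorem4p1:
  fixes M :: "'w measure"
    and P :: "'e::{finite,discrete_topology} \<Rightarrow> real \<Rightarrow> 'w measure"
    and F :: "real \<Rightarrow> 'w measure"
    and J :: "real \<Rightarrow> 'w \<Rightarrow> 'e"
    and \<xi> Y :: "real \<Rightarrow> 'w \<Rightarrow> real"
    and q :: "'e \<Rightarrow> 'e \<Rightarrow> real"
    and N :: "'l measure"
    and L :: "'e \<Rightarrow> real \<Rightarrow> 'l \<Rightarrow> real"
    and U :: "'e \<Rightarrow> 'e \<Rightarrow> 'l \<Rightarrow> real"
    and f :: "'e \<Rightarrow> real \<Rightarrow> real"
    and \<mu> :: "'e pmf" and x\<^sub>0 :: real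
  assumes F: "F = natural_filtration M state_space (\<lambda>t w. (J t w, \<xi> t w))"
    and map: "markov_additive_process M P F J \<xi>"
    and characteristics: "map_characteristics P J \<xi> q N L U"
    and irreducible: "irreducible_rates q"
    and Y: "Y = (\<lambda>t w. exp (\<xi> t w))"
    and f: "f = (\<lambda>\<alpha> x. x)"
  shows "martingale (initial_law P \<mu> x\<^sub>0) F Y \<longleftrightarrow>
    f \<in> extended_domain P F J Y \<and>
    (\<exists>Af. extended_generator P F J Y f Af \<and> generator_formula q N L U f Af \<and> (\<forall>\<alpha>. Af \<alpha> 1 = 0))"
proof -
  interpret markov_additive_characteristics M P F J \<xi> q N L U
    by (rule markov_additive_characteristics.intro[OF map characteristics])
  show ?thesis
  proof
    assume m: "martingale (initial_law P \<mu> x\<^sub>0) F Y"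
    have unit: "(\<Sum>b\<in>UNIV. tilted_kernel 1 t a b) = 1" if "0 \<le> t" for a t
      using m unfolding Y by (rule martingale_unit_mean[OF _ irreducible that])
    show "f \<in> extended_domain P F J Y \<and>
        (\<exists>Af. extended_generator P F J Y f Af \<and> generator_formula q N L U f Af \<and> (\<forall>\<alpha>. Af \<alpha> 1 = 0))"
      using unit_mean_generator[OF unit] unfolding Y f extended_domain_def by blast
  next
    assume "f \<in> extended_domain P F J Y \<and>
        (\<exists>Af. extended_generator P F J Y f Af \<and> generator_formula q N L U f Af \<and> (\<forall>\<alpha>. Af \<alpha> 1 = 0))"
    then obtain Af where gen: "extended_generator P F J Y f Af"
      and formula: "generator_formula q N L U f Af" and zero: "\<And>\<alpha>. Af \<alpha> 1 = 0" by blast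
    have "Af a x = 0" if "0 < x" for a x
      using generator_formula_identity_scales[OF formula[unfolded f] that, of a] zero by simp
    then show "martingale (initial_law P \<mu> x\<^sub>0) F Y"
      unfolding Y using gen[unfolded Y f]
      by (intro mixture_martingale vanishing_generator_martingale)
  qed
qed

end
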